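(* Let $(X,\phi)$ be a non-compact connected calibrated manifold with $\phi$ parallel, $p=\deg\phi$. Let $K\subset X$ be a compact subset, and let $T$ be a $\Lambda_+(\phi)$-positive $p$-dimensional current with compact support in $X$. If $\partial_\phi\partial T$ is $\le 0$ (a non-positive measure) on $X-\widehat K$, then $$\operatorname{supp} T\ \subset\ \widehat K\cup \mathrm{Core}(X).$$
   Context: A calibrated manifold $(X,\phi)$ is an oriented Riemannian manifold $X$ with a smooth $d$-closed $p$-form $\phi$ of comass one, i.e. $\phi(\xi)\le 1$ for every unit simple $p$-vector $\xi$. A $\phi$-plane is a unit simple $p$-vector $\xi\in\Lambda_pT_xX$ with $\phi(\xi)=1$; $G(\phi)$ denotes the set of all $\phi$-planes. $\phi$ is parallel if $\nabla\phi=0$. For $f\in C^\infty(X)$ let $d^\phi f=\nabla f\lrcorner\phi$ (contraction of $\phi$ with the gradient of $f$). For $\phi$ parallel, $f$ is $\phi$-plurisubharmonic if $(dd^\phi f)(\xi)\ge 0$ for all $\xi\in G(\phi)$, and is strictly $\phi$-plurisubharmonic at $x$ if $(dd^\phi f)(\xi)>0$ for all $\phi$-planes $\xi$ at $x$. $\mathrm{PSH}(X,\phi)\subset C^\infty(X)$ is the set of smooth $\phi$-plurisubharmonic functions. The $\phi$-convex hull of $K\subset X$ is $\widehat K=\{x\in X: f(x)\le\sup_K f\ \text{for all } f\in\mathrm{PSH}(X,\phi)\}$. $\mathrm{Core}(X)$ is the set of $x\in X$ such that no $f\in\mathrm{PSH}(X,\phi)$ is strictly $\phi$-plurisubharmonic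 at $x$. A smooth $p$-form $\alpha$ is $\Lambda^+(\phi)$-positive if $\alpha(\xi)\ge0$ for all $\xi\in G(\phi)$. A $p$-dimensional current $T$ is $\Lambda_+(\phi)$-positive if $T(\alpha)\ge 0$ for all compactly supported $\Lambda^+(\phi)$-positive $p$-forms $\alpha$ (equivalently, $T$ is representable by integration and its generalized tangent $p$-vector $\vec T$ lies in the convex cone generated by $G(\phi)$, $\|T\|$-almost everywhere). For a compactly supported $p$-dimensional current $T$, $\partial_\phi\partial T$ is the compactly supported $0$-dimensional current defined by $(\partial_\phi\partial T)(f)=T(dd^\phi f)$ for $f\in C^\infty(X)$. *)

theory Defs
  imports "HOL-Analysis.Analysis"
begin

section \<open>Smooth maps between open subsets of Euclidean spaces\<close>

definition pd :: "'n::finite \<Rightarrow> (real^'n \<Rightarrow> 'b::real_normed_vector) \<Rightarrow> real^'n \<Rightarrow> 'b" where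
  "pd i f y = frechet_derivative f (at y) (axis i 1)"

primrec iter_pd :: "'n::finite list \<Rightarrow> (real^'n \<Rightarrow> 'b::real_normed_vector) \<Rightarrow> real^'n \<Rightarrow> 'b" where
  "iter_pd [] f = f"
| "iter_pd (i # js) f = pd i (iter_pd js f)"

text \<open>Only used for open \<open>S\<close>: all iterated partial derivatives exist and are
  Frechet differentiable (hence continuous) on \<open>S\<close>.\<close>

definition smooth_on :: "(real^'n::finite) set \<Rightarrow> (real^'n \<Rightarrow> 'b::real_normed_vector) \<Rightarrow> bool" where
  "smooth_on S f \<longleftrightarrow> (\<forall>js. \<forall>y\<in>S. iter_pd js f differentiable (at y))"


section \<open>Oriented manifolds\<close>

text \<open>The manifold is the whole type \<open>'a\<close> (Hausdorff and second countable by type class), of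
  dimension \<open>CARD('n)\<close>. A chart is a pair of its domain and its coordinate map.\<close>

type_synonym ('a, 'n) chart = "'a set \<times> ('a \<Rightarrow> real^'n)"

abbreviation cdom :: "('a, 'n) chart \<Rightarrow> 'a set" where
  "cdom c \<equiv> fst c"

abbreviation cmap :: "('a, 'n) chart \<Rightarrow> 'a \<Rightarrow> real^'n" where
  "cmap c \<equiv> snd c"

definition cimg :: "('a, 'n) chart \<Rightarrow> (real^'n) set" where
  "cimg c = cmap c ` cdom c"

definition cinv :: "('a, 'n) chart \<Rightarrow> real^'n \<Rightarrow> 'a" where
  "cinv c = inv_into (cdom c) (cmap c)"

definition is_chart :: "('a::topological_space, 'n::finite) chart \<Rightarrow> bool" where
  "is_chart c \<longleftrightarrow> open (cdom c) \<and> open (cimg c) \<and>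
     homeomorphism (cdom c) (cimg c) (cmap c) (cinv c)"

definition transition :: "('a, 'n) chart \<Rightarrow> ('a, 'n) chart \<Rightarrow> real^'n \<Rightarrow> real^'n" where
  "transition c d = cmap d \<circ> cinv c"

definition oriented_atlas :: "('a::topological_space, 'n::finite) chart set \<Rightarrow> bool" where
  "oriented_atlas A \<longleftrightarrow>
     (\<forall>c\<in>A. is_chart c) \<and> (\<Union>c\<in>A. cdom c) = UNIV \<and>
     (\<forall>c\<in>A. \<forall>d\<in>A. smooth_on (cmap c ` (cdom c \<inter> cdom d)) (transition c d) \<and>
        (\<forall>y \<in> cmap c ` (cdom c \<inter> cdom d). det (jacobian (transition c d) (at y)) > 0))"

definition smooth_fun :: "('a, 'n::finite) chart set \<Rightarrow> ('a \<Rightarrow> real) \<Rightarrow> bool" where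
  "smooth_fun A f \<longleftrightarrow> (\<forall>c\<in>A. smooth_on (cimg c) (f \<circ> cinv c))"


section \<open>Tangent vectors and differential forms\<close>

text \<open>The tangent space at \<open>x\<close> is identified with \<open>real^'n\<close> by means of one chart
  \<open>chart_at A x\<close> around \<open>x\<close>, chosen once and for all. The choice need not depend
  continuously on \<open>x\<close>: smoothness is always tested in the charts of the atlas, after
  transporting vectors by \<open>from_chart\<close>, the differential of the coordinate change.\<close>

definition chart_at :: "('a, 'n) chart set \<Rightarrow> 'a \<Rightarrow> ('a, 'n) chart" where
  "chart_at A x = (SOME c. c \<in> A \<and> x \<in> cdom c)"

text \<open>\<open>from_chart A c x w\<close> is the tangent vector at \<open>x\<close> with components \<open>w\<close> in the chart \<open>c\<close>.\<close>

definition from_chart :: "('a, 'n::finite) chart set \<Rightarrow> ('a, 'n) chart \<Rightarrow> 'a \<Rightarrow> real^'n \<Rightarrow> real^'n" where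
  "from_chart A c x = frechet_derivative (transition c (chart_at A x)) (at (cmap c x))"

text \<open>The differential \<open>df\<close> at \<open>x\<close>.\<close>

definition differential :: "('a, 'n::finite) chart set \<Rightarrow> ('a \<Rightarrow> real) \<Rightarrow> 'a \<Rightarrow> real^'n \<Rightarrow> real" where
  "differential A f x =
     frechet_derivative (f \<circ> cinv (chart_at A x)) (at (cmap (chart_at A x) x))"

text \<open>Alternating \<open>k\<close>-linear forms take their arguments as a list of length \<open>k\<close>; they vanish on
  lists of any other length, so that equality of forms is equality of functions.\<close>

definition alt_forms :: "nat \<Rightarrow> ((real^'n::finite) list \<Rightarrow> real) set" where
  "alt_forms k = {\<omega>.
     (\<forall>vs. length vs \<noteq> k \<longrightarrow> \<omega> vs = 0) \<and>
     (\<forall>vs i. length vs = k \<longrightarrow> i < k \<longrightarrow> linear (\<lambda>v. \<omega> (vs[i := v]))) \<and>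
     (\<forall>vs i j. length vs = k \<longrightarrow> i < j \<longrightarrow> j < k \<longrightarrow> vs ! i = vs ! j \<longrightarrow> \<omega> vs = 0)}"

type_synonym ('a, 'n) form = "'a \<Rightarrow> (real^'n) list \<Rightarrow> real"

text \<open>The expression of a form in the chart \<open>c\<close>, as a form on \<open>cimg c\<close>.\<close>

definition in_chart ::
  "('a, 'n::finite) chart set \<Rightarrow> ('a, 'n) chart \<Rightarrow> ('a, 'n) form \<Rightarrow> real^'n \<Rightarrow> (real^'n) list \<Rightarrow> real" where
  "in_chart A c \<alpha> y ws = \<alpha> (cinv c y) (map (from_chart A c (cinv c y)) ws)"

definition smooth_forms :: "('a, 'n::finite) chart set \<Rightarrow> nat \<Rightarrow> ('a, 'n) form set" where
  "smooth_forms A k = {\<alpha>. (\<forall>x. \<alpha> x \<in> alt_forms k) \<and>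
     (\<forall>c\<in>A. \<forall>ws. length ws = k \<longrightarrow> smooth_on (cimg c) (\<lambda>y. in_chart A c \<alpha> y ws))}"

definition form_supp :: "('a::topological_space, 'n) form \<Rightarrow> 'a set" where
  "form_supp \<alpha> = closure {x. \<exists>vs. \<alpha> x vs \<noteq> 0}"

definition test_forms :: "('a::topological_space, 'n::finite) chart set \<Rightarrow> nat \<Rightarrow> ('a, 'n) form set" where
  "test_forms A k = {\<alpha> \<in> smooth_forms A k. compact (form_supp \<alpha>)}"

text \<open>The exterior derivative of a \<open>k\<close>-form:
  \<open>(d\<alpha>)(v\<^sub>0, \<dots>, v\<^sub>k) = (\<Sum>i\<le>k. (-1)^i v\<^sub>i(\<alpha>(v\<^sub>0, \<dots>, v\<^sub>k without v\<^sub>i)))\<close>, where the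
  tangent vectors \<open>v\<^sub>j\<close> at \<open>x\<close> are extended to vector fields with constant
  coefficients in the chart \<open>chart_at A x\<close>.\<close>

definition ext_deriv :: "('a, 'n::finite) chart set \<Rightarrow> nat \<Rightarrow> ('a, 'n) form \<Rightarrow> ('a, 'n) form" where
  "ext_deriv A k \<alpha> x vs =
     (if length vs = Suc k then
        (\<Sum>i\<le>k. (-1) ^ i * frechet_derivative
           (\<lambda>y. in_chart A (chart_at A x) \<alpha> y (take i vs @ drop (Suc i) vs))
           (at (cmap (chart_at A x) x)) (vs ! i))
      else 0)"


section \<open>Riemannian metrics, unit simple p-vectors, calibrations\<close>

type_synonym ('a, 'n) metric = "'a \<Rightarrow> real^'n \<Rightarrow> real^'n \<Rightarrow> real"

definition metric_in_chart ::
  "('a, 'n::finite) chart set \<Rightarrow> ('a, 'n) chart \<Rightarrow> ('a, 'n) metric \<Rightarrow> real^'n \<Rightarrow> real^'n \<Rightarrow> real^'n \<Rightarrow> real" where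
  "metric_in_chart A c g y v w =
     g (cinv c y) (from_chart A c (cinv c y) v) (from_chart A c (cinv c y) w)"

definition riemannian_metric :: "('a, 'n::finite) chart set \<Rightarrow> ('a, 'n) metric \<Rightarrow> bool" where
  "riemannian_metric A g \<longleftrightarrow>
     (\<forall>x. bilinear (g x) \<and> (\<forall>v w. g x v w = g x w v) \<and> (\<forall>v. v \<noteq> 0 \<longrightarrow> g x v v > 0)) \<and>
     (\<forall>c\<in>A. \<forall>v w. smooth_on (cimg c) (\<lambda>y. metric_in_chart A c g y v w))"

text \<open>\<open>\<Lambda>\<^sub>p V\<close> is realised as the dual of the space of alternating \<open>p\<close>-forms on \<open>V\<close>, so
  a \<open>p\<close>-form \<open>\<omega>\<close> takes the value \<open>\<xi> \<omega>\<close> on a \<open>p\<close>-vector \<open>\<xi>\<close>; the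
  value of \<open>\<xi>\<close> off \<open>alt_forms p\<close> is normalised to \<open>0\<close>.\<close>

type_synonym 'n pvector = "((real^'n) list \<Rightarrow> real) \<Rightarrow> real"

text \<open>\<open>wedge [v\<^sub>1, \<dots>, v\<^sub>p]\<close> is the simple \<open>p\<close>-vector
  \<open>v\<^sub>1 \<and> \<dots> \<and> v\<^sub>p\<close>.\<close>

definition wedge :: "(real^'n::finite) list \<Rightarrow> 'n pvector" where
  "wedge vs = (\<lambda>\<omega>. if \<omega> \<in> alt_forms (length vs) then \<omega> vs else 0)"

text \<open>The squared norm of \<open>wedge vs\<close> for the inner product \<open>b\<close>: the determinant of the
  matrix of the \<open>b (vs ! i) (vs ! j)\<close>.\<close>

definition gram_det :: "(real^'n \<Rightarrow> real^'n \<Rightarrow> real) \<Rightarrow> (real^'n::finite) list \<Rightarrow> real" where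
  "gram_det b vs = (\<Sum>\<pi> | \<pi> permutes {..<length vs}.
     of_int (sign \<pi>) * (\<Prod>i<length vs. b (vs ! i) (vs ! \<pi> i)))"

definition unit_simple :: "(real^'n \<Rightarrow> real^'n \<Rightarrow> real) \<Rightarrow> nat \<Rightarrow> 'n::finite pvector set" where
  "unit_simple b p = {wedge vs | vs. length vs = p \<and> gram_det b vs = 1}"

definition calibrated_manifold ::
  "('a::topological_space, 'n::finite) chart set \<Rightarrow> ('a, 'n) metric \<Rightarrow> nat \<Rightarrow> ('a, 'n) form \<Rightarrow> bool" where
  "calibrated_manifold A g p \<phi> \<longleftrightarrow>
     oriented_atlas A \<and> riemannian_metric A g \<and>
     \<phi> \<in> smooth_forms A p \<and> (\<forall>x vs. ext_deriv A p \<phi> x vs = 0) \<and>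
     (\<forall>x. \<forall>\<xi> \<in> unit_simple (g x) p. \<xi> (\<phi> x) \<le> 1)"

text \<open>The fibre of \<open>G(\<phi>)\<close> at \<open>x\<close>.\<close>

definition phi_planes :: "('a, 'n::finite) metric \<Rightarrow> nat \<Rightarrow> ('a, 'n) form \<Rightarrow> 'a \<Rightarrow> 'n pvector set" where
  "phi_planes g p \<phi> x = {\<xi> \<in> unit_simple (g x) p. \<xi> (\<phi> x) = 1}"


section \<open>Parallel forms\<close>

definition metric_matrix ::
  "('a, 'n::finite) chart set \<Rightarrow> ('a, 'n) chart \<Rightarrow> ('a, 'n) metric \<Rightarrow> real^'n \<Rightarrow> real^'n^'n" where
  "metric_matrix A c g y = (\<chi> i j. metric_in_chart A c g y (axis i 1) (axis j 1))"

text \<open>\<open>christoffel A c g y l k i\<close> is the Christoffel symbol \<open>\<Gamma>\<close> with upper index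
  \<open>l\<close> and lower indices \<open>k\<close>, \<open>i\<close> of the Levi-Civita connection in the chart \<open>c\<close>.\<close>

definition christoffel ::
  "('a, 'n::finite) chart set \<Rightarrow> ('a, 'n) chart \<Rightarrow> ('a, 'n) metric \<Rightarrow> real^'n \<Rightarrow> 'n \<Rightarrow> 'n \<Rightarrow> 'n \<Rightarrow> real" where
  "christoffel A c g y l k i = (1/2) * (\<Sum>m\<in>UNIV. matrix_inv (metric_matrix A c g y) $ l $ m *
     (pd k (\<lambda>z. metric_matrix A c g z $ i $ m) y
      + pd i (\<lambda>z. metric_matrix A c g z $ k $ m) y
      - pd m (\<lambda>z. metric_matrix A c g z $ k $ i) y))"

text \<open>The component of \<open>\<nabla>\<phi>\<close> in the chart \<open>c\<close>, with differentiation index \<open>k\<close> and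
  form indices \<open>js\<close>.\<close>

definition cov_deriv ::
  "('a, 'n::finite) chart set \<Rightarrow> ('a, 'n) chart \<Rightarrow> ('a, 'n) metric \<Rightarrow> ('a, 'n) form \<Rightarrow> real^'n \<Rightarrow> 'n \<Rightarrow> 'n list \<Rightarrow> real" where
  "cov_deriv A c g \<phi> y k js =
     pd k (\<lambda>z. in_chart A c \<phi> z (map (\<lambda>i. axis i 1) js)) y
     - (\<Sum>a<length js. \<Sum>l\<in>UNIV. christoffel A c g y l k (js ! a) *
          in_chart A c \<phi> y (map (\<lambda>i. axis i 1) (js[a := l])))"

definition parallel_form ::
  "('a, 'n::finite) chart set \<Rightarrow> ('a, 'n) metric \<Rightarrow> nat \<Rightarrow> ('a, 'n) form \<Rightarrow> bool" where
  "parallel_form A g p \<phi> \<longleftrightarrow>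
     (\<forall>c\<in>A. \<forall>y\<in>cimg c. \<forall>k js. length js = p \<longrightarrow> cov_deriv A c g \<phi> y k js = 0)"


section \<open>Plurisubharmonic functions, hulls and the core\<close>

definition grad :: "('a, 'n::finite) chart set \<Rightarrow> ('a, 'n) metric \<Rightarrow> ('a \<Rightarrow> real) \<Rightarrow> 'a \<Rightarrow> real^'n" where
  "grad A g f x = (THE v. \<forall>w. g x v w = differential A f x w)"

definition d_phi ::
  "('a, 'n::finite) chart set \<Rightarrow> ('a, 'n) metric \<Rightarrow> ('a, 'n) form \<Rightarrow> ('a \<Rightarrow> real) \<Rightarrow> ('a, 'n) form" where
  "d_phi A g \<phi> f x vs = \<phi> x (grad A g f x # vs)"

text \<open>\<open>d_phi A g \<phi> f\<close> is a \<open>(p - 1)\<close>-form. In the degenerate case \<open>p = 0\<close> the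
  contraction is the zero function, and so is \<open>dd_phi A g 0 \<phi> f\<close> on the empty list.\<close>

definition dd_phi ::
  "('a, 'n::finite) chart set \<Rightarrow> ('a, 'n) metric \<Rightarrow> nat \<Rightarrow> ('a, 'n) form \<Rightarrow> ('a \<Rightarrow> real) \<Rightarrow> ('a, 'n) form" where
  "dd_phi A g p \<phi> f = ext_deriv A (p - 1) (d_phi A g \<phi> f)"

definition PSH ::
  "('a, 'n::finite) chart set \<Rightarrow> ('a, 'n) metric \<Rightarrow> nat \<Rightarrow> ('a, 'n) form \<Rightarrow> ('a \<Rightarrow> real) set" where
  "PSH A g p \<phi> = {f. smooth_fun A f \<and> (\<forall>x. \<forall>\<xi> \<in> phi_planes g p \<phi> x. \<xi> (dd_phi A g p \<phi> f x) \<ge> 0)}"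

definition strictly_psh_at ::
  "('a, 'n::finite) chart set \<Rightarrow> ('a, 'n) metric \<Rightarrow> nat \<Rightarrow> ('a, 'n) form \<Rightarrow> ('a \<Rightarrow> real) \<Rightarrow> 'a \<Rightarrow> bool" where
  "strictly_psh_at A g p \<phi> f x \<longleftrightarrow> (\<forall>\<xi> \<in> phi_planes g p \<phi> x. \<xi> (dd_phi A g p \<phi> f x) > 0)"

text \<open>The supremum is taken in the extended reals; in particular the hull of the empty set is empty.\<close>

definition hull_phi ::
  "('a, 'n::finite) chart set \<Rightarrow> ('a, 'n) metric \<Rightarrow> nat \<Rightarrow> ('a, 'n) form \<Rightarrow> 'a set \<Rightarrow> 'a set" where
  "hull_phi A g p \<phi> K = {x. \<forall>f \<in> PSH A g p \<phi>. ereal (f x) \<le> (SUP y\<in>K. ereal (f y))}"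

definition core ::
  "('a, 'n::finite) chart set \<Rightarrow> ('a, 'n) metric \<Rightarrow> nat \<Rightarrow> ('a, 'n) form \<Rightarrow> 'a set" where
  "core A g p \<phi> = {x. \<not> (\<exists>f \<in> PSH A g p \<phi>. strictly_psh_at A g p \<phi> f x)}"


section \<open>Currents\<close>

text \<open>A \<open>k\<close>-dimensional current is a continuous linear functional on \<open>test_forms A k\<close>; its values
  elsewhere are irrelevant. Continuity is expressed by the usual estimates: on forms
  supported in a fixed compact subset \<open>L\<close> of a chart domain, \<open>T\<close> is bounded by a
  constant times the supremum \<open>M\<close> over \<open>L\<close> of the derivatives of order at most \<open>N\<close> of the
  coefficients (by partitions of unity this covers all compact sets).\<close>

definition current ::
  "('a::topological_space, 'n::finite) chart set \<Rightarrow> nat \<Rightarrow> (('a, 'n) form \<Rightarrow> real) \<Rightarrow> bool" where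
  "current A k T \<longleftrightarrow>
     (\<forall>\<alpha> \<in> test_forms A k. \<forall>\<beta> \<in> test_forms A k. T (\<lambda>x vs. \<alpha> x vs + \<beta> x vs) = T \<alpha> + T \<beta>) \<and>
     (\<forall>\<alpha> \<in> test_forms A k. \<forall>r. T (\<lambda>x vs. r * \<alpha> x vs) = r * T \<alpha>) \<and>
     (\<forall>c\<in>A. \<forall>L. compact L \<and> L \<subseteq> cdom c \<longrightarrow> (\<exists>N C. \<forall>\<alpha> \<in> test_forms A k. \<forall>M\<ge>0.
        form_supp \<alpha> \<subseteq> L \<and>
        (\<forall>ks js. \<forall>y \<in> cmap c ` L. length ks \<le> N \<and> length js = k \<longrightarrow>
           \<bar>iter_pd ks (\<lambda>z. in_chart A c \<alpha> z (map (\<lambda>i. axis i 1) js)) y\<bar> \<le> M)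
        \<longrightarrow> \<bar>T \<alpha>\<bar> \<le> C * M))"

definition current_supp ::
  "('a::topological_space, 'n::finite) chart set \<Rightarrow> nat \<Rightarrow> (('a, 'n) form \<Rightarrow> real) \<Rightarrow> 'a set" where
  "current_supp A k T = - \<Union>{U. open U \<and> (\<forall>\<alpha> \<in> test_forms A k. form_supp \<alpha> \<subseteq> U \<longrightarrow> T \<alpha> = 0)}"

definition positive_form ::
  "('a, 'n::finite) metric \<Rightarrow> nat \<Rightarrow> ('a, 'n) form \<Rightarrow> ('a, 'n) form \<Rightarrow> bool" where
  "positive_form g p \<phi> \<alpha> \<longleftrightarrow> (\<forall>x. \<forall>\<xi> \<in> phi_planes g p \<phi> x. \<xi> (\<alpha> x) \<ge> 0)"

definition positive_current ::
  "('a::topological_space, 'n::finite) chart set \<Rightarrow> ('a, 'n) metric \<Rightarrow> nat \<Rightarrow> ('a, 'n) form \<Rightarrow> (('a, 'n) form \<Rightarrow> real) \<Rightarrow> bool" where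
  "positive_current A g p \<phi> T \<longleftrightarrow> (\<forall>\<alpha> \<in> test_forms A p. positive_form g p \<phi> \<alpha> \<longrightarrow> T \<alpha> \<ge> 0)"

text \<open>A compactly supported current extends to all smooth forms by
  \<open>T(\<alpha>) = T(\<eta>\<alpha>)\<close>, where \<open>\<eta>\<close> is any compactly supported smooth function equal to \<open>1\<close>
  near the support of \<open>T\<close>; the value does not depend on \<open>\<eta>\<close>.\<close>

definition cutoff :: "('a::topological_space, 'n::finite) chart set \<Rightarrow> 'a set \<Rightarrow> ('a \<Rightarrow> real) \<Rightarrow> bool" where
  "cutoff A S \<eta> \<longleftrightarrow> smooth_fun A \<eta> \<and> compact (closure {x. \<eta> x \<noteq> 0}) \<and>
     (\<exists>U. open U \<and> S \<subseteq> U \<and> (\<forall>x\<in>U. \<eta> x = 1))"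

definition extend_current ::
  "('a::topological_space, 'n::finite) chart set \<Rightarrow> nat \<Rightarrow> (('a, 'n) form \<Rightarrow> real) \<Rightarrow> ('a, 'n) form \<Rightarrow> real" where
  "extend_current A k T \<alpha> =
     T (\<lambda>x vs. (SOME \<eta>. cutoff A (current_supp A k T) \<eta>) x * \<alpha> x vs)"

text \<open>The \<open>0\<close>-dimensional current \<open>f \<mapsto> T(dd\<^sup>\<phi>f)\<close>.\<close>

definition del_phi_del ::
  "('a::topological_space, 'n::finite) chart set \<Rightarrow> ('a, 'n) metric \<Rightarrow> nat \<Rightarrow> ('a, 'n) form \<Rightarrow> (('a, 'n) form \<Rightarrow> real) \<Rightarrow> ('a \<Rightarrow> real) \<Rightarrow> real" where
  "del_phi_del A g p \<phi> T f = extend_current A p T (dd_phi A g p \<phi> f)"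

text \<open>\<open>S \<le> 0\<close> on the open set \<open>U\<close> for a \<open>0\<close>-dimensional current \<open>S\<close>. (Such an \<open>S\<close>
  is automatically given on \<open>U\<close> by a non-positive measure.)\<close>

definition nonpos_on ::
  "('a::topological_space, 'n::finite) chart set \<Rightarrow> (('a \<Rightarrow> real) \<Rightarrow> real) \<Rightarrow> 'a set \<Rightarrow> bool" where
  "nonpos_on A S U \<longleftrightarrow> (\<forall>f. smooth_fun A f \<and> compact (closure {x. f x \<noteq> 0}) \<and>
     closure {x. f x \<noteq> 0} \<subseteq> U \<and> (\<forall>x. f x \<ge> 0) \<longrightarrow> S f \<le> 0)"

end

theory Submission
  imports Defs
begin

text \<open>Suppose that a point \<open>x\<close> of the support of \<open>T\<close> lies neither in the hull of \<open>K\<close> nor in the core.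
  Some plurisubharmonic function separates \<open>x\<close> from \<open>K\<close>, and another one is strict at \<open>x\<close>.
  Adding a small multiple of the second to the first and composing with a convex increasing
  function that vanishes up to a level between a bound on \<open>K\<close> and the value at \<open>x\<close> gives a
  nonnegative plurisubharmonic function \<open>F\<close> that is zero near the hull and strict at \<open>x\<close>
  (\<open>psh_separating_hull\<close>). That composition preserves plurisubharmonicity rests on the first
  cousin principle: a form of comass one is stationary at the planes where it attains the value
  one, which makes \<open>df \<and> d\<^sup>\<phi>f\<close> nonnegative on \<open>\<phi>\<close>-planes (\<open>contraction_plane_nonneg\<close>).

  After multiplication by a cutoff function equal to \<open>1\<close> near the support of \<open>T\<close>, \<open>F\<close> is a
  test function for the hypothesis on \<open>\<partial>\<^sub>\<phi>\<partial>T\<close>, so \<open>T(dd\<^sup>\<phi>F) \<le> 0\<close>. On the other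
  hand \<open>dd\<^sup>\<phi>F\<close> is nonnegative on all \<open>\<phi>\<close>-planes and, since the \<open>\<phi>\<close>-planes over a compact
  set form a compact set, bounded below by a positive constant on those over a neighbourhood of
  \<open>x\<close>. Hence every form \<open>\<alpha>\<close> supported there satisfies \<open>|\<alpha>| \<le> C dd\<^sup>\<phi>F\<close> on \<open>\<phi>\<close>-planes
  (\<open>strictly_positive_form_dominates\<close>), and positivity of \<open>T\<close> gives
  \<open>|T(\<alpha>)| \<le> C T(dd\<^sup>\<phi>F) \<le> 0\<close>. So \<open>T\<close> vanishes near \<open>x\<close>, a contradiction.

  For these evaluations of \<open>T\<close> to make sense, \<open>dd\<^sup>\<phi>F\<close> must be a smooth form. This is
  where the analysis lies: the gradient is smooth by Cramer's rule, and the exterior derivative,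
  which is computed at each point in a chart of its own, has the same formula in all charts
  because second derivatives are symmetric (\<open>chart_ext_deriv_transition\<close>). That \<open>T\<close> does not
  see forms supported away from its support (\<open>current_zero_off_supp\<close>) follows from the existence
  of smooth bump functions.\<close>

section \<open>Calculus of smooth functions on open subsets of Euclidean space\<close>

abbreviation fderiv :: "(real^'n::finite \<Rightarrow> 'b::real_normed_vector) \<Rightarrow> real^'n \<Rightarrow> real^'n \<Rightarrow> 'b" where
  "fderiv f y \<equiv> frechet_derivative f (at y)"

lemma has_derivative_cong_open:
  assumes "open S" "y \<in> S" "\<And>z. z \<in> S \<Longrightarrow> f z = g z"
  shows "(f has_derivative D) (at y) \<longleftrightarrow> (g has_derivative D) (at y)"
  using assms has_derivative_transform_within_open[of f D y UNIV S g]
    has_derivative_transform_within_open[of g D y UNIV S f] by auto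

lemma differentiable_cong_open:
  assumes "open S" "y \<in> S" "\<And>z. z \<in> S \<Longrightarrow> f z = g z"
  shows "f differentiable (at y) \<longleftrightarrow> g differentiable (at y)"
  using has_derivative_cong_open[OF assms] by (auto simp: differentiable_def)

lemma frechet_derivative_cong_open:
  assumes "open S" "y \<in> S" "\<And>z. z \<in> S \<Longrightarrow> f z = g z"
  shows "fderiv f y = fderiv g y"
  unfolding frechet_derivative_def using has_derivative_cong_open[OF assms] by simp

lemma pd_cong_open:
  assumes "open S" "y \<in> S" "\<And>z. z \<in> S \<Longrightarrow> f z = g z"
  shows "pd i f y = pd i g y"
  unfolding pd_def using frechet_derivative_cong_open[OF assms] by simp

lemma pd_eq:
  assumes "(f has_derivative D) (at y)"
  shows "pd i f y = D (axis i 1)"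
  unfolding pd_def using frechet_derivative_at[OF assms] by simp

lemma frechet_derivative_eqI: "(f has_derivative D) (at y) \<Longrightarrow> fderiv f y v = D v"
  using frechet_derivative_at[of f D y] by simp

lemma iter_pd_append: "iter_pd (js @ ks) f = iter_pd js (iter_pd ks f)"
  by (induction js) auto

text \<open>Smoothness quantifies over all iterated partial derivatives with the list of indices growing at
  the outside, which does not fit the product and chain rules. Recursion on the order of
  differentiability, taking one derivative first, turns each closure property into an
  induction on the order.\<close>

primrec diff_upto :: "nat \<Rightarrow> (real^'n::finite) set \<Rightarrow> (real^'n \<Rightarrow> 'b::real_normed_vector) \<Rightarrow> bool" where
  "diff_upto 0 S f \<longleftrightarrow> (\<forall>y\<in>S. f differentiable (at y))"
| "diff_upto (Suc n) S f \<longleftrightarrow> (\<forall>y\<in>S. f differentiable (at y)) \<and> (\<forall>i. diff_upto n S (pd i f))"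

lemma diff_upto_iff:
  "diff_upto n S f \<longleftrightarrow> (\<forall>js. length js \<le> n \<longrightarrow> (\<forall>y\<in>S. iter_pd js f differentiable (at y)))"
proof (induction n arbitrary: f)
  case 0
  then show ?case by simp
next
  case (Suc n)
  show ?case
  proof
    assume L: "diff_upto (Suc n) S f"
    show "\<forall>js. length js \<le> Suc n \<longrightarrow> (\<forall>y\<in>S. iter_pd js f differentiable at y)"
    proof (intro allI impI)
      fix js :: "'a list" assume "length js \<le> Suc n"
      then show "\<forall>y\<in>S. iter_pd js f differentiable at y"
        using L by (cases js rule: rev_cases) (auto simp: iter_pd_append Suc.IH)
    qed
  next
    assume R: "\<forall>js. length js \<le> Suc n \<longrightarrow> (\<forall>y\<in>S. iter_pd js f differentiable at y)"
    have "\<forall>y\<in>S. f differentiable at y" using R[rule_format, of "[]"] by simp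
    moreover have "diff_upto n S (pd i f)" for i
      unfolding Suc.IH using R[rule_format, of "_ @ [i]"] by (simp add: iter_pd_append)
    ultimately show "diff_upto (Suc n) S f" by simp
  qed
qed

lemma smooth_on_iff_diff_upto: "smooth_on S f \<longleftrightarrow> (\<forall>n. diff_upto n S f)"
  unfolding smooth_on_def diff_upto_iff by blast

lemma diff_upto_imp_differentiable: "diff_upto n S f \<Longrightarrow> y \<in> S \<Longrightarrow> f differentiable (at y)"
  by (cases n) auto

lemma diff_upto_Suc_D: "diff_upto (Suc n) S f \<Longrightarrow> diff_upto n S f"
  unfolding diff_upto_iff by auto

lemma diff_upto_cong:
  assumes "open S" "\<And>z. z \<in> S \<Longrightarrow> f z = g z" "diff_upto n S f"
  shows "diff_upto n S g"
  using assms(2,3)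
proof (induction n arbitrary: f g)
  case 0
  then show ?case using differentiable_cong_open[OF assms(1), of _ f g] by auto
next
  case (Suc n)
  have "pd i f z = pd i g z" if "z \<in> S" for i z
    using pd_cong_open[OF assms(1) that] Suc.prems(1) by blast
  then have "diff_upto n S (pd i g)" for i
    using Suc.IH[of "pd i f" "pd i g"] Suc.prems(2) by auto
  then show ?case
    using Suc.prems differentiable_cong_open[OF assms(1), of _ f g] by auto
qed

lemma smooth_on_cong:
  assumes "open S" "\<And>z. z \<in> S \<Longrightarrow> f z = g z"
  shows "smooth_on S f \<longleftrightarrow> smooth_on S g"
  unfolding smooth_on_iff_diff_upto using diff_upto_cong[OF assms(1)] assms(2) by metis

lemma smooth_on_differentiable: "smooth_on S f \<Longrightarrow> y \<in> S \<Longrightarrow> f differentiable (at y)"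
  unfolding smooth_on_iff_diff_upto using diff_upto_imp_differentiable by blast

lemma smooth_on_has_derivative:
  "smooth_on S f \<Longrightarrow> y \<in> S \<Longrightarrow> (f has_derivative fderiv f y) (at y)"
  using smooth_on_differentiable frechet_derivative_works by blast

lemma smooth_on_continuous_on: "smooth_on S f \<Longrightarrow> continuous_on S f"
  using smooth_on_differentiable differentiable_imp_continuous_within
  by (metis continuous_at_imp_continuous_on)

lemma smooth_on_pd: "smooth_on S f \<Longrightarrow> smooth_on S (pd i f)"
  unfolding smooth_on_iff_diff_upto using diff_upto.simps(2) by blast

lemma smooth_on_subset: "smooth_on S f \<Longrightarrow> S' \<subseteq> S \<Longrightarrow> smooth_on S' f"
  unfolding smooth_on_def by blast

lemma smooth_on_locally:
  "(\<And>y. y \<in> S \<Longrightarrow> \<exists>U. y \<in> U \<and> smooth_on U f) \<Longrightarrow> smooth_on S f"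
  unfolding smooth_on_def by blast

lemma diff_upto_const: "diff_upto n S (\<lambda>_. c)"
proof (induction n arbitrary: c)
  case (Suc n)
  have "pd i (\<lambda>_. c) = (\<lambda>_. 0)" for i :: 'a
    by (rule ext) (simp add: pd_def)
  then show ?case using Suc by simp
qed simp

lemma smooth_on_const [simp]: "smooth_on S (\<lambda>_. c)"
  unfolding smooth_on_iff_diff_upto using diff_upto_const by blast

lemma smooth_on_bounded_linear:
  assumes "bounded_linear L"
  shows "smooth_on S L"
proof -
  have d: "(L has_derivative L) (at y)" for y
    using assms by (rule bounded_linear_imp_has_derivative)
  have "pd i L = (\<lambda>_. L (axis i 1))" for i
    by (rule ext) (rule pd_eq[OF d])
  then have "diff_upto n S L" for n
    using d by (cases n) (auto simp: differentiable_def diff_upto_const)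
  then show ?thesis unfolding smooth_on_iff_diff_upto by blast
qed

lemma diff_upto_bounded_linear_comp:
  assumes "open S" "bounded_linear L" "diff_upto n S f"
  shows "diff_upto n S (\<lambda>y. L (f y))"
  using assms(3)
proof (induction n arbitrary: f)
  case 0
  then show ?case
    by (metis assms(2) diff_upto.simps(1) bounded_linear.has_derivative differentiable_def)
next
  case (Suc n)
  have d: "((\<lambda>y. L (f y)) has_derivative (\<lambda>v. L (fderiv f y v))) (at y)"
    if "y \<in> S" for y
    using Suc.prems that bounded_linear.has_derivative[OF assms(2)] frechet_derivative_works
    by (metis diff_upto.simps(2))
  have "L (pd i f y) = pd i (\<lambda>y. L (f y)) y" if "y \<in> S" for i y
    using pd_eq[OF d[OF that]] by (simp add: pd_def)
  then have "diff_upto n S (pd i (\<lambda>y. L (f y)))" for i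
    by (rule diff_upto_cong[OF assms(1)]) (use Suc in auto)
  then show ?case using d by (auto simp: differentiable_def)
qed

lemma smooth_on_bounded_linear_comp:
  "open S \<Longrightarrow> bounded_linear L \<Longrightarrow> smooth_on S f \<Longrightarrow> smooth_on S (\<lambda>y. L (f y))"
  unfolding smooth_on_iff_diff_upto using diff_upto_bounded_linear_comp by blast

lemma smooth_on_nth: "open S \<Longrightarrow> smooth_on S f \<Longrightarrow> smooth_on S (\<lambda>y. f y $ l)"
  by (rule smooth_on_bounded_linear_comp[OF _ bounded_linear_vec_nth])

lemma diff_upto_add:
  assumes "open S" "diff_upto n S f" "diff_upto n S g"
  shows "diff_upto n S (\<lambda>y. f y + g y)"
  using assms(2,3)
proof (induction n arbitrary: f g)
  case 0
  then show ?case by (simp add: differentiable_add)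
next
  case (Suc n)
  have d: "((\<lambda>y. f y + g y) has_derivative
      (\<lambda>v. fderiv f y v + fderiv g y v)) (at y)"
    if "y \<in> S" for y
    using Suc.prems that has_derivative_add[of f _ "at y" g] frechet_derivative_works[of f "at y"]
      frechet_derivative_works[of g "at y"] by simp
  have "pd i f y + pd i g y = pd i (\<lambda>y. f y + g y) y" if "y \<in> S" for i y
    using pd_eq[OF d[OF that]] by (simp add: pd_def)
  then have "diff_upto n S (pd i (\<lambda>y. f y + g y))" for i
    by (rule diff_upto_cong[OF assms(1)]) (use Suc in auto)
  then show ?case using d by (auto simp: differentiable_def)
qed

lemma smooth_on_add:
  "open S \<Longrightarrow> smooth_on S f \<Longrightarrow> smooth_on S g \<Longrightarrow> smooth_on S (\<lambda>y. f y + g y)"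
  unfolding smooth_on_iff_diff_upto using diff_upto_add by blast

lemma diff_upto_mult:
  fixes f g :: "real^'n::finite \<Rightarrow> real"
  assumes "open S" "diff_upto n S f" "diff_upto n S g"
  shows "diff_upto n S (\<lambda>y. f y * g y)"
  using assms(2,3)
proof (induction n arbitrary: f g)
  case 0
  then show ?case by (simp add: differentiable_mult)
next
  case (Suc n)
  have d: "((\<lambda>y. f y * g y) has_derivative
      (\<lambda>v. f y * fderiv g y v + fderiv f y v * g y)) (at y)"
    if "y \<in> S" for y
    using Suc.prems that has_derivative_mult[of f _ y UNIV g] frechet_derivative_works[of f "at y"]
      frechet_derivative_works[of g "at y"] by simp
  have e: "f y * pd i g y + pd i f y * g y = pd i (\<lambda>y. f y * g y) y" if "y \<in> S" for i y
    using pd_eq[OF d[OF that]] by (simp add: pd_def)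
  have "diff_upto n S (\<lambda>y. f y * pd i g y + pd i f y * g y)" for i
    using Suc.IH[OF diff_upto_Suc_D[OF Suc.prems(1)], of "pd i g"]
      Suc.IH[OF _ diff_upto_Suc_D[OF Suc.prems(2)], of "pd i f"] Suc.prems
    by (simp add: diff_upto_add[OF assms(1)])
  then have "diff_upto n S (pd i (\<lambda>y. f y * g y))" for i
    by (rule diff_upto_cong[OF assms(1), rotated]) (rule e)
  then show ?case using d by (auto simp: differentiable_def)
qed

lemma smooth_on_mult:
  fixes f g :: "real^'n::finite \<Rightarrow> real"
  shows "open S \<Longrightarrow> smooth_on S f \<Longrightarrow> smooth_on S g \<Longrightarrow> smooth_on S (\<lambda>y. f y * g y)"
  unfolding smooth_on_iff_diff_upto using diff_upto_mult by blast

lemma smooth_on_cmult: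
  fixes f :: "real^'n::finite \<Rightarrow> real"
  shows "open S \<Longrightarrow> smooth_on S f \<Longrightarrow> smooth_on S (\<lambda>y. c * f y)"
  by (rule smooth_on_mult) simp_all

lemma smooth_on_diff:
  fixes f g :: "real^'n::finite \<Rightarrow> real"
  assumes "open S" "smooth_on S f" "smooth_on S g"
  shows "smooth_on S (\<lambda>y. f y - g y)"
  using smooth_on_add[OF assms(1,2) smooth_on_cmult[OF assms(1,3), of "-1"]] by simp

lemma smooth_on_sum:
  "open S \<Longrightarrow> (\<And>i. i \<in> I \<Longrightarrow> smooth_on S (f i)) \<Longrightarrow> smooth_on S (\<lambda>y. \<Sum>i\<in>I. f i y)"
  by (induction I rule: infinite_finite_induct) (simp_all add: smooth_on_add)

lemma smooth_on_prod:
  fixes f :: "'i \<Rightarrow> real^'n::finite \<Rightarrow> real"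
  shows "open S \<Longrightarrow> (\<And>i. i \<in> I \<Longrightarrow> smooth_on S (f i)) \<Longrightarrow> smooth_on S (\<lambda>y. \<Prod>i\<in>I. f i y)"
  by (induction I rule: infinite_finite_induct) (simp_all add: smooth_on_mult)

lemma linear_axis_expansion:
  fixes L :: "real^'n::finite \<Rightarrow> 'b::real_vector"
  assumes "linear L"
  shows "L v = (\<Sum>l\<in>UNIV. v $ l *\<^sub>R L (axis l 1))"
proof -
  have "L v = L (\<Sum>l\<in>UNIV. v $ l *\<^sub>R axis l 1)"
    by (simp add: basis_expansion scalar_mult_eq_scaleR[symmetric])
  also have "\<dots> = (\<Sum>l\<in>UNIV. v $ l *\<^sub>R L (axis l 1))"
    using assms by (simp add: linear_sum linear_cmul)
  finally show ?thesis .
qed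

lemma frechet_derivative_axis_expansion:
  assumes "f differentiable (at y)"
  shows "fderiv f y v = (\<Sum>l\<in>UNIV. v $ l *\<^sub>R pd l f y)"
  unfolding pd_def
  by (rule linear_axis_expansion) (simp add: assms linear_frechet_derivative)

lemma smooth_on_frechet_derivative:
  fixes f :: "real^'n::finite \<Rightarrow> real"
  assumes "open S" "smooth_on S f"
  shows "smooth_on S (\<lambda>y. fderiv f y v)"
proof -
  have "smooth_on S (\<lambda>y. \<Sum>l\<in>UNIV. v $ l * pd l f y)"
    by (intro smooth_on_sum smooth_on_cmult smooth_on_pd assms)
  then show ?thesis
    using frechet_derivative_axis_expansion[OF smooth_on_differentiable[OF assms(2)]]
      smooth_on_cong[OF assms(1)] by (metis (mono_tags, lifting) real_scaleR_def sum.cong)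
qed

text \<open>By the chain rule a partial derivative of \<open>f \<circ> h\<close> is a sum of products of functions
  \<open>pd l f \<circ> h\<close> with smooth functions, and the induction hypothesis applies to \<open>pd l f\<close>.\<close>

lemma diff_upto_compose:
  fixes f :: "real^'m::finite \<Rightarrow> real" and h :: "real^'n::finite \<Rightarrow> real^'m"
  assumes "open S" "smooth_on S h" "h ` S \<subseteq> V" "diff_upto n V f"
  shows "diff_upto n S (\<lambda>y. f (h y))"
  using assms(4)
proof (induction n arbitrary: f)
  case 0
  have "(\<lambda>y. f (h y)) differentiable (at y)" if "y \<in> S" for y
    using differentiable_chain_at[of h y f] smooth_on_differentiable[OF assms(2) that] 0 that assms(3)
    by (auto simp: o_def)
  then show ?case by simp
next
  case (Suc n)
  have d: "((\<lambda>y. f (h y)) has_derivative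
      (\<lambda>v. fderiv f (h y) (fderiv h y v))) (at y)" if "y \<in> S" for y
  proof -
    have "(f has_derivative fderiv f (h y)) (at (h y))"
      using Suc.prems that assms(3) frechet_derivative_works[of f "at (h y)"] by auto
    then show ?thesis
      using diff_chain_at[OF smooth_on_has_derivative[OF assms(2) that]] by (simp add: o_def)
  qed
  have e: "(\<Sum>l\<in>UNIV. pd i h y $ l * pd l f (h y)) = pd i (\<lambda>y. f (h y)) y" if "y \<in> S" for i y
  proof -
    have "f differentiable at (h y)" using Suc.prems that assms(3) by auto
    then show ?thesis
      using pd_eq[OF d[OF that]] frechet_derivative_axis_expansion[of f "h y" "pd i h y"]
      by (simp add: pd_def)
  qed
  have "diff_upto n S (\<lambda>y. \<Sum>l\<in>UNIV. pd i h y $ l * pd l f (h y))" for i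
  proof -
    have "diff_upto n S (\<lambda>y. \<Sum>l\<in>I. pd i h y $ l * pd l f (h y))" if "finite I" for I
      using that
    proof induction
      case empty show ?case by (simp add: diff_upto_const)
    next
      case (insert l I)
      have "diff_upto n S (\<lambda>y. pd i h y $ l)"
        using smooth_on_nth[OF assms(1) smooth_on_pd[OF assms(2)]] smooth_on_iff_diff_upto by blast
      then show ?case
        using insert Suc by (simp add: diff_upto_add diff_upto_mult assms(1))
    qed
    then show ?thesis by simp
  qed
  then have "diff_upto n S (pd i (\<lambda>y. f (h y)))" for i
    by (rule diff_upto_cong[OF assms(1), rotated]) (rule e)
  then show ?case using d by (auto simp: differentiable_def)
qed

lemma smooth_on_compose:
  fixes f :: "real^'m::finite \<Rightarrow> real" and h :: "real^'n::finite \<Rightarrow> real^'m"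
  assumes "open S" "smooth_on S h" "h ` S \<subseteq> V" "smooth_on V f"
  shows "smooth_on S (\<lambda>y. f (h y))"
  using assms unfolding smooth_on_iff_diff_upto[of V] smooth_on_iff_diff_upto[of S "\<lambda>y. f (h y)"]
  using diff_upto_compose by blast

text \<open>Composition with a function of one real variable, given inside a family closed under
  differentiation. This replaces a separate theory of smooth functions on the line: the
  two families needed are the multiples of powers of \<open>1/t\<close> and the flat functions
  below.\<close>

lemma smooth_on_compose_real:
  fixes f :: "real^'n::finite \<Rightarrow> real"
  assumes "open S" "smooth_on S f" "\<And>y. y \<in> S \<Longrightarrow> f y \<in> V"
    and step: "\<And>\<psi>. \<psi> \<in> \<Psi> \<Longrightarrow> \<exists>\<psi>'\<in>\<Psi>. \<forall>t\<in>V. (\<psi> has_real_derivative \<psi>' t) (at t)"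
    and "\<psi> \<in> \<Psi>"
  shows "smooth_on S (\<lambda>y. \<psi> (f y))"
proof -
  have "diff_upto n S (\<lambda>y. \<psi> (f y))" for n
    using \<open>\<psi> \<in> \<Psi>\<close>
  proof (induction n arbitrary: \<psi>)
    case 0
    then obtain \<psi>' where p: "\<psi>'\<in>\<Psi>" "\<And>t. t\<in>V \<Longrightarrow> (\<psi> has_real_derivative \<psi>' t) (at t)"
      using step by blast
    have "(\<lambda>y. \<psi> (f y)) differentiable (at y)" if "y \<in> S" for y
      using differentiable_chain_at[of f y \<psi>] p(2)[OF assms(3)[OF that]]
        smooth_on_differentiable[OF assms(2) that] real_differentiable_def
      by (auto simp: o_def)
    then show ?case by simp
  next
    case (Suc n)
    then obtain \<psi>' where p: "\<psi>'\<in>\<Psi>" "\<And>t. t\<in>V \<Longrightarrow> (\<psi> has_real_derivative \<psi>' t) (at t)"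
      using step by blast
    have d: "((\<lambda>y. \<psi> (f y)) has_derivative
        (\<lambda>v. \<psi>' (f y) * fderiv f y v)) (at y)" if "y \<in> S" for y
      using diff_chain_at[OF smooth_on_has_derivative[OF assms(2) that]
          p(2)[OF assms(3)[OF that], unfolded has_field_derivative_def]] by (simp add: o_def)
    have e: "\<psi>' (f y) * pd i f y = pd i (\<lambda>y. \<psi> (f y)) y" if "y \<in> S" for i y
      using pd_eq[OF d[OF that]] by (simp add: pd_def)
    have "diff_upto n S (\<lambda>y. \<psi>' (f y) * pd i f y)" for i
      using Suc.IH[OF p(1)] smooth_on_pd[OF assms(2)] smooth_on_iff_diff_upto
      by (intro diff_upto_mult assms(1)) auto
    then have "diff_upto n S (pd i (\<lambda>y. \<psi> (f y)))" for i
      by (rule diff_upto_cong[OF assms(1), rotated]) (rule e)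
    then show ?case using d by (auto simp: differentiable_def)
  qed
  then show ?thesis unfolding smooth_on_iff_diff_upto by blast
qed

lemma smooth_on_inverse:
  fixes f :: "real^'n::finite \<Rightarrow> real"
  assumes "open S" "smooth_on S f" "\<And>y. y \<in> S \<Longrightarrow> f y \<noteq> 0"
  shows "smooth_on S (\<lambda>y. inverse (f y))"
proof (rule smooth_on_compose_real[where \<psi> = inverse and V = "-{0}" and \<Psi> = "{\<lambda>t. a * inverse t ^ k | a k. True}"])
  fix \<psi> :: "real \<Rightarrow> real" assume "\<psi> \<in> {\<lambda>t. a * inverse t ^ k |a k. True}"
  then obtain a k where \<psi>: "\<psi> = (\<lambda>t. a * inverse t ^ k)" by blast
  have d: "\<forall>t\<in>-{0}. (\<psi> has_real_derivative (- a * real k) * inverse t ^ Suc k) (at t)"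
  proof
    fix t :: real assume "t \<in> -{0}"
    then have i: "(inverse has_real_derivative - (inverse t * inverse t)) (at t)"
      using DERIV_inverse[of t UNIV] by (simp add: power2_eq_square numeral_2_eq_2)
    have "(\<psi> has_real_derivative a * (real k * (- (inverse t * inverse t) * inverse t ^ (k - Suc 0)))) (at t)"
      unfolding \<psi> by (intro DERIV_cmult DERIV_power i)
    then show "(\<psi> has_real_derivative (- a * real k) * inverse t ^ Suc k) (at t)"
      by (cases k) (simp_all add: mult_ac)
  qed
  show "\<exists>\<psi>'\<in>{\<lambda>t. a * inverse t ^ k |a k. True}. \<forall>t\<in>- {0}. (\<psi> has_real_derivative \<psi>' t) (at t)"
    by (rule bexI[of _ "\<lambda>t. (- a * real k) * inverse t ^ Suc k"]) (use d in blast)+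
next
  show "(inverse :: real \<Rightarrow> real) \<in> {\<lambda>t. a * inverse t ^ k |a k. True}"
    by (rule CollectI, rule exI[of _ 1], rule exI[of _ "Suc 0"]) (simp add: fun_eq_iff)
qed (use assms in auto)

lemma smooth_on_divide:
  fixes f g :: "real^'n::finite \<Rightarrow> real"
  assumes "open S" "smooth_on S f" "smooth_on S g" "\<And>y. y \<in> S \<Longrightarrow> g y \<noteq> 0"
  shows "smooth_on S (\<lambda>y. f y / g y)"
  unfolding divide_inverse by (intro smooth_on_mult smooth_on_inverse assms)

lemma smooth_on_det:
  fixes M :: "real^'m::finite \<Rightarrow> real^'n::finite^'n"
  assumes "open S" "\<And>i j. smooth_on S (\<lambda>y. M y $ i $ j)"
  shows "smooth_on S (\<lambda>y. det (M y))"
  unfolding det_def by (intro smooth_on_sum smooth_on_cmult smooth_on_prod assms)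

section \<open>Flat functions and a smooth step\<close>

text \<open>Differentiation turns \<open>P\<close> into \<open>X\<^sup>2 (P - P')\<close>, so the functions \<open>flat P\<close> form a family
  closed under differentiation.\<close>

definition flat :: "real poly \<Rightarrow> real \<Rightarrow> real" where
  "flat P t = (if t > 0 then poly P (inverse t) * exp (- inverse t) else 0)"

lemma flat_has_derivative:
  "(flat P has_real_derivative flat ([:0, 0, 1:] * (P - pderiv P)) t) (at t)"
proof -
  consider "t > 0" | "t < 0" | "t = 0" by linarith
  then show ?thesis
  proof cases
    case 1
    have i: "(inverse has_real_derivative - (inverse t * inverse t)) (at t)"
      using DERIV_inverse[of t UNIV] 1 by (simp add: power2_eq_square numeral_2_eq_2)
    have "((\<lambda>t. poly P (inverse t) * exp (- inverse t)) has_real_derivative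
       poly (pderiv P) (inverse t) * - (inverse t * inverse t) * exp (- inverse t)
        + exp (- inverse t) * - (- (inverse t * inverse t)) * poly P (inverse t)) (at t)"
      by (intro DERIV_mult DERIV_chain2[OF poly_DERIV i] DERIV_chain2[OF DERIV_exp] DERIV_minus i)
    then have "((\<lambda>t. poly P (inverse t) * exp (- inverse t)) has_real_derivative
       flat ([:0, 0, 1:] * (P - pderiv P)) t) (at t)"
      using 1 by (simp add: flat_def algebra_simps)
    then show ?thesis
      using 1 has_field_derivative_transform_within_open[of _ _ t "{0<..}" "flat P"]
      by (auto simp: flat_def)
  next
    case 2
    have "((\<lambda>t. 0) has_real_derivative flat ([:0, 0, 1:] * (P - pderiv P)) t) (at t)"
      using 2 by (simp add: flat_def)
    then show ?thesis
      using 2 has_field_derivative_transform_within_open[of "\<lambda>t. 0" _ t "{..<0}" "flat P"]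
      by (auto simp: flat_def)
  next
    case 3
    \<comment> \<open>With \<open>s = 1/t\<close> the difference quotient is \<open>s P(s) exp (- s)\<close>, which tends to \<open>0\<close>
      as \<open>s\<close> tends to infinity.\<close>
    have lim: "((\<lambda>s. poly Q s * exp (- s)) \<longlongrightarrow> (0::real)) at_top" for Q
    proof (induction Q)
      case (pCons a Q)
      have m: "((\<lambda>s::real. s ^ k * exp (- s)) \<longlongrightarrow> 0) at_top" for k
        using tendsto_power_div_exp_0[of k] by (simp add: exp_minus field_simps)
      have "((\<lambda>s. \<Sum>i\<le>degree (pCons a Q). coeff (pCons a Q) i * (s ^ i * exp (- s))) \<longlongrightarrow> (\<Sum>i\<le>degree (pCons a Q). coeff (pCons a Q) i * 0)) at_top"
        by (intro tendsto_sum tendsto_mult tendsto_const m)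
      then have "((\<lambda>s. \<Sum>i\<le>degree (pCons a Q). coeff (pCons a Q) i * (s ^ i * exp (- s))) \<longlongrightarrow> 0) at_top"
        by simp
      then show ?case
        unfolding poly_altdef sum_distrib_right mult.assoc .
    qed simp
    have "((\<lambda>s. poly ([:0, 1:] * P) s * exp (- s)) \<longlongrightarrow> (0::real)) at_top" by (rule lim)
    then have "((\<lambda>t. poly ([:0, 1:] * P) (inverse t) * exp (- inverse t)) \<longlongrightarrow> (0::real)) (at_right 0)"
      using filterlim_compose[OF _ filterlim_inverse_at_top_right] by fast
    then have r: "((\<lambda>t. flat P t / t) \<longlongrightarrow> 0) (at_right 0)"
      by (rule tendsto_cong[THEN iffD1, rotated])
        (auto simp: eventually_at_filter flat_def divide_inverse)
    have l: "((\<lambda>t. flat P t / t) \<longlongrightarrow> 0) (at_left 0)"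
      by (rule tendsto_eventually) (auto simp: eventually_at_filter flat_def)
    have "((\<lambda>t. flat P t / t) \<longlongrightarrow> 0) (at 0)"
      using l r by (simp add: filterlim_split_at)
    then show ?thesis using 3 by (simp add: has_field_derivative_iff flat_def)
  qed
qed

text \<open>\<open>flat 1\<close> itself is not convex, but \<open>t * flat 1 t\<close> is convex and increasing: its first
  two derivatives are \<open>(1 + 1/t) exp (- 1/t)\<close> and \<open>exp (- 1/t) / t\<^sup>3\<close> for \<open>t > 0\<close>.\<close>

lemma times_flat_has_derivative: "((\<lambda>s. s * flat 1 s) has_real_derivative flat [:1, 1:] t) (at t)"
proof -
  have "((\<lambda>s. s * flat 1 s) has_real_derivative 1 * flat 1 t + flat ([:0, 0, 1:] * (1 - pderiv 1)) t * t) (at t)"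
    by (intro DERIV_mult DERIV_ident flat_has_derivative)
  moreover have "1 * flat 1 t + flat ([:0, 0, 1:] * (1 - pderiv 1)) t * t = flat [:1, 1:] t"
    by (simp add: flat_def algebra_simps)
  ultimately show ?thesis by simp
qed

lemma smooth_on_flat:
  fixes f :: "real^'n::finite \<Rightarrow> real"
  assumes "open S" "smooth_on S f"
  shows "smooth_on S (\<lambda>y. flat P (f y))"
  by (rule smooth_on_compose_real[where V = UNIV and \<Psi> = "range flat", OF assms])
    (use flat_has_derivative in blast)+

definition smooth_step :: "real \<Rightarrow> real" where
  "smooth_step t = flat 1 t / (flat 1 t + flat 1 (1 - t))"

lemma flat_1_nonneg: "flat 1 t \<ge> 0" and flat_1_pos: "t > 0 \<Longrightarrow> flat 1 t > 0"
  by (auto simp: flat_def)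

lemma smooth_step_denominator_pos: "flat 1 t + flat 1 (1 - t) > 0"
  using flat_1_nonneg[of t] flat_1_nonneg[of "1 - t"] flat_1_pos[of t] flat_1_pos[of "1 - t"]
  by (cases "t > 0") (auto simp: add_pos_nonneg add_nonneg_pos)

lemma smooth_step_bounds: "0 \<le> smooth_step t" "smooth_step t \<le> 1"
  using smooth_step_denominator_pos[of t] flat_1_nonneg[of t] flat_1_nonneg[of "1-t"]
  by (auto simp: smooth_step_def)

lemma smooth_step_eq_0: "t \<le> 0 \<Longrightarrow> smooth_step t = 0"
  by (simp add: smooth_step_def flat_def)

lemma smooth_step_eq_1: "t \<ge> 1 \<Longrightarrow> smooth_step t = 1"
  using smooth_step_denominator_pos[of t] by (simp add: smooth_step_def flat_def)

lemma smooth_on_smooth_step: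
  fixes f :: "real^'n::finite \<Rightarrow> real"
  assumes "open S" "smooth_on S f"
  shows "smooth_on S (\<lambda>y. smooth_step (f y))"
  unfolding smooth_step_def
  by (intro smooth_on_divide smooth_on_add smooth_on_flat smooth_on_diff smooth_on_const assms)
    (metis smooth_step_denominator_pos less_irrefl)

lemma compact_closed_subset: "compact C \<Longrightarrow> closed D \<Longrightarrow> D \<subseteq> C \<Longrightarrow> compact D"
  using compact_Int_closed[of C D] by (simp add: Int_absorb1)

section \<open>Smooth functions and bump functions on a manifold\<close>

locale oriented_manifold =
  fixes A :: "('a::{t2_space,second_countable_topology}, 'n::finite) chart set"
  assumes atlas: "oriented_atlas A"
begin

lemma atlas_is_chart: "c \<in> A \<Longrightarrow> is_chart c"
  using atlas by (auto simp: oriented_atlas_def)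

lemma open_cdom: "c \<in> A \<Longrightarrow> open (cdom c)"
  and open_cimg: "c \<in> A \<Longrightarrow> open (cimg c)"
  and chart_homeomorphism: "c \<in> A \<Longrightarrow> homeomorphism (cdom c) (cimg c) (cmap c) (cinv c)"
  using atlas_is_chart by (auto simp: is_chart_def)

lemma cmap_in: "x \<in> cdom c \<Longrightarrow> cmap c x \<in> cimg c"
  by (simp add: cimg_def)

lemma cinv_in: "y \<in> cimg c \<Longrightarrow> cinv c y \<in> cdom c"
  by (auto simp: cimg_def cinv_def inv_into_into)

lemma cmap_cinv: "y \<in> cimg c \<Longrightarrow> cmap c (cinv c y) = y"
  by (auto simp: cimg_def cinv_def f_inv_into_f)

lemma cinv_cmap: "c \<in> A \<Longrightarrow> x \<in> cdom c \<Longrightarrow> cinv c (cmap c x) = x"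
  using chart_homeomorphism by (auto simp: homeomorphism_def)

lemma chart_at: "chart_at A x \<in> A" "x \<in> cdom (chart_at A x)"
proof -
  have "\<exists>c. c \<in> A \<and> x \<in> cdom c" using atlas unfolding oriented_atlas_def by (metis UNIV_I UN_iff)
  then have "chart_at A x \<in> A \<and> x \<in> cdom (chart_at A x)"
    unfolding chart_at_def by (rule someI_ex)
  then show "chart_at A x \<in> A" "x \<in> cdom (chart_at A x)" by auto
qed

lemma open_cmap_image:
  assumes "c \<in> A" "open U"
  shows "open (cmap c ` (cdom c \<inter> U))"
proof -
  have "openin (top_of_set (cimg c)) (cmap c ` (cdom c \<inter> U))"
    using homeomorphism_imp_open_map[OF chart_homeomorphism[OF assms(1)]] assms(2) by blast
  then show ?thesis using open_cimg[OF assms(1)] openin_open_eq by blast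
qed

lemma cmap_image_iff:
  "c \<in> A \<Longrightarrow> y \<in> cmap c ` (cdom c \<inter> U) \<longleftrightarrow> y \<in> cimg c \<and> cinv c y \<in> U"
proof
  assume "c \<in> A" "y \<in> cmap c ` (cdom c \<inter> U)"
  then show "y \<in> cimg c \<and> cinv c y \<in> U" by (auto simp: cmap_in cinv_cmap)
next
  assume "c \<in> A" "y \<in> cimg c \<and> cinv c y \<in> U"
  then show "y \<in> cmap c ` (cdom c \<inter> U)"
    using cmap_cinv[of y c] cinv_in[of y c] by (intro image_eqI[of _ _ "cinv c y"]) auto
qed

abbreviation overlap :: "('a, 'n) chart \<Rightarrow> ('a, 'n) chart \<Rightarrow> (real^'n) set" where
  "overlap c d \<equiv> cmap c ` (cdom c \<inter> cdom d)"

lemma open_overlap: "c \<in> A \<Longrightarrow> d \<in> A \<Longrightarrow> open (overlap c d)"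
  by (simp add: open_cmap_image open_cdom)

lemma smooth_transition: "c \<in> A \<Longrightarrow> d \<in> A \<Longrightarrow> smooth_on (overlap c d) (transition c d)"
  using atlas by (auto simp: oriented_atlas_def)

lemma cinv_transition:
  "c \<in> A \<Longrightarrow> d \<in> A \<Longrightarrow> y \<in> overlap c d \<Longrightarrow> cinv d (transition c d y) = cinv c y"
  by (auto simp: transition_def cinv_cmap)

lemma transition_in:
  "c \<in> A \<Longrightarrow> d \<in> A \<Longrightarrow> y \<in> overlap c d \<Longrightarrow> transition c d y \<in> overlap d c"
  by (auto simp: transition_def cinv_cmap)

lemma transition_transition:
  "c \<in> A \<Longrightarrow> d \<in> A \<Longrightarrow> e \<in> A \<Longrightarrow> y \<in> overlap c d \<Longrightarrow> transition d e (transition c d y) = transition c e y"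
  by (auto simp: transition_def cinv_cmap)

text \<open>Smoothness at a point may be tested in any one chart around it, since coordinate changes are
  smooth.\<close>

lemma smooth_fun_locally:
  assumes "\<And>x. \<exists>c\<in>A. \<exists>U. open U \<and> x \<in> U \<and> x \<in> cdom c \<and> smooth_on (cmap c ` (cdom c \<inter> U)) (f \<circ> cinv c)"
  shows "smooth_fun A f"
  unfolding smooth_fun_def
proof
  fix d assume d: "d \<in> A"
  show "smooth_on (cimg d) (f \<circ> cinv d)"
  proof (rule smooth_on_locally)
    fix y assume y: "y \<in> cimg d"
    obtain c U where c: "c \<in> A" "open U" "cinv d y \<in> U" "cinv d y \<in> cdom c"
      and s: "smooth_on (cmap c ` (cdom c \<inter> U)) (f \<circ> cinv c)"
      using assms[of "cinv d y"] by blast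
    let ?W = "cmap d ` (cdom d \<inter> (cdom c \<inter> U))"
    have W: "open ?W" by (intro open_cmap_image d open_Int open_cdom c)
    have "smooth_on ?W (\<lambda>z. (f \<circ> cinv c) (transition d c z))"
    proof (rule smooth_on_compose[OF W _ _ s])
      show "smooth_on ?W (transition d c)"
        by (rule smooth_on_subset[OF smooth_transition[OF d c(1)]]) blast
      show "transition d c ` ?W \<subseteq> cmap c ` (cdom c \<inter> U)"
        using d by (auto simp: transition_def cinv_cmap)
    qed
    moreover have e: "(f \<circ> cinv c) (transition d c z) = (f \<circ> cinv d) z" if "z \<in> ?W" for z
      using cinv_transition[OF d c(1), of z] that by auto
    ultimately have "smooth_on ?W (f \<circ> cinv d)" by (simp only: smooth_on_cong[OF W e])
    then show "\<exists>U. y \<in> U \<and> smooth_on U (f \<circ> cinv d)"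
      using cmap_image_iff[OF d] y c by (intro exI[of _ ?W]) auto
  qed
qed

lemma smooth_funD: "smooth_fun A f \<Longrightarrow> c \<in> A \<Longrightarrow> smooth_on (cimg c) (f \<circ> cinv c)"
  by (simp add: smooth_fun_def)

lemma smooth_fun_const: "smooth_fun A (\<lambda>_. r)"
  by (simp add: smooth_fun_def o_def)

lemma smooth_fun_add: "smooth_fun A f \<Longrightarrow> smooth_fun A h \<Longrightarrow> smooth_fun A (\<lambda>x. f x + h x)"
  by (simp add: smooth_fun_def o_def smooth_on_add open_cimg)

lemma smooth_fun_diff: "smooth_fun A f \<Longrightarrow> smooth_fun A h \<Longrightarrow> smooth_fun A (\<lambda>x. f x - h x)"
  by (simp add: smooth_fun_def o_def smooth_on_diff open_cimg)

lemma smooth_fun_mult: "smooth_fun A f \<Longrightarrow> smooth_fun A h \<Longrightarrow> smooth_fun A (\<lambda>x. f x * h x)"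
  by (simp add: smooth_fun_def o_def smooth_on_mult open_cimg)

lemma smooth_fun_flat: "smooth_fun A f \<Longrightarrow> smooth_fun A (\<lambda>x. flat P (f x))"
  by (simp add: smooth_fun_def o_def smooth_on_flat open_cimg)

lemma smooth_fun_prod: "(\<And>i. i \<in> I \<Longrightarrow> smooth_fun A (f i)) \<Longrightarrow> smooth_fun A (\<lambda>x. \<Prod>i\<in>I. f i x)"
  by (induction I rule: infinite_finite_induct) (simp_all add: smooth_fun_mult smooth_fun_const)

lemma smooth_fun_continuous_on:
  assumes "smooth_fun A f"
  shows "continuous_on UNIV f"
proof (rule continuous_at_imp_continuous_on, rule ballI)
  fix x
  let ?c = "chart_at A x"
  have "continuous_on (cdom ?c) ((f \<circ> cinv ?c) \<circ> cmap ?c)"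
  proof (rule continuous_on_compose)
    show "continuous_on (cdom ?c) (cmap ?c)"
      using chart_homeomorphism[OF chart_at(1)] by (simp add: homeomorphism_def)
    show "continuous_on (cmap ?c ` cdom ?c) (f \<circ> cinv ?c)"
      using smooth_on_continuous_on[OF smooth_funD[OF assms chart_at(1)]] by (simp add: cimg_def)
  qed
  then have "continuous_on (cdom ?c) f"
    using continuous_on_cong[of "cdom ?c" "cdom ?c" "(f \<circ> cinv ?c) \<circ> cmap ?c" f]
      cinv_cmap[OF chart_at(1)] by simp
  then show "isCont f x"
    using continuous_on_eq_continuous_at[OF open_cdom[OF chart_at(1)]] chart_at(2) by blast
qed

text \<open>A bump function of the distance from the centre of a coordinate ball, extended by zero. The
  extension is smooth because a compact subset of the chart domain is closed in the
  Hausdorff space \<open>'a\<close>.\<close>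

lemma bump_exists:
  assumes "open U" "x \<in> U"
  shows "\<exists>\<eta>. smooth_fun A \<eta> \<and> (\<forall>z. 0 \<le> \<eta> z \<and> \<eta> z \<le> 1) \<and> compact (closure {z. \<eta> z \<noteq> 0}) \<and>
    closure {z. \<eta> z \<noteq> 0} \<subseteq> U \<and> (\<exists>V. open V \<and> x \<in> V \<and> (\<forall>z\<in>V. \<eta> z = 1))"
proof -
  define c where "c = chart_at A x"
  have c: "c \<in> A" "x \<in> cdom c" using chart_at by (auto simp: c_def)
  define y0 where "y0 = cmap c x"
  have "y0 \<in> cmap c ` (cdom c \<inter> U)" using c assms by (auto simp: y0_def)
  then obtain r where r: "r > 0" "cball y0 r \<subseteq> cmap c ` (cdom c \<inter> U)"
    using open_cmap_image[OF c(1) assms(1)] open_contains_cball by blast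
  \<comment> \<open>The polynomial \<open>2 - 2 |y - y0|\<^sup>2 / r\<^sup>2\<close> is at least \<open>1\<close> near \<open>y0\<close> and at most \<open>0\<close> outside the
    ball of radius \<open>r\<close>.\<close>
  define b where "b y = smooth_step (2 + (- 2 / r^2) * (\<Sum>i\<in>UNIV. (y $ i - y0 $ i) * (y $ i - y0 $ i)))" for y
  have b_alt: "b y = smooth_step (2 - 2 * (dist y y0)^2 / r^2)" for y
    by (simp add: b_def dist_norm norm_vec_def L2_set_def power2_eq_square sum_nonneg)
  have b_smooth: "smooth_on (cimg c) b"
    unfolding b_def
    by (intro smooth_on_smooth_step smooth_on_add smooth_on_cmult smooth_on_sum smooth_on_mult smooth_on_diff
        smooth_on_const open_cimg c smooth_on_bounded_linear bounded_linear_vec_nth)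
  have b0: "b y = 0" if "dist y y0 \<ge> r" for y
    unfolding b_alt using that r(1) power_mono[of r "dist y y0" 2]
    by (intro smooth_step_eq_0) (simp add: field_simps)
  have b1: "b y = 1" if "dist y y0 < r / 2" for y
  proof -
    have "(dist y y0)^2 \<le> (r/2)^2" using that by (intro power_mono) auto
    then have "4 * (dist y y0)^2 \<le> r^2" by (simp add: power_divide)
    then have "2 * (dist y y0)^2 \<le> r^2" using zero_le_power2[of "dist y y0"] by linarith
    then have "2 * (dist y y0)^2 / r^2 \<le> 1" using r(1) by simp
    then show ?thesis unfolding b_alt by (intro smooth_step_eq_1) simp
  qed
  define \<eta> where "\<eta> z = (if z \<in> cdom c then b (cmap c z) else 0)" for z
  define B where "B = cinv c ` cball y0 r"
  have sub: "cball y0 r \<subseteq> cimg c" using r(2) by (auto simp: cimg_def)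
  have "continuous_on (cball y0 r) (cinv c)"
    using chart_homeomorphism[OF c(1)] sub continuous_on_subset by (auto simp: homeomorphism_def)
  then have B: "compact B" "closed B"
    unfolding B_def using compact_continuous_image compact_cball compact_imp_closed by blast+
  have BU: "B \<subseteq> U" using r(2) cmap_image_iff[OF c(1)] by (auto simp: B_def)
  have supp: "{z. \<eta> z \<noteq> 0} \<subseteq> B"
  proof
    fix z assume "z \<in> {z. \<eta> z \<noteq> 0}"
    then have z: "z \<in> cdom c" "b (cmap c z) \<noteq> 0" by (auto simp: \<eta>_def split: if_splits)
    then have "dist y0 (cmap c z) < r"
      using b0[of "cmap c z"] by (simp add: dist_commute not_le[symmetric]) blast
    then show "z \<in> B"
      unfolding B_def using cinv_cmap[OF c(1) z(1)] by (intro image_eqI[of _ _ "cmap c z"]) auto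
  qed
  then have cl: "closure {z. \<eta> z \<noteq> 0} \<subseteq> B" using B(2) closure_minimal by blast
  have "smooth_fun A \<eta>"
  proof (rule smooth_fun_locally)
    fix z
    show "\<exists>c\<in>A. \<exists>U. open U \<and> z \<in> U \<and> z \<in> cdom c \<and> smooth_on (cmap c ` (cdom c \<inter> U)) (\<eta> \<circ> cinv c)"
    proof (cases "z \<in> cdom c")
      case True
      have "smooth_on (cimg c) (\<eta> \<circ> cinv c)"
        using smooth_on_cong[OF open_cimg[OF c(1)], of b "\<eta> \<circ> cinv c"] b_smooth
        by (simp add: \<eta>_def cinv_in cmap_cinv)
      then show ?thesis using True c by (intro bexI[of _ c] exI[of _ UNIV]) (auto simp: cimg_def)
    next
      case False
      let ?d = "chart_at A z"
      have "z \<notin> B" using False sub cinv_in[of _ c] unfolding B_def by blast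
      let ?W = "cmap ?d ` (cdom ?d \<inter> - B)"
      have W: "open ?W" using open_cmap_image[OF chart_at(1)] B(2) by blast
      have "smooth_on ?W (\<eta> \<circ> cinv ?d)"
      proof (rule smooth_on_cong[OF W, THEN iffD1, OF _ smooth_on_const])
        fix y assume "y \<in> ?W"
        then show "0 = (\<eta> \<circ> cinv ?d) y" using supp cinv_cmap[OF chart_at(1)] by auto
      qed
      then show ?thesis
        using chart_at[of z] \<open>z \<notin> B\<close> B(2) by (intro bexI[of _ ?d] exI[of _ "- B"]) auto
    qed
  qed
  moreover have "\<forall>z. 0 \<le> \<eta> z \<and> \<eta> z \<le> 1"
    using smooth_step_bounds by (simp add: \<eta>_def b_def)
  moreover have "compact (closure {z. \<eta> z \<noteq> 0})"
    by (rule compact_closed_subset[OF B(1) closed_closure cl])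
  moreover have "closure {z. \<eta> z \<noteq> 0} \<subseteq> U" using cl BU by blast
  moreover have "\<exists>V. open V \<and> x \<in> V \<and> (\<forall>z\<in>V. \<eta> z = 1)"
  proof (intro exI conjI ballI)
    let ?V = "cdom c \<inter> cmap c -` ball y0 (r/2)"
    show "open ?V"
      using homeomorphism_cont1[OF chart_homeomorphism[OF c(1)]]
      by (rule continuous_open_preimage[OF _ open_cdom[OF c(1)] open_ball])
    show "x \<in> ?V" using c(2) r(1) by (simp add: y0_def)
    show "\<eta> z = 1" if "z \<in> ?V" for z
      using that b1[of "cmap c z"] by (simp add: \<eta>_def mem_ball dist_commute[of y0])
  qed
  ultimately show ?thesis
    by - (rule exI[of _ \<eta>], intro conjI; assumption)
qed

text \<open>\<open>1 - \<Prod> (1 - b\<^sub>i)\<close> for finitely many bump functions \<open>b\<^sub>i\<close> whose sets \<open>b\<^sub>i = 1\<close> cover \<open>S\<close>.\<close>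

lemma smooth_cutoff_exists:
  assumes "compact S" "open U" "S \<subseteq> U"
  shows "\<exists>\<eta>. smooth_fun A \<eta> \<and> (\<forall>z. 0 \<le> \<eta> z \<and> \<eta> z \<le> 1) \<and> compact (closure {z. \<eta> z \<noteq> 0}) \<and>
    closure {z. \<eta> z \<noteq> 0} \<subseteq> U \<and> (\<exists>V. open V \<and> S \<subseteq> V \<and> (\<forall>z\<in>V. \<eta> z = 1))"
proof -
  have "\<forall>x\<in>S. \<exists>b. smooth_fun A b \<and> (\<forall>z. 0 \<le> b z \<and> b z \<le> 1) \<and>
      compact (closure {z. b z \<noteq> 0}) \<and> closure {z. b z \<noteq> 0} \<subseteq> U \<and>
      (\<exists>V. open V \<and> x \<in> V \<and> (\<forall>z\<in>V. b z = 1))"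
    using bump_exists[OF assms(2)] assms(3) by auto
  then obtain b where "\<forall>x\<in>S. smooth_fun A (b x) \<and> (\<forall>z. 0 \<le> b x z \<and> b x z \<le> 1) \<and>
      compact (closure {z. b x z \<noteq> 0}) \<and> closure {z. b x z \<noteq> 0} \<subseteq> U \<and>
      (\<exists>V. open V \<and> x \<in> V \<and> (\<forall>z\<in>V. b x z = 1))"
    by (rule bchoice[THEN exE])
  note good = this[rule_format]
  have b: "\<And>x. x \<in> S \<Longrightarrow> smooth_fun A (b x)" "\<And>x z. x \<in> S \<Longrightarrow> 0 \<le> b x z \<and> b x z \<le> 1"
      "\<And>x. x \<in> S \<Longrightarrow> compact (closure {z. b x z \<noteq> 0})"
      "\<And>x. x \<in> S \<Longrightarrow> closure {z. b x z \<noteq> 0} \<subseteq> U"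
      and bV: "\<forall>x\<in>S. \<exists>V. open V \<and> x \<in> V \<and> (\<forall>z\<in>V. b x z = 1)"
    using good by simp_all
  obtain V where "\<forall>x\<in>S. open (V x) \<and> x \<in> V x \<and> (\<forall>z\<in>V x. b x z = 1)"
    using bV by (rule bchoice[THEN exE])
  then have V: "\<And>x. x \<in> S \<Longrightarrow> open (V x)" "\<And>x. x \<in> S \<Longrightarrow> x \<in> V x"
      "\<And>x z. x \<in> S \<Longrightarrow> z \<in> V x \<Longrightarrow> b x z = 1" by auto
  obtain F where F: "F \<subseteq> S" "finite F" "S \<subseteq> (\<Union>x\<in>F. V x)"
    by (rule compactE_image[OF assms(1), of S V]) (use V in auto)
  define \<eta> where "\<eta> z = 1 - (\<Prod>x\<in>F. 1 - b x z)" for z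
  let ?B = "\<Union>x\<in>F. closure {z. b x z \<noteq> 0}"
  have B: "compact ?B" "closed ?B" "?B \<subseteq> U"
  proof -
    show B1: "compact ?B" by (intro compact_UN F(2) b(3)) (use F(1) in auto)
    show "closed ?B" by (rule compact_imp_closed[OF B1])
    show "?B \<subseteq> U" by (intro UN_least b(4)) (use F(1) in auto)
  qed
  have "\<eta> z = 0" if "z \<notin> ?B" for z
  proof -
    have "b x z = 0" if "x \<in> F" for x 
      using that \<open>z \<notin> ?B\<close> closure_subset[of "{z. b x z \<noteq> 0}"] by blast
    then show ?thesis by (simp add: \<eta>_def)
  qed
  then have cl: "closure {z. \<eta> z \<noteq> 0} \<subseteq> ?B" using B(2) by (intro closure_minimal) blast+
  have "smooth_fun A \<eta>"
    unfolding \<eta>_def by (intro smooth_fun_diff smooth_fun_const smooth_fun_prod b(1)) (use F(1) in auto)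
  moreover have "\<forall>z. 0 \<le> \<eta> z \<and> \<eta> z \<le> 1"
  proof
    fix z
    have "0 \<le> 1 - b x z \<and> 1 - b x z \<le> 1" if "x \<in> F" for x
      using F(1) b(2)[of x z] that by auto
    then have "0 \<le> (\<Prod>x\<in>F. 1 - b x z)" "(\<Prod>x\<in>F. 1 - b x z) \<le> 1"
      using prod_nonneg[of F "\<lambda>x. 1 - b x z"] prod_le_1[of F "\<lambda>x. 1 - b x z"] by auto
    then show "0 \<le> \<eta> z \<and> \<eta> z \<le> 1" by (simp add: \<eta>_def)
  qed
  moreover have "compact (closure {z. \<eta> z \<noteq> 0})"
    by (rule compact_closed_subset[OF B(1) closed_closure cl])
  moreover have "closure {z. \<eta> z \<noteq> 0} \<subseteq> U" using cl B(3) by blast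
  moreover have "\<exists>V. open V \<and> S \<subseteq> V \<and> (\<forall>z\<in>V. \<eta> z = 1)"
  proof (intro exI conjI ballI)
    show "open (\<Union>x\<in>F. V x)" using F V by blast
    show "S \<subseteq> (\<Union>x\<in>F. V x)" by (rule F)
    fix z assume "z \<in> (\<Union>x\<in>F. V x)"
    then obtain x where "x \<in> F" "b x z = 1" using V F by blast
    then have "(\<Prod>x\<in>F. 1 - b x z) = 0" using F(2) by (intro prod_zero) auto
    then show "\<eta> z = 1" by (simp add: \<eta>_def)
  qed
  ultimately show ?thesis
    by - (rule exI[of _ \<eta>], intro conjI; assumption)
qed

end

section \<open>Alternating forms\<close>

lemma alt_forms_length: "\<omega> \<in> alt_forms k \<Longrightarrow> length vs \<noteq> k \<Longrightarrow> \<omega> vs = 0"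
  by (auto simp: alt_forms_def)

lemma alt_forms_linear: "\<omega> \<in> alt_forms k \<Longrightarrow> length vs = k \<Longrightarrow> i < k \<Longrightarrow> linear (\<lambda>v. \<omega> (vs[i := v]))"
  by (auto simp: alt_forms_def)

lemma alt_forms_repeat:
  assumes "\<omega> \<in> alt_forms k" "i \<noteq> j" "i < k" "j < k" "vs ! i = vs ! j"
  shows "\<omega> vs = 0"
proof (cases "length vs = k")
  case True
  have "\<omega> vs = 0" if "i < j" "j < k" "vs ! i = vs ! j" for i j
    using assms(1) True that unfolding alt_forms_def by blast
  from this[of i j] this[of j i] show ?thesis
    using assms(2-5) by (cases "i < j") auto
qed (use assms(1) alt_forms_length in blast)

lemma alt_forms_linear_append:
  assumes "\<omega> \<in> alt_forms k" "Suc (length xs + length ys) = k"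
  shows "linear (\<lambda>v. \<omega> (xs @ v # ys))"
  using alt_forms_linear[OF assms(1), of "xs @ 0 # ys" "length xs"] assms(2) by simp

lemma alt_forms_swap:
  assumes w: "\<omega> \<in> alt_forms k" and "length xs + length ys + 2 = k"
  shows "\<omega> (xs @ u # v # ys) = - \<omega> (xs @ v # u # ys)"
proof -
  have rep: "\<omega> (xs @ w # w # ys) = 0" for w
    by (rule alt_forms_repeat[OF w, of "length xs" "Suc (length xs)"]) (use assms in \<open>auto simp: nth_append\<close>)
  have l1: "linear (\<lambda>v. \<omega> (xs @ v # (w # ys)))" for w
    by (rule alt_forms_linear_append[OF w]) (use assms in simp)
  have l2: "linear (\<lambda>v. \<omega> ((xs @ [w]) @ v # ys))" for w
    by (rule alt_forms_linear_append[OF w]) (use assms in simp)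
  have "\<omega> (xs @ (u + v) # (u + v) # ys) =
      \<omega> (xs @ u # u # ys) + \<omega> (xs @ u # v # ys) + (\<omega> (xs @ v # u # ys) + \<omega> (xs @ v # v # ys))"
    using linear_add[OF l1, of u v] linear_add[OF l2, of _ u v] by simp
  then show ?thesis using rep by simp
qed

lemma alt_forms_move:
  assumes w: "\<omega> \<in> alt_forms k"
  shows "length xs + length ys + length zs + 1 = k \<Longrightarrow>
    \<omega> (xs @ ys @ v # zs) = (-1) ^ length ys * \<omega> (xs @ v # ys @ zs)"
proof (induction ys arbitrary: xs)
  case (Cons y ys)
  have "\<omega> ((xs @ [y]) @ ys @ v # zs) = (-1) ^ length ys * \<omega> ((xs @ [y]) @ v # ys @ zs)"
    by (rule Cons.IH) (use Cons.prems in simp)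
  moreover have "\<omega> (xs @ y # v # (ys @ zs)) = - \<omega> (xs @ v # y # (ys @ zs))"
    by (rule alt_forms_swap[OF w]) (use Cons.prems in simp)
  ultimately show ?case by simp
qed simp

abbreviation remove_nth :: "nat \<Rightarrow> 'b list \<Rightarrow> 'b list" where
  "remove_nth i vs \<equiv> take i vs @ drop (Suc i) vs"

lemma length_remove_nth: "length vs = Suc k \<Longrightarrow> i \<le> k \<Longrightarrow> length (remove_nth i vs) = k"
  by simp

lemma list_split2:
  assumes "i < j" "j < length vs"
  obtains xs a ys b zs where "vs = xs @ a # ys @ b # zs" "length xs = i" "length ys = j - i - 1"
    "a = vs ! i" "b = vs ! j"
proof
  show "vs = take i vs @ vs ! i # take (j - i - 1) (drop (Suc i) vs) @ vs ! j # drop (Suc j) vs"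
  proof -
    have "drop (Suc i) vs = take (j - i - 1) (drop (Suc i) vs) @ drop (j - i - 1) (drop (Suc i) vs)"
      by (rule append_take_drop_id[symmetric])
    also have "drop (j - i - 1) (drop (Suc i) vs) = drop j vs" using assms by simp
    also have "drop j vs = vs ! j # drop (Suc j) vs" using assms by (simp add: Cons_nth_drop_Suc)
    finally show ?thesis using assms id_take_nth_drop[of i vs] by simp
  qed
qed (use assms in auto)

lemma nth_remove_nth:
  assumes "length vs = Suc k" "i \<le> k" "a < k"
  shows "remove_nth i vs ! a = vs ! (if a < i then a else Suc a)"
  using assms by (auto simp: nth_append min_def)

text \<open>Both lists consist of \<open>s\<close> and of the entries of \<open>vs\<close> other than the \<open>i\<close>-th and the
  \<open>j\<close>-th; \<open>s\<close> stands where the \<open>j\<close>-th entry was in the first and where the \<open>i\<close>-th was in the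
  second, \<open>j - i - 1\<close> places apart. This sign accounts for every cancellation in the
  exterior derivative.\<close>

lemma alt_forms_remove_swap:
  assumes w: "\<omega> \<in> alt_forms k" and l: "length vs = Suc k" and ij: "i < j" "j \<le> k"
  shows "(-1) ^ i * \<omega> ((remove_nth i vs)[j - 1 := s]) = - ((-1) ^ j * \<omega> ((remove_nth j vs)[i := s]))"
proof -
  obtain xs a ys b zs where vs: "vs = xs @ a # ys @ b # zs" "length xs = i" "length ys = j - i - 1"
  proof -
    have "j < length vs" using l ij by simp
    show ?thesis by (rule list_split2[OF ij(1) \<open>j < length vs\<close>]) (rule that; assumption)
  qed
  have j: "j = Suc (i + length ys)" using vs ij by simp
  have "(remove_nth i vs)[j - 1 := s] = xs @ ys @ s # zs"
    using vs(1,2) j by (simp add: list_update_append)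
  moreover have "(remove_nth j vs)[i := s] = xs @ s # ys @ zs"
    using vs(1,2) j by (simp add: list_update_append)
  moreover have "\<omega> (xs @ ys @ s # zs) = (-1) ^ length ys * \<omega> (xs @ s # ys @ zs)"
    by (rule alt_forms_move[OF w]) (use vs l in simp)
  moreover have "(-1::real) ^ i * (-1) ^ length ys = - ((-1) ^ j)"
    by (simp add: j power_add)
  ultimately show ?thesis by (simp add: mult.assoc[symmetric])
qed

lemma alt_forms_zero: "(\<lambda>vs. 0) \<in> alt_forms k"
  by (simp add: alt_forms_def linear_zero)

lemma alt_forms_add: "\<omega> \<in> alt_forms k \<Longrightarrow> \<eta> \<in> alt_forms k \<Longrightarrow> (\<lambda>vs. \<omega> vs + \<eta> vs) \<in> alt_forms k"
  by (simp add: alt_forms_def linear_compose_add)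

lemma linear_real_cmult:
  fixes f :: "'v::real_vector \<Rightarrow> real"
  shows "linear f \<Longrightarrow> linear (\<lambda>x. r * f x)"
  using linear_compose_scale_right[of f r] by simp

lemma alt_forms_cmult: "\<omega> \<in> alt_forms k \<Longrightarrow> (\<lambda>vs. r * \<omega> vs) \<in> alt_forms k"
  by (simp add: alt_forms_def linear_real_cmult)

lemma alt_forms_pullback:
  assumes "\<omega> \<in> alt_forms k" "linear L"
  shows "(\<lambda>vs. \<omega> (map L vs)) \<in> alt_forms k"
proof -
  have "linear (\<lambda>v. \<omega> (map L (vs[i := v])))" if "length vs = k" "i < k" for vs i
    using linear_compose[OF assms(2) alt_forms_linear[OF assms(1), of "map L vs" i]] that
    by (simp add: map_update o_def)
  then show ?thesis using assms(1) unfolding alt_forms_def by simp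
qed

lemma alt_forms_contract: "\<omega> \<in> alt_forms (Suc k) \<Longrightarrow> (\<lambda>vs. \<omega> (v # vs)) \<in> alt_forms k"
proof -
  assume w: "\<omega> \<in> alt_forms (Suc k)"
  have "linear (\<lambda>u. \<omega> (v # vs[i := u]))" if "length vs = k" "i < k" for vs i
    using alt_forms_linear[OF w, of "v # vs" "Suc i"] that by simp
  moreover have "\<omega> (v # vs) = 0" if "length vs = k" "i < j" "j < k" "vs ! i = vs ! j" for vs i j
    using alt_forms_repeat[OF w, of "Suc i" "Suc j" "v # vs"] that by simp
  ultimately show ?thesis using alt_forms_length[OF w] by (simp add: alt_forms_def)
qed

text \<open>With \<open>E u L\<close> the derivative in the direction \<open>u\<close> of the coefficient \<open>L\<close> of a form, this is
  the formula for the exterior derivative.\<close>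

definition antisymmetrize :: "nat \<Rightarrow> ('v \<Rightarrow> 'v list \<Rightarrow> real) \<Rightarrow> 'v list \<Rightarrow> real" where
  "antisymmetrize k E vs = (if length vs = Suc k then \<Sum>i\<le>k. (-1) ^ i * E (vs ! i) (remove_nth i vs) else 0)"

lemma remove_nth_update:
  assumes "length vs = Suc k" "i \<le> k" "m \<le> k" "m \<noteq> i"
  shows "remove_nth i (vs[m := v]) = (remove_nth i vs)[(if m < i then m else m - 1) := v]"
  using assms by (auto simp: list_update_append take_update_swap drop_update_swap min_def list_update_beyond)

lemma antisymmetrize_alt_forms:
  fixes E :: "real^'n::finite \<Rightarrow> (real^'n) list \<Rightarrow> real"
  assumes alt: "\<And>u. E u \<in> alt_forms k" and lin: "\<And>L. linear (\<lambda>u. E u L)"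
  shows "antisymmetrize k E \<in> alt_forms (Suc k)"
proof -
  have "linear (\<lambda>v. antisymmetrize k E (vs[m := v]))" if l: "length vs = Suc k" and m: "m < Suc k" for vs m
  proof -
    have "linear (\<lambda>v. (-1) ^ i * E (vs[m := v] ! i) (remove_nth i (vs[m := v])))" if i: "i \<le> k" for i
    proof (cases "m = i")
      case True
      then have "(\<lambda>v. (-1) ^ i * E (vs[m := v] ! i) (remove_nth i (vs[m := v])))
          = (\<lambda>v. (-1) ^ i * E v (remove_nth i vs))"
        using l m by (auto simp: fun_eq_iff)
      then show ?thesis using linear_real_cmult[OF lin] by simp
    next
      case False
      have "(\<lambda>v. (-1) ^ i * E (vs[m := v] ! i) (remove_nth i (vs[m := v])))
          = (\<lambda>v. (-1) ^ i * E (vs ! i) ((remove_nth i vs)[(if m < i then m else m - 1) := v]))"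
        using False remove_nth_update[OF l i, of m] m by (simp add: fun_eq_iff)
      moreover have "linear (\<lambda>v. E (vs ! i) ((remove_nth i vs)[(if m < i then m else m - 1) := v]))"
        by (rule alt_forms_linear[OF alt length_remove_nth[OF l i]]) (use False m i in auto)
      ultimately show ?thesis by (simp only: linear_real_cmult)
    qed
    then have "linear (\<lambda>v. \<Sum>i\<le>k. (-1) ^ i * E (vs[m := v] ! i) (remove_nth i (vs[m := v])))"
      by (intro linear_compose_sum) auto
    then show ?thesis using l by (simp add: antisymmetrize_def)
  qed
  moreover have "antisymmetrize k E vs = 0"
    if l: "length vs = Suc k" and ij: "i < j" "j < Suc k" and eq: "vs ! i = vs ! j" for vs i j
  proof -
    let ?t = "\<lambda>m. (-1) ^ m * E (vs ! m) (remove_nth m vs)"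
    have z: "?t m = 0" if "m \<le> k" "m \<noteq> i" "m \<noteq> j" for m
    proof -
      let ?i = "if i < m then i else i - 1" and ?j = "if j < m then j else j - 1"
      have "E (vs ! m) (remove_nth m vs) = 0"
      proof (rule alt_forms_repeat[OF alt, of ?i ?j])
        show "?i \<noteq> ?j" "?i < k" "?j < k" using that ij by auto
        then show "remove_nth m vs ! ?i = remove_nth m vs ! ?j"
          using nth_remove_nth[OF l that(1), of ?i] nth_remove_nth[OF l that(1), of ?j] that ij eq
          by auto
      qed
      then show ?thesis by simp
    qed
    have "(\<Sum>m\<le>k. ?t m) = (\<Sum>m\<in>{i, j}. ?t m)"
      by (rule sum.mono_neutral_right) (use z ij in auto)
    also have "\<dots> = ?t i + ?t j" using ij by simp
    also have "\<dots> = 0"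
    proof -
      have "remove_nth i vs ! (j - 1) = vs ! j" "remove_nth j vs ! i = vs ! i"
        using nth_remove_nth[OF l, of i "j - 1"] nth_remove_nth[OF l, of j i] ij by auto
      then have "(remove_nth i vs)[j - 1 := vs ! j] = remove_nth i vs"
          "(remove_nth j vs)[i := vs ! j] = remove_nth j vs"
        using eq by (metis list_update_id)+
      then have "(-1) ^ i * E (vs ! j) (remove_nth i vs) = - ((-1) ^ j * E (vs ! j) (remove_nth j vs))"
        using alt_forms_remove_swap[OF alt l ij(1), of "vs ! j" "vs ! j"] ij by simp
      then show ?thesis using eq by simp
    qed
    finally show ?thesis using l by (simp add: antisymmetrize_def)
  qed
  ultimately show ?thesis unfolding alt_forms_def by (simp add: antisymmetrize_def)
qed

lemma sum_antisymmetric_zero: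
  fixes B :: "nat \<Rightarrow> nat \<Rightarrow> real"
  assumes "\<And>i j. i \<le> k \<Longrightarrow> j \<le> k \<Longrightarrow> B i j = - B j i"
  shows "(\<Sum>i\<le>k. \<Sum>j\<le>k. B i j) = 0"
proof -
  have "(\<Sum>i\<le>k. \<Sum>j\<le>k. B i j) = (\<Sum>j\<le>k. \<Sum>i\<le>k. B i j)" by (rule sum.swap)
  also have "\<dots> = (\<Sum>j\<le>k. \<Sum>i\<le>k. - B j i)" by (intro sum.cong refl assms) auto
  also have "\<dots> = - (\<Sum>j\<le>k. \<Sum>i\<le>k. B j i)" by (simp add: sum_negf)
  finally show ?thesis by simp
qed

lemma sum_skip:
  fixes f :: "nat \<Rightarrow> real"
  assumes "i \<le> k"
  shows "(\<Sum>a<k. f (if a < i then a else Suc a)) = (\<Sum>j\<in>{..k} - {i}. f j)"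
proof (rule sum.reindex_bij_witness[where i = "\<lambda>j. if j < i then j else j - 1" and j = "\<lambda>a. if a < i then a else Suc a"])
qed (use assms in auto)

text \<open>The terms for the pairs \<open>(i, j)\<close> and \<open>(j, i)\<close> of entries of \<open>vs\<close> cancel. This removes the
  second derivatives of a coordinate change from the exterior derivative.\<close>

lemma alt_forms_symmetric_cancel:
  fixes S :: "'v \<Rightarrow> 'v \<Rightarrow> real^'n::finite"
  assumes w: "\<omega> \<in> alt_forms k" and l: "length vs = Suc k" and S: "\<And>u v. S u v = S v u"
  shows "(\<Sum>i\<le>k. (-1) ^ i * (\<Sum>a<k. \<omega> ((map L (remove_nth i vs))[a := S (vs ! i) (remove_nth i vs ! a)]))) = 0"
proof -
  let ?ws = "map L vs"
  have lw: "length ?ws = Suc k" using l by simp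
  have mr: "map L (remove_nth i vs) = remove_nth i ?ws" for i by (simp add: take_map drop_map)
  define B where "B i j = (if i = j then 0 else
     (-1) ^ i * \<omega> ((remove_nth i ?ws)[(if j < i then j else j - 1) := S (vs ! i) (vs ! j)]))" for i j
  have "(\<Sum>i\<le>k. \<Sum>j\<le>k. B i j) = 0"
  proof (rule sum_antisymmetric_zero)
    have *: "B i j = - B j i" if "i < j" "j \<le> k" for i j
      using alt_forms_remove_swap[OF w lw that, of "S (vs ! i) (vs ! j)"] that S[of "vs ! i" "vs ! j"]
      by (simp add: B_def)
    show "B i j = - B j i" if "i \<le> k" "j \<le> k" for i j
    proof -
      consider "i < j" | "j < i" | "i = j" by linarith
      then show ?thesis using *[of i j] *[of j i] that by cases (simp_all add: B_def)
    qed
  qed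
  moreover have "(-1) ^ i * (\<Sum>a<k. \<omega> ((map L (remove_nth i vs))[a := S (vs ! i) (remove_nth i vs ! a)])) = (\<Sum>j\<le>k. B i j)"
    if i: "i \<le> k" for i
  proof -
    have "(\<Sum>j\<le>k. B i j) = (\<Sum>j\<in>{..k} - {i}. B i j)"
      by (rule sum.mono_neutral_right) (auto simp: B_def)
    also have "\<dots> = (\<Sum>a<k. B i (if a < i then a else Suc a))"
      by (rule sum_skip[OF i, symmetric])
    also have "\<dots> = (\<Sum>a<k. (-1) ^ i * \<omega> ((remove_nth i ?ws)[a := S (vs ! i) (remove_nth i vs ! a)]))"
    proof (rule sum.cong[OF refl])
      fix a assume "a \<in> {..<k}"
      then show "B i (if a < i then a else Suc a) = (-1) ^ i * \<omega> ((remove_nth i ?ws)[a := S (vs ! i) (remove_nth i vs ! a)])"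
        using nth_remove_nth[OF l i, of a] by (simp add: B_def)
    qed
    finally show ?thesis unfolding mr sum_distrib_left by (rule sym)
  qed
  ultimately show ?thesis by simp
qed

section \<open>Unit simple p-vectors and orthonormal frames\<close>

definition is_inner_product :: "(real^'n::finite \<Rightarrow> real^'n \<Rightarrow> real) \<Rightarrow> bool" where
  "is_inner_product b \<longleftrightarrow> bilinear b \<and> (\<forall>v w. b v w = b w v) \<and> (\<forall>v. v \<noteq> 0 \<longrightarrow> b v v > 0)"

definition orthonormal :: "('v \<Rightarrow> 'v \<Rightarrow> real) \<Rightarrow> 'v list \<Rightarrow> bool" where
  "orthonormal b es \<longleftrightarrow> (\<forall>i<length es. \<forall>j<length es. b (es ! i) (es ! j) = (if i = j then 1 else 0))"

text \<open>Gram-Schmidt orthogonalization, one vector at a time: subtracting combinations of the other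
  entries does not change the value of an alternating form, and normalizing an entry scales
  it. If an entry becomes \<open>0\<close>, every alternating form vanishes on the list.\<close>

lemma gram_schmidt_alt_forms:
  fixes b :: "real^'n::finite \<Rightarrow> real^'n \<Rightarrow> real"
  assumes b: "is_inner_product b" and l: "length vs = k" and "m \<le> k"
  shows "(\<forall>\<omega>\<in>alt_forms k. \<omega> vs = 0) \<or>
    (\<exists>es d. length es = k \<and> (\<forall>i<m. \<forall>j<m. b (es ! i) (es ! j) = (if i = j then 1 else 0)) \<and>
      (\<forall>\<omega>\<in>alt_forms k. \<omega> vs = d * \<omega> es))"
  using \<open>m \<le> k\<close>
proof (induction m)
  case 0
  show ?case by (rule disjI2, rule exI[of _ vs], rule exI[of _ 1]) (simp add: l)
next
  case (Suc m)
  have lr: "linear (b v)" and ll: "linear (\<lambda>v. b v w)" for v w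
    using b by (auto simp: is_inner_product_def bilinear_def)
  have sym: "b v w = b w v" for v w using b by (simp add: is_inner_product_def)
  show ?case
  proof (cases "\<forall>\<omega>\<in>alt_forms k. \<omega> vs = 0")
    case False
    then obtain es d where "length es = k \<and>
        (\<forall>i<m. \<forall>j<m. b (es ! i) (es ! j) = (if i = j then 1 else 0)) \<and>
        (\<forall>\<omega>\<in>alt_forms k. \<omega> vs = d * \<omega> es)"
      using Suc.IH[OF Suc_leD[OF Suc.prems]] by blast
    then have es: "length es = k"
        "\<And>i j. i < m \<Longrightarrow> j < m \<Longrightarrow> b (es ! i) (es ! j) = (if i = j then 1 else 0)"
        "\<And>\<omega>. \<omega> \<in> alt_forms k \<Longrightarrow> \<omega> vs = d * \<omega> es"
      by auto
    have m: "m < k" using Suc.prems by simp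
    define u where "u = es ! m - (\<Sum>i<m. b (es ! m) (es ! i) *\<^sub>R es ! i)"
    have orth: "b u (es ! j) = 0" if "j < m" for j
    proof -
      have "b u (es ! j) = b (es ! m) (es ! j) - (\<Sum>i<m. b (es ! m) (es ! i) * b (es ! i) (es ! j))"
        unfolding u_def by (simp add: linear_diff[OF ll] linear_sum[OF ll] linear_scale[OF ll])
      also have "(\<Sum>i<m. b (es ! m) (es ! i) * b (es ! i) (es ! j)) = (\<Sum>i<m. if i = j then b (es ! m) (es ! i) else 0)"
        by (rule sum.cong[OF refl]) (use es(2) that in auto)
      finally show ?thesis using that by simp
    qed
    have same: "\<omega> (es[m := u]) = \<omega> es" if w: "\<omega> \<in> alt_forms k" for \<omega>
    proof -
      have lin: "linear (\<lambda>v. \<omega> (es[m := v]))" by (rule alt_forms_linear[OF w es(1) m])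
      have "\<omega> (es[m := es ! i]) = 0" if "i < m" for i
        by (rule alt_forms_repeat[OF w, of i m]) (use that m es(1) in auto)
      then show ?thesis
        unfolding u_def
        by (simp add: linear_diff[OF lin] linear_sum[OF lin] linear_scale[OF lin])
    qed
    show ?thesis
    proof (cases "u = 0")
      case True
      have "\<omega> vs = 0" if w: "\<omega> \<in> alt_forms k" for \<omega>
        using same[OF w] es(3)[OF w] linear_0[OF alt_forms_linear[OF w es(1) m]] True by simp
      then show ?thesis by blast
    next
      case False
      then have pos: "b u u > 0" using b by (simp add: is_inner_product_def)
      define r where "r = sqrt (b u u)"
      have r: "r > 0" "r * r = b u u" using pos by (auto simp: r_def)
      let ?e = "(1 / r) *\<^sub>R u"
      have e1: "b ?e ?e = 1"
        using r pos by (simp add: linear_scale[OF ll] linear_scale[OF lr] field_simps)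
      have e0: "b ?e (es ! j) = 0" "b (es ! j) ?e = 0" if "j < m" for j
        using orth[OF that] sym[of "es ! j" ?e] by (simp_all add: linear_scale[OF ll])
      show ?thesis
      proof (rule disjI2, rule exI[of _ "es[m := ?e]"], rule exI[of _ "d * r"], intro conjI allI impI ballI)
        show "length (es[m := ?e]) = k" using es(1) by simp
        show "b (es[m := ?e] ! i) (es[m := ?e] ! j) = (if i = j then 1 else 0)" if "i < Suc m" "j < Suc m" for i j
          using that es(1,2) m e1 e0 by (cases "i = m"; cases "j = m") auto
        show "\<omega> vs = d * r * \<omega> (es[m := ?e])" if w: "\<omega> \<in> alt_forms k" for \<omega>
          using es(3)[OF w] same[OF w] linear_scale[OF alt_forms_linear[OF w es(1) m], of "1 / r" u] r(1)
          by simp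
      qed
    qed
  qed blast
qed

text \<open>For fixed \<open>vs\<close> this determinant is an alternating form in \<open>ws\<close> whose value at \<open>vs\<close> is the Gram
  determinant, so that Gram determinants transform by the rules for alternating forms.\<close>

definition gram_form :: "('v \<Rightarrow> 'v \<Rightarrow> real) \<Rightarrow> 'v list \<Rightarrow> 'v list \<Rightarrow> real" where
  "gram_form b vs ws = (if length ws = length vs then
     (\<Sum>\<pi> | \<pi> permutes {..<length vs}. of_int (sign \<pi>) * (\<Prod>i<length vs. b (vs ! i) (ws ! \<pi> i))) else 0)"

lemma gram_form_alt_forms:
  fixes b :: "real^'n::finite \<Rightarrow> real^'n \<Rightarrow> real"
  assumes b: "bilinear b"
  shows "gram_form b vs \<in> alt_forms (length vs)"
proof -
  let ?k = "length vs"
  have lr: "linear (b v)" for v using b by (auto simp: bilinear_def)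
  have "linear (\<lambda>v. gram_form b vs (ws[m := v]))" if l: "length ws = ?k" and m: "m < ?k" for ws m
  proof -
    have "linear (\<lambda>v. of_int (sign \<pi>) * (\<Prod>i<?k. b (vs ! i) (ws[m := v] ! \<pi> i)))"
      if p: "\<pi> permutes {..<?k}" for \<pi>
    proof -
      define q where "q = inv \<pi> m"
      have q: "q < ?k" "\<pi> q = m"
        using permutes_in_image[OF permutes_inv[OF p], of m] m permutes_inverses(1)[OF p] by (auto simp: q_def)
      have "(\<Prod>i<?k. b (vs ! i) (ws[m := v] ! \<pi> i)) =
          b (vs ! q) v * (\<Prod>i\<in>{..<?k} - {q}. b (vs ! i) (ws ! \<pi> i))" for v
      proof -
        have "(\<Prod>i<?k. b (vs ! i) (ws[m := v] ! \<pi> i)) =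
            b (vs ! q) (ws[m := v] ! \<pi> q) * (\<Prod>i\<in>{..<?k} - {q}. b (vs ! i) (ws[m := v] ! \<pi> i))"
          using q by (intro prod.remove) auto
        moreover have "ws[m := v] ! \<pi> i = ws ! \<pi> i" if "i \<noteq> q" for i
          using that q permutes_inj[OF p] by (metis injD nth_list_update_neq)
        ultimately show ?thesis using q l m by simp
      qed
      then have "(\<lambda>v. of_int (sign \<pi>) * (\<Prod>i<?k. b (vs ! i) (ws[m := v] ! \<pi> i))) =
          (\<lambda>v. (of_int (sign \<pi>) * (\<Prod>i\<in>{..<?k} - {q}. b (vs ! i) (ws ! \<pi> i))) *\<^sub>R b (vs ! q) v)"
        by (simp add: fun_eq_iff mult_ac)
      then show ?thesis using linear_compose_scale_right[OF lr] by simp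
    qed
    then have "linear (\<lambda>v. \<Sum>\<pi> | \<pi> permutes {..<?k}. of_int (sign \<pi>) * (\<Prod>i<?k. b (vs ! i) (ws[m := v] ! \<pi> i)))"
      by (intro linear_compose_sum) auto
    then show ?thesis using l by (simp add: gram_form_def)
  qed
  moreover have "gram_form b vs ws = 0"
    if l: "length ws = ?k" and ij: "i < j" "j < ?k" and eq: "ws ! i = ws ! j" for ws i j
  proof -
    let ?t = "Transposition.transpose i j"
    let ?f = "\<lambda>\<pi>. of_int (sign \<pi>) * (\<Prod>i<?k. b (vs ! i) (ws ! \<pi> i))"
    have t: "?t permutes {..<?k}" by (rule permutes_swap_id) (use ij in auto)
    have "sum ?f {\<pi>. \<pi> permutes {..<?k}} = sum (\<lambda>\<pi>. ?f (?t \<circ> \<pi>)) {\<pi>. \<pi> permutes {..<?k}}"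
      by (rule setum_permutations_compose_left[OF t])
    also have "\<dots> = sum (\<lambda>\<pi>. - ?f \<pi>) {\<pi>. \<pi> permutes {..<?k}}"
    proof (rule sum.cong[OF refl])
      fix \<pi> assume "\<pi> \<in> {\<pi>. \<pi> permutes {..<?k}}"
      then have "permutation \<pi>" using permutation_permutes finite_lessThan by blast
      then have "sign (?t \<circ> \<pi>) = - sign \<pi>"
        using sign_compose[OF permutation_swap_id[of i j]] ij by (simp add: sign_swap_id)
      moreover have "ws ! ?t m = ws ! m" for m using eq by (simp add: Transposition.transpose_def)
      ultimately show "?f (?t \<circ> \<pi>) = - ?f \<pi>" by simp
    qed
    finally have "sum ?f {\<pi>. \<pi> permutes {..<?k}} = - sum ?f {\<pi>. \<pi> permutes {..<?k}}"
      by (simp only: sum_negf)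
    then show ?thesis using l by (simp add: gram_form_def)
  qed
  ultimately show ?thesis unfolding alt_forms_def by (simp add: gram_form_def)
qed

lemma gram_form_commute:
  assumes sym: "\<And>v w. b v w = b w v"
  shows "gram_form b vs ws = gram_form b ws vs"
proof (cases "length ws = length vs")
  case True
  let ?k = "length vs"
  have "(\<Sum>\<pi> | \<pi> permutes {..<?k}. of_int (sign \<pi>) * (\<Prod>i<?k. b (vs ! i) (ws ! \<pi> i)))
    = (\<Sum>\<pi> | \<pi> permutes {..<?k}. of_int (sign (inv \<pi>)) * (\<Prod>i<?k. b (vs ! i) (ws ! inv \<pi> i)))"
    by (rule sum_permutations_inverse)
  also have "\<dots> = (\<Sum>\<pi> | \<pi> permutes {..<?k}. of_int (sign \<pi>) * (\<Prod>i<?k. b (ws ! i) (vs ! \<pi> i)))"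
  proof (rule sum.cong[OF refl])
    fix \<pi> assume "\<pi> \<in> {\<pi>. \<pi> permutes {..<?k}}"
    then have p: "\<pi> permutes {..<?k}" by simp
    have "(\<Prod>i<?k. b (vs ! i) (ws ! inv \<pi> i)) = (\<Prod>i<?k. b (vs ! \<pi> i) (ws ! inv \<pi> (\<pi> i)))"
      using prod.permute[OF p, of "\<lambda>i. b (vs ! i) (ws ! inv \<pi> i)"] by (simp add: o_def)
    then show "of_int (sign (inv \<pi>)) * (\<Prod>i<?k. b (vs ! i) (ws ! inv \<pi> i)) =
        real_of_int (sign \<pi>) * (\<Prod>i<?k. b (ws ! i) (vs ! \<pi> i))"
      using sign_inverse[OF permutes_imp_permutation[OF finite_lessThan p]] permutes_inverses(2)[OF p] sym
      by (simp add: sym)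
  qed
  finally show ?thesis using True by (simp add: gram_form_def)
qed (simp add: gram_form_def)

lemma gram_det_orthonormal:
  assumes "orthonormal b es"
  shows "gram_det b es = 1"
proof -
  let ?k = "length es"
  have "gram_det b es = (\<Sum>\<pi> | \<pi> permutes {..<?k}. if \<pi> = id then 1 else 0)"
    unfolding gram_det_def
  proof (rule sum.cong[OF refl])
    fix \<pi> assume "\<pi> \<in> {\<pi>. \<pi> permutes {..<?k}}"
    then have p: "\<pi> permutes {..<?k}" by simp
    have pk: "\<pi> i < ?k" if "i < ?k" for i using permutes_in_image[OF p, of i] that by simp
    have e: "(\<Prod>i<?k. b (es ! i) (es ! \<pi> i)) = (\<Prod>i<?k. if i = \<pi> i then 1 else 0)"
      by (rule prod.cong[OF refl]) (use assms pk in \<open>simp add: orthonormal_def\<close>)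
    show "of_int (sign \<pi>) * (\<Prod>i<?k. b (es ! i) (es ! \<pi> i)) = (if \<pi> = id then 1 else 0)"
    proof (cases "\<pi> = id")
      case False
      then obtain i where "\<pi> i \<noteq> i" by (auto simp: fun_eq_iff)
      then have "i < ?k" using p by (auto simp: permutes_def)
      then have "(\<Prod>i<?k. if i = \<pi> i then 1 else 0 :: real) = 0"
        using \<open>\<pi> i \<noteq> i\<close> by (intro prod_zero bexI[of _ i]) auto
      then show ?thesis using False e by simp
    next
      case True
      have "(\<Prod>i<?k. b (es ! i) (es ! \<pi> i)) = 1" unfolding e using True by simp
      then show ?thesis using True by simp
    qed
  qed
  also have "\<dots> = 1" by (simp add: finite_permutations permutes_id)
  finally show ?thesis .
qed

lemma orthonormal_wedge_unit_simple:
  "orthonormal b es \<Longrightarrow> wedge es \<in> unit_simple b (length es)"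
  using gram_det_orthonormal by (auto simp: unit_simple_def)

text \<open>Orthogonalization gives a frame \<open>es\<close> and a number \<open>d\<close> with \<open>\<omega> vs = d * \<omega> es\<close> for all \<open>\<omega>\<close>.
  Applied to the form \<open>gram_form\<close> in each of its two arguments, this yields \<open>1 = d\<^sup>2\<close>; a sign
  is absorbed into the first vector of the frame.\<close>

lemma unit_simple_orthonormal:
  fixes b :: "real^'n::finite \<Rightarrow> real^'n \<Rightarrow> real"
  assumes b: "is_inner_product b" and "\<xi> \<in> unit_simple b k"
  obtains es where "length es = k" "orthonormal b es" "\<xi> = wedge es"
proof -
  obtain vs where vs: "length vs = k" "gram_det b vs = 1" "\<xi> = wedge vs"
    using assms(2) by (auto simp: unit_simple_def)
  have bil: "bilinear b" and sym: "b v w = b w v" for v w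
    using b by (auto simp: is_inner_product_def)
  have gf: "gram_form b ws ws = gram_det b ws" for ws by (simp add: gram_form_def gram_det_def)
  have ga: "gram_form b ws \<in> alt_forms k" if "length ws = k" for ws
    using gram_form_alt_forms[OF bil, of ws] that by simp
  obtain es d where es: "length es = k"
      "\<And>i j. i < k \<Longrightarrow> j < k \<Longrightarrow> b (es ! i) (es ! j) = (if i = j then 1 else 0)"
      "\<And>\<omega>. \<omega> \<in> alt_forms k \<Longrightarrow> \<omega> vs = d * \<omega> es"
    using gram_schmidt_alt_forms[OF b vs(1) order_refl] ga[OF vs(1)] gf[of vs] vs(2)
    by (metis zero_neq_one)
  have on: "orthonormal b es" using es by (simp add: orthonormal_def)
  have "1 = gram_form b vs vs" using gf vs(2) by simp
  also have "\<dots> = d * gram_form b vs es" using es(3)[OF ga[OF vs(1)]] .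
  also have "gram_form b vs es = gram_form b es vs" by (rule gram_form_commute[OF sym])
  also have "\<dots> = d * gram_form b es es" using es(3)[OF ga[OF es(1)]] .
  also have "gram_form b es es = 1" using gf gram_det_orthonormal[OF on] by simp
  finally have "d * d = 1" by simp
  then consider "d = 1" | "d = -1" using square_eq_1_iff[of d] by blast
  then show ?thesis
  proof cases
    case 1
    then have "\<xi> = wedge es" using vs es by (auto simp: wedge_def fun_eq_iff)
    then show ?thesis using that es(1) on by blast
  next
    case 2
    show ?thesis
    proof (cases "k = 0")
      case True
      then have "\<xi> = wedge es" using vs es by simp
      then show ?thesis using that es(1) on by blast
    next
      case False
      let ?es = "es[0 := - es ! 0]"
      have neg: "b (- v) w = - b v w" "b v (- w) = - b v w" for v w
        using bil by (auto simp: bilinear_lneg bilinear_rneg)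
      have "orthonormal b ?es"
        using on False es(1) unfolding orthonormal_def
        by (auto simp: nth_list_update neg)
      moreover have "\<xi> = wedge ?es"
      proof -
        have "\<omega> vs = \<omega> ?es" if w: "\<omega> \<in> alt_forms k" for \<omega>
          using es(3)[OF w] 2 linear_neg[OF alt_forms_linear[OF w es(1), of 0], of "es ! 0"] False by simp
        then show ?thesis using vs es(1) by (auto simp: wedge_def fun_eq_iff)
      qed
      ultimately show ?thesis using that[of ?es] es(1) by simp
    qed
  qed
qed

section \<open>The first cousin principle\<close>

text \<open>A form of comass one attains its maximum over all frames at \<open>es\<close>, so its first variation
  vanishes in the directions that rotate an entry out of the plane.\<close>

lemma first_cousin:
  fixes b :: "real^'n::finite \<Rightarrow> real^'n \<Rightarrow> real"
  assumes b: "is_inner_product b" and w: "\<omega> \<in> alt_forms k"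
    and comass: "\<And>es. length es = k \<Longrightarrow> orthonormal b es \<Longrightarrow> \<omega> es \<le> 1"
    and es: "length es = k" "orthonormal b es" "\<omega> es = 1"
    and n: "\<And>i. i < k \<Longrightarrow> b n (es ! i) = 0" and j: "j < k"
  shows "\<omega> (es[j := n]) = 0"
proof (cases "n = 0")
  case True
  then show ?thesis using linear_0[OF alt_forms_linear[OF w es(1) j]] by simp
next
  case False
  have lr: "linear (b v)" and ll: "linear (\<lambda>v. b v w)" for v w
    using b by (auto simp: is_inner_product_def bilinear_def)
  have sym: "b v w = b w v" for v w using b by (simp add: is_inner_product_def)
  have lin: "linear (\<lambda>v. \<omega> (es[j := v]))" by (rule alt_forms_linear[OF w es(1) j])
  have pos: "b n n > 0" using b False by (simp add: is_inner_product_def)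
  define r where "r = sqrt (b n n)"
  have r: "r > 0" "r * r = b n n" using pos by (auto simp: r_def)
  define u where "u = (1 / r) *\<^sub>R n"
  have u1: "b u u = 1"
    using r pos by (simp add: u_def linear_scale[OF ll] linear_scale[OF lr] field_simps)
  have u0: "b u (es ! i) = 0" "b (es ! i) u = 0" if "i < k" for i
    using n[OF that] sym[of "es ! i" u] by (simp_all add: u_def linear_scale[OF ll])
  define c where "c = \<omega> (es[j := u])"
  define s where "s = sqrt (1 + c\<^sup>2)"
  have s: "s > 0" "s * s = 1 + c * c" by (auto simp: s_def add_pos_nonneg power2_eq_square)
  \<comment> \<open>Rotating the \<open>j\<close>-th vector of the frame towards \<open>u\<close> by the angle with tangent \<open>c\<close>
    gives the frame of largest value \<open>sqrt (1 + c\<^sup>2)\<close>.\<close>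
  define e where "e = (1 / s) *\<^sub>R es ! j + (c / s) *\<^sub>R u"
  have ejj: "b (es ! i) (es ! m) = (if i = m then 1 else 0)" if "i < k" "m < k" for i m
    using es that by (simp add: orthonormal_def)
  have e1: "b e e = 1"
  proof -
    have "b e e = (1 / s) * (1 / s) + (c / s) * (c / s)"
      unfolding e_def using ejj[OF j j] u0[OF j] u1
      by (simp add: linear_add[OF ll] linear_scale[OF ll] linear_add[OF lr] linear_scale[OF lr])
    also have "\<dots> = (1 + c * c) / (s * s)" by (simp add: add_divide_distrib)
    also have "\<dots> = 1" unfolding s(2)[symmetric] using s(1) by simp
    finally show ?thesis .
  qed
  have e0: "b e (es ! i) = 0" "b (es ! i) e = 0" if "i < k" "i \<noteq> j" for i
  proof -
    show "b e (es ! i) = 0"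
      unfolding e_def using ejj[OF j that(1)] u0[OF that(1)] that
      by (simp add: linear_add[OF ll] linear_scale[OF ll])
    then show "b (es ! i) e = 0" using sym by simp
  qed
  have "orthonormal b (es[j := e])"
    unfolding orthonormal_def
  proof (intro allI impI)
    fix i m assume "i < length (es[j := e])" "m < length (es[j := e])"
    then show "b (es[j := e] ! i) (es[j := e] ! m) = (if i = m then 1 else 0)"
      using ejj e0 e1 es(1) j by (cases "i = j"; cases "m = j") auto
  qed
  then have "\<omega> (es[j := e]) \<le> 1" using comass es(1) by simp
  moreover have "\<omega> (es[j := e]) = (1 / s) * 1 + (c / s) * c"
    unfolding e_def c_def using linear_add[OF lin] linear_scale[OF lin] es(3) by simp
  moreover have "(1 / s) * 1 + (c / s) * c = s"
    using s by (simp add: field_simps)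
  ultimately have "s \<le> 1" by simp
  then have "s * s \<le> 1" using s(1) by (simp add: mult_le_one)
  then have "c = 0" using s(2) by (simp add: power2_eq_square[symmetric])
  then show ?thesis
    using linear_scale[OF lin, of "1 / r" n] r(1) by (simp add: c_def u_def)
qed

text \<open>Decompose \<open>G\<close> into its projection to the plane and a normal vector. The normal vector
  contributes nothing by the first cousin principle, and by alternation the projection
  contributes its squared length. For \<open>G = \<nabla>f\<close> the sum is the value of
  \<open>df \<and> d\<^sup>\<phi>f\<close> on the plane.\<close>

lemma contraction_plane_nonneg:
  fixes b :: "real^'n::finite \<Rightarrow> real^'n \<Rightarrow> real"
  assumes b: "is_inner_product b" and w: "\<omega> \<in> alt_forms k"
    and comass: "\<And>es. length es = k \<Longrightarrow> orthonormal b es \<Longrightarrow> \<omega> es \<le> 1"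
    and es: "length es = k" "orthonormal b es" "\<omega> es = 1"
  shows "(\<Sum>i<k. b G (es ! i) * \<omega> (es[i := G])) \<ge> 0"
proof -
  have ll: "linear (\<lambda>v. b v w)" for w
    using b by (auto simp: is_inner_product_def bilinear_def)
  have ejj: "b (es ! i) (es ! m) = (if i = m then 1 else 0)" if "i < k" "m < k" for i m
    using es that by (simp add: orthonormal_def)
  define n where "n = G - (\<Sum>j<k. b G (es ! j) *\<^sub>R es ! j)"
  have n0: "b n (es ! i) = 0" if "i < k" for i
  proof -
    have "b n (es ! i) = b G (es ! i) - (\<Sum>j<k. b G (es ! j) * b (es ! j) (es ! i))"
      unfolding n_def by (simp add: linear_diff[OF ll] linear_sum[OF ll] linear_scale[OF ll])
    also have "(\<Sum>j<k. b G (es ! j) * b (es ! j) (es ! i)) = (\<Sum>j<k. if j = i then b G (es ! j) else 0)"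
      by (rule sum.cong[OF refl]) (use ejj that in auto)
    finally show ?thesis using that by simp
  qed
  have "\<omega> (es[i := G]) = b G (es ! i)" if i: "i < k" for i
  proof -
    have lin: "linear (\<lambda>v. \<omega> (es[i := v]))" by (rule alt_forms_linear[OF w es(1) i])
    have "\<omega> (es[i := es ! j]) = (if j = i then 1 else 0)" if "j < k" for j
      using alt_forms_repeat[OF w, of i j "es[i := es ! j]"] that i es by auto
    then have "(\<Sum>j<k. b G (es ! j) * \<omega> (es[i := es ! j])) = (\<Sum>j<k. if j = i then b G (es ! j) else 0)"
      by (intro sum.cong refl) auto
    also have "\<dots> = b G (es ! i)" using i by simp
    finally have s: "(\<Sum>j<k. b G (es ! j) * \<omega> (es[i := es ! j])) = b G (es ! i)" .
    have "G = n + (\<Sum>j<k. b G (es ! j) *\<^sub>R es ! j)" by (simp add: n_def)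
    then have "\<omega> (es[i := G]) = \<omega> (es[i := n + (\<Sum>j<k. b G (es ! j) *\<^sub>R es ! j)])" by simp
    also have "\<dots> = \<omega> (es[i := n]) + (\<Sum>j<k. b G (es ! j) * \<omega> (es[i := es ! j]))"
      by (simp add: linear_add[OF lin] linear_sum[OF lin] linear_scale[OF lin])
    also have "\<omega> (es[i := n]) = 0" by (rule first_cousin[OF b w comass es n0 i])
    finally show ?thesis using s by simp
  qed
  then show ?thesis by (intro sum_nonneg) simp
qed

section \<open>Symmetry of second derivatives\<close>

text \<open>By the mean value theorem in the direction \<open>i\<close>, the second difference is \<open>h\<close> times a
  difference of values of \<open>pd i f\<close> near \<open>y\<close>, which the differential of \<open>pd i f\<close> approximates.
  The second difference is symmetric in \<open>i\<close> and \<open>j\<close>, so its limit is too.\<close>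

lemma second_difference_limit:
  fixes f :: "real^'n::finite \<Rightarrow> real"
  assumes "open S" "y \<in> S" "\<And>z. z \<in> S \<Longrightarrow> f differentiable (at z)"
    and g: "(pd i f has_derivative g) (at y)" and "e > 0"
  shows "\<exists>d>0. \<forall>h. 0 < h \<and> h < d \<longrightarrow>
    \<bar>(f (y + h *\<^sub>R axis i 1 + h *\<^sub>R axis j 1) - f (y + h *\<^sub>R axis i 1) - f (y + h *\<^sub>R axis j 1) + f y)
      - h * h * g (axis j 1)\<bar> \<le> e * (h * h)"
proof -
  have "e / 3 > 0" using assms(5) by simp
  then obtain d1 where d1: "d1 > 0" "\<And>z. norm (z - y) < d1 \<Longrightarrow>
      \<bar>pd i f z - pd i f y - g (z - y)\<bar> \<le> e / 3 * norm (z - y)"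
    using g unfolding has_derivative_at_alt real_norm_def by blast
  obtain d2 where d2: "d2 > 0" "ball y d2 \<subseteq> S" using assms(1,2) open_contains_ball by blast
  have lin: "linear g" using g has_derivative_linear by blast
  let ?ei = "axis i 1 :: real^'n" and ?ej = "axis j 1 :: real^'n"
  define d where "d = min d1 d2 / 3"
  show ?thesis
  proof (intro exI[of _ d] conjI allI impI)
    show "d > 0" using d1 d2 by (simp add: d_def)
    fix h assume "0 < h \<and> h < d"
    then have h: "0 < h" "h < d" by auto
    let ?p = "\<lambda>s t. y + s *\<^sub>R ?ei + t *\<^sub>R ?ej"
    have nrm: "norm (?p s t - y) \<le> \<bar>s\<bar> + \<bar>t\<bar>" for s t
    proof -
      have "?p s t - y = s *\<^sub>R ?ei + t *\<^sub>R ?ej" by simp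
      then show ?thesis using norm_triangle_ineq[of "s *\<^sub>R ?ei" "t *\<^sub>R ?ej"] by simp
    qed
    have inS: "?p s t \<in> S" if "\<bar>s\<bar> \<le> h" "\<bar>t\<bar> \<le> h" for s t
    proof -
      have "norm (?p s t - y) < d2" using nrm[of s t] that h by (simp add: d_def)
      then have "?p s t \<in> ball y d2" by (subst mem_ball, subst dist_commute, subst dist_norm)
      then show ?thesis using d2(2) by blast
    qed
    have der: "((\<lambda>s. f (?p s t)) has_real_derivative pd i f (?p s t)) (at s)"
      if "\<bar>s\<bar> \<le> h" "\<bar>t\<bar> \<le> h" for s t
    proof -
      have f': "(f has_derivative fderiv f (?p s t)) (at (?p s t))"
        using assms(3)[OF inS[OF that]] frechet_derivative_works by blast
      have "((\<lambda>s. ?p s t) has_derivative (\<lambda>r. r *\<^sub>R ?ei)) (at s)"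
        by (auto intro!: derivative_eq_intros)
      from diff_chain_at[OF this f']
      have "((\<lambda>s. f (?p s t)) has_derivative (\<lambda>r. fderiv f (?p s t) (r *\<^sub>R ?ei))) (at s)"
        by (simp add: o_def)
      moreover have "(\<lambda>r. fderiv f (?p s t) (r *\<^sub>R ?ei)) = (*) (pd i f (?p s t))"
        using linear_scale[OF has_derivative_linear[OF f']] by (simp add: fun_eq_iff pd_def mult.commute)
      ultimately show ?thesis by (simp add: has_field_derivative_def)
    qed
    have "\<exists>s. 0 < s \<and> s < h \<and> (f (?p h h) - f (?p h 0)) - (f (?p 0 h) - f (?p 0 0)) =
        (h - 0) * (pd i f (?p s h) - pd i f (?p s 0))"
    proof (rule MVT2[where f = "\<lambda>s. f (?p s h) - f (?p s 0)"])
      show "0 < h" by (rule h)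
      show "((\<lambda>s. f (?p s h) - f (?p s 0)) has_real_derivative pd i f (?p s h) - pd i f (?p s 0)) (at s)"
        if "0 \<le> s" "s \<le> h" for s
        using that h by (intro DERIV_diff der) auto
    qed
    then obtain s where s: "0 < s" "s < h"
      and eq: "(f (?p h h) - f (?p h 0)) - (f (?p 0 h) - f (?p 0 0)) = h * (pd i f (?p s h) - pd i f (?p s 0))"
      by auto
    have n1: "norm (?p s h - y) \<le> 2 * h" "norm (?p s 0 - y) \<le> h"
      using nrm[of s h] nrm[of s 0] s h by auto
    then have "norm (?p s h - y) < d1" "norm (?p s 0 - y) < d1" using h by (auto simp: d_def)
    then have b1: "\<bar>pd i f (?p s h) - pd i f y - g (?p s h - y)\<bar> \<le> e / 3 * (2 * h)"
       and b2: "\<bar>pd i f (?p s 0) - pd i f y - g (?p s 0 - y)\<bar> \<le> e / 3 * h"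
      using d1(2)[of "?p s h"] d1(2)[of "?p s 0"] n1 \<open>e / 3 > 0\<close>
      by (meson mult_left_mono order_trans less_imp_le)+
    have "g (?p s h - y) - g (?p s 0 - y) = g ((?p s h - y) - (?p s 0 - y))"
      by (simp only: linear_diff[OF lin])
    also have "\<dots> = h * g ?ej" using linear_scale[OF lin, of h ?ej] by simp
    finally have "\<bar>(pd i f (?p s h) - pd i f (?p s 0)) - h * g ?ej\<bar> \<le> e * h"
      using b1 b2 by linarith
    then have "h * \<bar>(pd i f (?p s h) - pd i f (?p s 0)) - h * g ?ej\<bar> \<le> h * (e * h)"
      using h by (intro mult_left_mono) auto
    moreover have "\<bar>h * (pd i f (?p s h) - pd i f (?p s 0)) - h * h * g ?ej\<bar> =
        h * \<bar>(pd i f (?p s h) - pd i f (?p s 0)) - h * g ?ej\<bar>"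
    proof -
      have "h * (pd i f (?p s h) - pd i f (?p s 0)) - h * h * g ?ej =
          h * ((pd i f (?p s h) - pd i f (?p s 0)) - h * g ?ej)" by (simp add: algebra_simps)
      then show ?thesis using h by (simp add: abs_mult)
    qed
    ultimately have "\<bar>(f (?p h h) - f (?p h 0)) - (f (?p 0 h) - f (?p 0 0)) - h * h * g ?ej\<bar> \<le> h * (e * h)"
      unfolding eq by simp
    then show "\<bar>(f (?p h h) - f (y + h *\<^sub>R ?ei) - f (y + h *\<^sub>R ?ej) + f y) - h * h * g ?ej\<bar> \<le> e * (h * h)"
      by (simp add: algebra_simps)
  qed
qed

lemma pd_commute_real:
  fixes f :: "real^'n::finite \<Rightarrow> real"
  assumes S: "open S" "smooth_on S f" "y \<in> S"
  shows "pd i (pd j f) y = pd j (pd i f) y"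
proof -
  define G where "G i j = pd j (pd i f) y" for i j
  have G: "G i j = fderiv (pd i f) y (axis j 1)" for i j by (simp add: G_def pd_def)
  have d: "(pd i f has_derivative fderiv (pd i f) y) (at y)" for i
    using smooth_on_has_derivative[OF smooth_on_pd[OF S(2)] S(3)] .
  have diff: "\<And>z. z \<in> S \<Longrightarrow> f differentiable at z" using smooth_on_differentiable[OF S(2)] .
  have "\<bar>G i j - G j i\<bar> \<le> 2 * e" if e: "e > 0" for e
  proof -
    let ?D = "\<lambda>i j h. f (y + h *\<^sub>R axis i 1 + h *\<^sub>R axis j 1) - f (y + h *\<^sub>R axis i 1) - f (y + h *\<^sub>R axis j 1) + f y"
    have lim: "\<exists>d>0. \<forall>h. 0 < h \<and> h < d \<longrightarrow> \<bar>?D i j h - h * h * G i j\<bar> \<le> e * (h * h)" for i j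
      unfolding G by (rule second_difference_limit[OF S(1,3) diff d e])
    obtain d1 where d1: "d1 > 0" "\<forall>h. 0 < h \<and> h < d1 \<longrightarrow> \<bar>?D i j h - h * h * G i j\<bar> \<le> e * (h * h)"
      using lim[of i j] by (elim exE conjE)
    obtain d2 where d2: "d2 > 0" "\<forall>h. 0 < h \<and> h < d2 \<longrightarrow> \<bar>?D j i h - h * h * G j i\<bar> \<le> e * (h * h)"
      using lim[of j i] by (elim exE conjE)
    define h where "h = min d1 d2 / 2"
    have h: "0 < h" "h < d1" "h < d2" using d1(1) d2(1) by (auto simp: h_def)
    have "?D i j h = ?D j i h" by (simp add: add.assoc add.commute[of "h *\<^sub>R axis i 1"])
    then have "\<bar>h * h * G i j - h * h * G j i\<bar> \<le> 2 * (e * (h * h))"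
      using d1(2)[rule_format, of h] d2(2)[rule_format, of h] h by linarith
    moreover have "h * h * G i j - h * h * G j i = (h * h) * (G i j - G j i)" by (simp add: algebra_simps)
    ultimately have "(h * h) * \<bar>G i j - G j i\<bar> \<le> (h * h) * (2 * e)"
      using h by (simp add: abs_mult mult_ac)
    moreover have "h * h > 0" using h by simp
    ultimately show ?thesis by (simp only: mult_le_cancel_left_pos)
  qed
  from this[of "\<bar>G i j - G j i\<bar> / 4"] have "G i j = G j i"
    by (cases "G i j = G j i") auto
  then show ?thesis by (simp add: G_def)
qed

lemma pd_commute:
  fixes f :: "real^'n::finite \<Rightarrow> real^'m::finite"
  assumes S: "open S" "smooth_on S f" "y \<in> S"
  shows "pd i (pd j f) y = pd j (pd i f) y"
proof (rule vec_eq_iff[THEN iffD2], rule allI)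
  fix l
  have nth: "pd i g z $ l = pd i (\<lambda>z. g z $ l) z" if "smooth_on S g" "z \<in> S" for g :: "real^'n \<Rightarrow> real^'m" and z i
    using pd_eq[OF bounded_linear.has_derivative[OF bounded_linear_vec_nth smooth_on_has_derivative[OF that]]]
    by (simp add: pd_def)
  have "pd i (pd j f) y $ l = pd i (pd j (\<lambda>z. f z $ l)) y" for i j
    unfolding nth[OF smooth_on_pd[OF S(2)] S(3)]
    by (rule pd_cong_open[OF S(1,3)]) (rule nth[OF S(2)])
  then show "pd i (pd j f) y $ l = pd j (pd i f) y $ l"
    using pd_commute_real[OF S(1) smooth_on_nth[OF S(1,2)] S(3)] by simp
qed

definition second_derivative :: "(real^'n::finite \<Rightarrow> 'b::real_normed_vector) \<Rightarrow> real^'n \<Rightarrow> real^'n \<Rightarrow> real^'n \<Rightarrow> 'b" where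
  "second_derivative f y v w = fderiv (\<lambda>z. fderiv f z w) y v"

lemma second_derivative_has_derivative:
  fixes f :: "real^'n::finite \<Rightarrow> 'b::real_normed_vector"
  assumes S: "open S" "smooth_on S f" "y \<in> S"
  shows "((\<lambda>z. fderiv f z w) has_derivative (\<lambda>v. second_derivative f y v w)) (at y)"
    and "second_derivative f y v w = (\<Sum>j\<in>UNIV. \<Sum>i\<in>UNIV. (w $ j * v $ i) *\<^sub>R pd i (pd j f) y)"
proof -
  have d: "(pd j f has_derivative fderiv (pd j f) y) (at y)" for j
    using smooth_on_has_derivative[OF smooth_on_pd[OF S(2)] S(3)] .
  have "((\<lambda>z. \<Sum>j\<in>UNIV. w $ j *\<^sub>R pd j f z) has_derivative
      (\<lambda>v. \<Sum>j\<in>UNIV. w $ j *\<^sub>R fderiv (pd j f) y v)) (at y)"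
    by (intro has_derivative_sum has_derivative_scaleR_right d)
  then have *: "((\<lambda>z. fderiv f z w) has_derivative
      (\<lambda>v. \<Sum>j\<in>UNIV. w $ j *\<^sub>R fderiv (pd j f) y v)) (at y)"
    by (rule has_derivative_transform_within_open[OF _ S(1,3)])
      (rule frechet_derivative_axis_expansion[OF smooth_on_differentiable[OF S(2)], symmetric])
  then show "((\<lambda>z. fderiv f z w) has_derivative (\<lambda>v. second_derivative f y v w)) (at y)"
    unfolding second_derivative_def using frechet_derivative_at[OF *] by simp
  have "second_derivative f y v w = (\<Sum>j\<in>UNIV. w $ j *\<^sub>R fderiv (pd j f) y v)"
    unfolding second_derivative_def by (rule frechet_derivative_eqI[OF *])
  also have "\<dots> = (\<Sum>j\<in>UNIV. \<Sum>i\<in>UNIV. (w $ j * v $ i) *\<^sub>R pd i (pd j f) y)"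
    using frechet_derivative_axis_expansion[OF smooth_on_differentiable[OF smooth_on_pd[OF S(2)] S(3)], of _ v]
    by (simp add: scaleR_sum_right)
  finally show "second_derivative f y v w = (\<Sum>j\<in>UNIV. \<Sum>i\<in>UNIV. (w $ j * v $ i) *\<^sub>R pd i (pd j f) y)" .
qed

lemma second_derivative_commute:
  fixes f :: "real^'n::finite \<Rightarrow> real^'m::finite"
  assumes S: "open S" "smooth_on S f" "y \<in> S"
  shows "second_derivative f y v w = second_derivative f y w v"
  unfolding second_derivative_has_derivative(2)[OF S]
  by (subst sum.swap) (simp add: pd_commute[OF S] mult.commute)

section \<open>Derivatives of families of alternating forms\<close>

lemma alt_forms_derivative:
  fixes \<beta> :: "real^'m::finite \<Rightarrow> (real^'n::finite) list \<Rightarrow> real"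
  assumes alt: "\<And>z. \<beta> z \<in> alt_forms k"
    and d: "\<And>L. length L = k \<Longrightarrow> (\<lambda>z. \<beta> z L) differentiable (at y)"
  shows "(\<lambda>L. fderiv (\<lambda>z. \<beta> z L) y u) \<in> alt_forms k"
proof -
  let ?D = "\<lambda>L. fderiv (\<lambda>z. \<beta> z L) y"
  have z: "(\<lambda>z. \<beta> z L) = (\<lambda>z. 0)" if "length L \<noteq> k" for L
    using alt_forms_length[OF alt that] by simp
  have fd: "((\<lambda>z. \<beta> z L) has_derivative ?D L) (at y)" if "length L = k" for L
    using d[OF that] frechet_derivative_works by blast
  have "linear (\<lambda>v. ?D (L[i := v]) u)" if L: "length L = k" "i < k" for L i
  proof (rule linearI)
    have fdu: "((\<lambda>z. \<beta> z (L[i := v])) has_derivative ?D (L[i := v])) (at y)" for v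
      using fd L by simp
    note lin = alt_forms_linear[OF alt L]
    fix v w r
    have "((\<lambda>z. \<beta> z (L[i := v + w])) has_derivative (\<lambda>u. ?D (L[i := v]) u
        + ?D (L[i := w]) u)) (at y)"
      unfolding linear_add[OF lin] by (intro has_derivative_add fdu)
    then show "?D (L[i := v + w]) u =
      ?D (L[i := v]) u + ?D (L[i := w]) u"
      by (rule frechet_derivative_eqI)
    have "((\<lambda>z. \<beta> z (L[i := r *\<^sub>R v])) has_derivative (\<lambda>u. r *\<^sub>R ?D (L[i := v]) u)) (at y)"
      unfolding linear_scale[OF lin] by (intro has_derivative_scaleR_right fdu)
    then show "?D (L[i := r *\<^sub>R v]) u =
      r *\<^sub>R ?D (L[i := v]) u"
      by (rule frechet_derivative_eqI)
  qed
  moreover have "?D L u = 0"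
    if "length L = k" "i < j" "j < k" "L ! i = L ! j" for L i j
  proof -
    have "(\<lambda>z. \<beta> z L) = (\<lambda>z. 0)"
      using alt_forms_repeat[OF alt, of i j L] that by auto
    then show ?thesis by simp
  qed
  ultimately show ?thesis unfolding alt_forms_def using z by simp
qed

lemma alt_forms_axis_expansion:
  assumes "\<omega> \<in> alt_forms k" "Suc (length xs + length ys) = k"
  shows "(\<Sum>l\<in>UNIV. v $ l * \<omega> (xs @ axis l 1 # ys)) = \<omega> (xs @ v # ys)"
  using linear_axis_expansion[OF alt_forms_linear_append[OF assms], of v] by simp

text \<open>The product rule for a family of alternating forms evaluated on moving vectors, proved
  by letting one more vector move at a time.\<close>

lemma alt_forms_product_rule:
  fixes \<gamma> :: "real^'m::finite \<Rightarrow> (real^'n::finite) list \<Rightarrow> real" and us :: "nat \<Rightarrow> real^'m \<Rightarrow> real^'n"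
  assumes alt: "\<And>z. \<gamma> z \<in> alt_forms k"
    and d: "\<And>L. length L = k \<Longrightarrow> (\<lambda>z. \<gamma> z L) differentiable (at y)"
    and u: "\<And>a. a < k \<Longrightarrow> (us a has_derivative us' a) (at y)"
  shows "m \<le> k \<Longrightarrow> length L = k - m \<Longrightarrow>
    ((\<lambda>z. \<gamma> z (map (\<lambda>a. us a z) [0..<m] @ L)) has_derivative
     (\<lambda>v. fderiv (\<lambda>z. \<gamma> z (map (\<lambda>a. us a y) [0..<m] @ L)) y v
        + (\<Sum>a<m. \<gamma> y ((map (\<lambda>a. us a y) [0..<m] @ L)[a := us' a v])))) (at y)"
proof (induction m arbitrary: L)
  case 0
  then show ?case using d[of L] frechet_derivative_works by auto
next
  case (Suc m)
  let ?P = "\<lambda>z. map (\<lambda>a. us a z) [0..<m]"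
  let ?G = "\<lambda>v L. fderiv (\<lambda>z. \<gamma> z L) y v"
  have galt: "?G v \<in> alt_forms k" for v by (rule alt_forms_derivative[OF alt d])
  have len: "Suc (length (?P z) + length L) = k" for z using Suc.prems by simp
  have "((\<lambda>z. \<Sum>l\<in>UNIV. us m z $ l * \<gamma> z (?P z @ axis l 1 # L)) has_derivative
     (\<lambda>v. \<Sum>l\<in>UNIV. us m y $ l * (?G v (?P y @ axis l 1 # L) + (\<Sum>a<m. \<gamma> y ((?P y @ axis l 1 # L)[a := us' a v])))
        + us' m v $ l * \<gamma> y (?P y @ axis l 1 # L))) (at y)"
  proof (intro has_derivative_sum has_derivative_mult)
    show "((\<lambda>z. us m z $ l) has_derivative (\<lambda>v. us' m v $ l)) (at y)" for l
      using bounded_linear.has_derivative[OF bounded_linear_vec_nth u[of m]] Suc.prems by simp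
    show "((\<lambda>z. \<gamma> z (?P z @ axis l 1 # L)) has_derivative (\<lambda>v. ?G v (?P y @ axis l 1 # L) +
        (\<Sum>a<m. \<gamma> y ((?P y @ axis l 1 # L)[a := us' a v])))) (at y)" for l
      by (rule Suc.IH) (use Suc.prems in auto)
  qed
  moreover have "(\<Sum>l\<in>UNIV. us m z $ l * \<gamma> z (?P z @ axis l 1 # L)) = \<gamma> z (?P z @ us m z # L)" for z
    by (rule alt_forms_axis_expansion[OF alt len])
  moreover have "(\<Sum>l\<in>UNIV. us m y $ l * (?G v (?P y @ axis l 1 # L) + (\<Sum>a<m. \<gamma> y ((?P y @ axis l 1 # L)[a := us' a v])))
        + us' m v $ l * \<gamma> y (?P y @ axis l 1 # L))
      = ?G v (?P y @ us m y # L) + (\<Sum>a<Suc m. \<gamma> y ((?P y @ us m y # L)[a := us' a v]))" for v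
  proof -
    have 1: "(\<Sum>l\<in>UNIV. us m y $ l * ?G v (?P y @ axis l 1 # L)) = ?G v (?P y @ us m y # L)"
      by (rule alt_forms_axis_expansion[OF galt len])
    have 2: "(\<Sum>l\<in>UNIV. us' m v $ l * \<gamma> y (?P y @ axis l 1 # L)) = \<gamma> y ((?P y @ us m y # L)[m := us' m v])"
      using alt_forms_axis_expansion[OF alt[of y] len[of y], of "us' m v"] by (simp add: list_update_append)
    have "(\<Sum>l\<in>UNIV. us m y $ l * \<gamma> y ((?P y @ axis l 1 # L)[a := us' a v])) = \<gamma> y ((?P y @ us m y # L)[a := us' a v])"
      if "a < m" for a
      using alt_forms_axis_expansion[OF alt[of y], of "(?P y)[a := us' a v]" L "us m y"] len that
      by (simp add: list_update_append)
    then have 3: "(\<Sum>a<m. \<Sum>l\<in>UNIV. us m y $ l * \<gamma> y ((?P y @ axis l 1 # L)[a := us' a v])) =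
        (\<Sum>a<m. \<gamma> y ((?P y @ us m y # L)[a := us' a v]))" by simp
    have "(\<Sum>l\<in>UNIV. us m y $ l * (\<Sum>a<m. \<gamma> y ((?P y @ axis l 1 # L)[a := us' a v]))) =
        (\<Sum>a<m. \<Sum>l\<in>UNIV. us m y $ l * \<gamma> y ((?P y @ axis l 1 # L)[a := us' a v]))"
      unfolding sum_distrib_left by (rule sum.swap)
    then show ?thesis using 1 2 3 by (simp add: sum.distrib distrib_left)
  qed
  ultimately show ?case by simp
qed

section \<open>The exterior derivative in charts\<close>

context oriented_manifold
begin

lemma transition_has_derivative:
  "c \<in> A \<Longrightarrow> d \<in> A \<Longrightarrow> y \<in> overlap c d \<Longrightarrow>
    (transition c d has_derivative fderiv (transition c d) y) (at y)"
  by (rule smooth_on_has_derivative[OF smooth_transition])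

lemma frechet_transition_linear:
  "c \<in> A \<Longrightarrow> d \<in> A \<Longrightarrow> y \<in> overlap c d \<Longrightarrow> linear (fderiv (transition c d) y)"
  using has_derivative_linear[OF transition_has_derivative] .

lemma frechet_transition_chain:
  assumes c: "c \<in> A" "d \<in> A" "e \<in> A" and y: "y \<in> overlap c d" "y \<in> overlap c e"
  shows "fderiv (transition d e) (transition c d y) (fderiv (transition c d) y w)
    = fderiv (transition c e) y w"
proof -
  let ?W = "overlap c d \<inter> overlap c e"
  have W: "open ?W" "y \<in> ?W" using open_overlap[OF c(1,2)] open_overlap[OF c(1,3)] y by auto
  have "transition c d y \<in> overlap d e"
  proof -
    have "cinv c y \<in> cdom d" "cinv c y \<in> cdom e"
      using cmap_image_iff[OF c(1), of y "cdom d"] cmap_image_iff[OF c(1), of y "cdom e"] y by auto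
    then show ?thesis by (auto simp: transition_def)
  qed
  then have "((transition d e \<circ> transition c d) has_derivative
      (fderiv (transition d e) (transition c d y) \<circ> fderiv (transition c d) y)) (at y)"
    by (intro diff_chain_at transition_has_derivative c y)
  then have "(transition c e has_derivative
      (fderiv (transition d e) (transition c d y) \<circ> fderiv (transition c d) y)) (at y)"
    by (rule has_derivative_transform_within_open[OF _ W]) (use transition_transition[OF c] in auto)
  from frechet_derivative_eqI[OF this] show ?thesis by simp
qed

lemma frechet_transition_self:
  assumes "c \<in> A" "y \<in> cimg c"
  shows "fderiv (transition c c) y w = w"
proof -
  have "((\<lambda>z. z) has_derivative (\<lambda>v. v)) (at y)" by (rule has_derivative_ident)
  then have "(transition c c has_derivative (\<lambda>v. v)) (at y)"
    by (rule has_derivative_transform_within_open[OF _ open_cimg[OF assms(1)] assms(2)])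
      (simp add: transition_def cmap_cinv)
  then show ?thesis by (rule frechet_derivative_eqI)
qed

lemma from_chart_cocycle:
  assumes "c \<in> A" "d \<in> A" "x \<in> cdom c" "x \<in> cdom d"
  shows "from_chart A d x (fderiv (transition c d) (cmap c x) w) = from_chart A c x w"
proof -
  have "transition c d (cmap c x) = cmap d x" using assms by (simp add: transition_def cinv_cmap)
  then show ?thesis
    using frechet_transition_chain[OF assms(1,2) chart_at(1)[of x], of "cmap c x" w] assms chart_at(2)[of x]
    by (simp add: from_chart_def)
qed

lemma from_chart_self: "from_chart A (chart_at A x) x w = w"
  unfolding from_chart_def by (rule frechet_transition_self[OF chart_at(1) cmap_in[OF chart_at(2)]])

lemma from_chart_linear: "c \<in> A \<Longrightarrow> x \<in> cdom c \<Longrightarrow> linear (from_chart A c x)"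
  unfolding from_chart_def using frechet_transition_linear[OF _ chart_at(1)] chart_at(2) by blast

definition to_chart :: "('a, 'n) chart \<Rightarrow> 'a \<Rightarrow> real^'n \<Rightarrow> real^'n" where
  "to_chart c x = fderiv (transition (chart_at A x) c) (cmap (chart_at A x) x)"

lemma from_to_chart: "c \<in> A \<Longrightarrow> x \<in> cdom c \<Longrightarrow> from_chart A c x (to_chart c x v) = v"
  unfolding to_chart_def using from_chart_cocycle[OF chart_at(1) _ chart_at(2), of c x v] from_chart_self[of x v] by simp

lemma to_from_chart:
  assumes "c \<in> A" "x \<in> cdom c"
  shows "to_chart c x (from_chart A c x w) = w"
proof -
  let ?d = "chart_at A x"
  have "transition c ?d (cmap c x) = cmap ?d x" using assms by (simp add: transition_def cinv_cmap)
  then show ?thesis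
    using frechet_transition_chain[OF assms(1) chart_at(1)[of x] assms(1), of "cmap c x" w] assms chart_at(2)[of x]
      frechet_transition_self[OF assms(1) cmap_in[OF assms(2)], of w]
    by (simp add: from_chart_def to_chart_def)
qed

lemma in_chart_transition:
  assumes "c \<in> A" "d \<in> A" "y \<in> overlap c d"
  shows "in_chart A c \<alpha> y ws =
    in_chart A d \<alpha> (transition c d y) (map (fderiv (transition c d) y) ws)"
proof -
  have x: "cinv c y \<in> cdom c" "cinv c y \<in> cdom d" "cmap c (cinv c y) = y"
    using assms(3) cmap_image_iff[OF assms(1), of y "cdom d"] cmap_cinv[of y c] cinv_in[of y c] by auto
  show ?thesis
    using from_chart_cocycle[OF assms(1,2) x(1,2)] cinv_transition[OF assms] x(3)
    by (simp add: in_chart_def o_def)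
qed

lemma form_at_from_chart:
  "c \<in> A \<Longrightarrow> x \<in> cdom c \<Longrightarrow> \<alpha> x (map (from_chart A c x) ws) = in_chart A c \<alpha> (cmap c x) ws"
  by (simp add: in_chart_def cinv_cmap)

lemma smooth_forms_alt: "\<alpha> \<in> smooth_forms A k \<Longrightarrow> \<alpha> x \<in> alt_forms k"
  by (simp add: smooth_forms_def)

lemma in_chart_alt_forms:
  assumes "c \<in> A" "y \<in> cimg c" "\<alpha> (cinv c y) \<in> alt_forms k"
  shows "in_chart A c \<alpha> y \<in> alt_forms k"
  using alt_forms_pullback[OF assms(3) from_chart_linear[OF assms(1) cinv_in[OF assms(2)]]]
  by (simp add: in_chart_def[abs_def])

lemma in_chart_smooth:
  "\<alpha> \<in> smooth_forms A k \<Longrightarrow> c \<in> A \<Longrightarrow> length ws = k \<Longrightarrow> smooth_on (cimg c) (\<lambda>y. in_chart A c \<alpha> y ws)"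
  by (simp add: smooth_forms_def)

definition chart_ext_deriv :: "('a, 'n) chart \<Rightarrow> nat \<Rightarrow> ('a, 'n) form \<Rightarrow> real^'n \<Rightarrow> (real^'n) list \<Rightarrow> real" where
  "chart_ext_deriv c k \<alpha> y =
     antisymmetrize k (\<lambda>u L. fderiv (\<lambda>z. in_chart A c \<alpha> z L) y u)"

lemma ext_deriv_eq_chart:
  "ext_deriv A k \<alpha> x = chart_ext_deriv (chart_at A x) k \<alpha> (cmap (chart_at A x) x)"
  by (rule ext) (simp add: ext_deriv_def chart_ext_deriv_def antisymmetrize_def)

lemma in_chart_derivative_alt_forms:
  assumes "\<alpha> \<in> smooth_forms A k" "c \<in> A" "y \<in> cimg c"
  shows "(\<lambda>L. fderiv (\<lambda>z. in_chart A c \<alpha> z L) y u) \<in> alt_forms k"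
proof -
  \<comment> \<open>Outside \<open>cimg c\<close> the expression in the chart has no meaning; it is replaced by \<open>0\<close>.\<close>
  define \<beta> where "\<beta> z = (if z \<in> cimg c then in_chart A c \<alpha> z else (\<lambda>L. 0))" for z
  have eq: "in_chart A c \<alpha> z L = \<beta> z L" if "z \<in> cimg c" for z L using that by (simp add: \<beta>_def)
  have "(\<lambda>L. fderiv (\<lambda>z. \<beta> z L) y u) \<in> alt_forms k"
  proof (rule alt_forms_derivative)
    show "\<beta> z \<in> alt_forms k" for z
      using in_chart_alt_forms[OF assms(2) _ smooth_forms_alt[OF assms(1)]]
      by (simp add: \<beta>_def alt_forms_zero)
    show "(\<lambda>z. \<beta> z L) differentiable at y" if "length L = k" for L
      using smooth_on_differentiable[OF in_chart_smooth[OF assms(1,2) that] assms(3)]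
        differentiable_cong_open[OF open_cimg[OF assms(2)] assms(3), of "\<lambda>z. in_chart A c \<alpha> z L" "\<lambda>z. \<beta> z L"] eq
      by simp
  qed
  moreover have "fderiv (\<lambda>z. \<beta> z L) y = fderiv (\<lambda>z. in_chart A c \<alpha> z L) y" for L
    by (rule frechet_derivative_cong_open[OF open_cimg[OF assms(2)] assms(3)]) (simp add: eq)
  ultimately show ?thesis by simp
qed

lemma in_chart_derivative_linear:
  assumes "\<alpha> \<in> smooth_forms A k" "c \<in> A" "y \<in> cimg c"
  shows "linear (\<lambda>u. fderiv (\<lambda>z. in_chart A c \<alpha> z L) y u)"
proof (cases "length L = k")
  case True
  then show ?thesis
    using linear_frechet_derivative[OF smooth_on_differentiable[OF in_chart_smooth[OF assms(1,2) True] assms(3)]]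
    by simp
next
  case False
  then have "(\<lambda>z. in_chart A c \<alpha> z L) = (\<lambda>z. 0)"
    using alt_forms_length[OF smooth_forms_alt[OF assms(1)]] by (simp add: in_chart_def)
  then show ?thesis by (simp add: linear_zero)
qed

lemma chart_ext_deriv_alt_forms:
  assumes "\<alpha> \<in> smooth_forms A k" "c \<in> A" "y \<in> cimg c"
  shows "chart_ext_deriv c k \<alpha> y \<in> alt_forms (Suc k)"
  unfolding chart_ext_deriv_def
  by (rule antisymmetrize_alt_forms)
    (rule in_chart_derivative_alt_forms[OF assms] in_chart_derivative_linear[OF assms])+

text \<open>By the product rule, the derivative of the coefficients of \<open>\<alpha>\<close> in the chart \<open>c\<close> is
  the pull-back of the derivative in \<open>d\<close> plus terms containing the second derivative of the
  coordinate change. The latter is symmetric, so these terms cancel on antisymmetrization.\<close>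

lemma chart_ext_deriv_transition:
  assumes \<alpha>: "\<alpha> \<in> smooth_forms A k" and c: "c \<in> A" "d \<in> A" and y: "y \<in> overlap c d"
  shows "chart_ext_deriv c k \<alpha> y vs =
    chart_ext_deriv d k \<alpha> (transition c d y) (map (fderiv (transition c d) y) vs)"
proof (cases "length vs = Suc k")
  case l: True
  let ?\<tau> = "transition c d" and ?y = "transition c d y"
  let ?T = "\<lambda>z. fderiv ?\<tau> z"
  let ?S = "second_derivative ?\<tau> y"
  let ?D = "\<lambda>L. fderiv (\<lambda>z. in_chart A d \<alpha> z L) ?y"
  note W = open_overlap[OF c] and sm = smooth_transition[OF c]
  have yd: "?y \<in> cimg d" using transition_in[OF c y] by (auto simp: cimg_def)
  define \<beta> where "\<beta> z = (if z \<in> cimg d then in_chart A d \<alpha> z else (\<lambda>L. 0))" for z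
  have \<beta>alt: "\<beta> z \<in> alt_forms k" for z
    using in_chart_alt_forms[OF c(2) _ smooth_forms_alt[OF \<alpha>]] by (simp add: \<beta>_def alt_forms_zero)
  have \<beta>d: "((\<lambda>z. \<beta> z L) has_derivative ?D L) (at ?y)"
    if "length L = k" for L
    by (rule has_derivative_transform_within_open[OF smooth_on_has_derivative[OF in_chart_smooth[OF \<alpha> c(2) that] yd]
        open_cimg[OF c(2)] yd]) (simp add: \<beta>_def)
  have \<gamma>d: "((\<lambda>z. \<beta> (?\<tau> z) L) has_derivative
      (\<lambda>v. ?D L (?T y v))) (at y)" if "length L = k" for L
    using diff_chain_at[OF transition_has_derivative[OF c y] \<beta>d[OF that]] by (simp add: o_def)
  have key: "fderiv (\<lambda>z. in_chart A c \<alpha> z L) y v =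
      ?D (map (?T y) L) (?T y v)
      + (\<Sum>a<k. \<beta> ?y ((map (?T y) L)[a := ?S v (L ! a)]))" if L: "length L = k" for L v
  proof -
    have m: "map (\<lambda>a. ?T z (L ! a)) [0..<k] = map (?T z) L" for z
      using L by (auto intro: nth_equalityI)
    have "((\<lambda>z. \<beta> (?\<tau> z) (map (\<lambda>a. ?T z (L ! a)) [0..<k] @ [])) has_derivative
      (\<lambda>v. fderiv (\<lambda>z. \<beta> (?\<tau> z) (map (\<lambda>a. ?T y (L ! a)) [0..<k] @ [])) y v
        + (\<Sum>a<k. \<beta> ?y ((map (\<lambda>a. ?T y (L ! a)) [0..<k] @ [])[a := ?S v (L ! a)])))) (at y)"
      by (rule alt_forms_product_rule[where us = "\<lambda>a z. ?T z (L ! a)"])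
        (use \<beta>alt \<gamma>d second_derivative_has_derivative(1)[OF W sm y] in \<open>auto simp: differentiable_def\<close>)
    then have "((\<lambda>z. \<beta> (?\<tau> z) (map (?T z) L)) has_derivative
      (\<lambda>v. fderiv (\<lambda>z. \<beta> (?\<tau> z) (map (?T y) L)) y v
        + (\<Sum>a<k. \<beta> ?y ((map (?T y) L)[a := ?S v (L ! a)])))) (at y)"
      by (simp only: m append_Nil2)
    then have D: "((\<lambda>z. in_chart A c \<alpha> z L) has_derivative
      (\<lambda>v. fderiv (\<lambda>z. \<beta> (?\<tau> z) (map (?T y) L)) y v
        + (\<Sum>a<k. \<beta> ?y ((map (?T y) L)[a := ?S v (L ! a)])))) (at y)"
    proof (rule has_derivative_transform_within_open[OF _ W y])
      fix z assume z: "z \<in> overlap c d"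
      then have "?\<tau> z \<in> cimg d" using transition_in[OF c] by (auto simp: cimg_def)
      then show "\<beta> (?\<tau> z) (map (?T z) L) = in_chart A c \<alpha> z L"
        using in_chart_transition[OF c z] by (simp add: \<beta>_def)
    qed
    have "fderiv (\<lambda>z. \<beta> (?\<tau> z) (map (?T y) L)) y =
        (\<lambda>v. ?D (map (?T y) L) (?T y v))"
      using frechet_derivative_at[OF \<gamma>d[of "map (?T y) L"]] L by simp
    then show ?thesis using frechet_derivative_eqI[OF D] by simp
  qed
  have "chart_ext_deriv c k \<alpha> y vs = (\<Sum>i\<le>k. (-1) ^ i *
      fderiv (\<lambda>z. in_chart A c \<alpha> z (remove_nth i vs)) y (vs ! i))"
    using l by (simp add: chart_ext_deriv_def antisymmetrize_def)
  also have "\<dots> = (\<Sum>i\<le>k.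
      (-1) ^ i * ?D (map (?T y) (remove_nth i vs)) (?T y (vs ! i))
      + (-1) ^ i * (\<Sum>a<k. \<beta> ?y ((map (?T y) (remove_nth i vs))[a := ?S (vs ! i) (remove_nth i vs ! a)])))"
  proof (rule sum.cong[OF refl])
    fix i assume "i \<in> {..k}"
    then have "length (remove_nth i vs) = k" using length_remove_nth[OF l] by simp
    from key[OF this, of "vs ! i"]
    show "(-1) ^ i * fderiv (\<lambda>z. in_chart A c \<alpha> z (remove_nth i vs)) y (vs ! i) =
      (-1) ^ i * ?D (map (?T y) (remove_nth i vs)) (?T y (vs ! i))
      + (-1) ^ i * (\<Sum>a<k. \<beta> ?y ((map (?T y) (remove_nth i vs))[a := ?S (vs ! i) (remove_nth i vs ! a)]))"
      by (simp only: distrib_left)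
  qed
  also have "\<dots> = (\<Sum>i\<le>k. (-1) ^ i *
      ?D (map (?T y) (remove_nth i vs)) (?T y (vs ! i)))"
    unfolding sum.distrib
    using alt_forms_symmetric_cancel[OF \<beta>alt l second_derivative_commute[OF W sm y]] by simp
  also have "\<dots> = chart_ext_deriv d k \<alpha> ?y (map (?T y) vs)"
    using l by (simp add: chart_ext_deriv_def antisymmetrize_def take_map drop_map)
  finally show ?thesis .
qed (simp add: chart_ext_deriv_def antisymmetrize_def)

text \<open>\<open>ext_deriv\<close> is computed at each point in a chart that may jump from point to point; by the
  invariance under coordinate changes it has the same coordinate formula in every chart.\<close>

lemma in_chart_ext_deriv:
  assumes \<alpha>: "\<alpha> \<in> smooth_forms A k" and c: "c \<in> A" and y: "y \<in> cimg c"
  shows "in_chart A c (ext_deriv A k \<alpha>) y vs = chart_ext_deriv c k \<alpha> y vs"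
proof -
  let ?x = "cinv c y" and ?d = "chart_at A (cinv c y)"
  have x: "?x \<in> cdom c" "cmap c ?x = y" using y cinv_in[of y c] cmap_cinv[of y c] by auto
  have "y \<in> overlap c ?d" using cmap_image_iff[OF c] y chart_at(2) by blast
  moreover have "transition c ?d y = cmap ?d ?x" by (simp add: transition_def)
  ultimately show ?thesis
    using chart_ext_deriv_transition[OF \<alpha> c chart_at(1), of y ?x vs] x
    by (simp add: in_chart_def ext_deriv_eq_chart from_chart_def)
qed

lemma ext_deriv_smooth_forms:
  assumes \<alpha>: "\<alpha> \<in> smooth_forms A k"
  shows "ext_deriv A k \<alpha> \<in> smooth_forms A (Suc k)"
proof -
  have "ext_deriv A k \<alpha> x \<in> alt_forms (Suc k)" for x
    unfolding ext_deriv_eq_chart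
    by (rule chart_ext_deriv_alt_forms[OF \<alpha> chart_at(1) cmap_in[OF chart_at(2)]])
  moreover have "smooth_on (cimg c) (\<lambda>y. in_chart A c (ext_deriv A k \<alpha>) y vs)"
    if c: "c \<in> A" and l: "length vs = Suc k" for c vs
  proof -
    have sm: "smooth_on (cimg c) (\<lambda>y. \<Sum>i\<le>k. (-1) ^ i *
        fderiv (\<lambda>z. in_chart A c \<alpha> z (remove_nth i vs)) y (vs ! i))"
      by (intro smooth_on_sum smooth_on_cmult smooth_on_frechet_derivative open_cimg[OF c] in_chart_smooth[OF \<alpha> c])
        (use length_remove_nth[OF l] in auto)
    have eq: "(\<Sum>i\<le>k. (-1) ^ i *
        fderiv (\<lambda>z. in_chart A c \<alpha> z (remove_nth i vs)) y (vs ! i))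
      = in_chart A c (ext_deriv A k \<alpha>) y vs" if "y \<in> cimg c" for y
      using in_chart_ext_deriv[OF \<alpha> c that] l by (simp add: chart_ext_deriv_def antisymmetrize_def)
    show ?thesis by (rule smooth_on_cong[OF open_cimg[OF c] eq, THEN iffD1, OF _ sm])
  qed
  ultimately show ?thesis by (simp add: smooth_forms_def)
qed

end

section \<open>Algebra of smooth forms\<close>

context oriented_manifold
begin

lemma smooth_forms_zero: "(\<lambda>x vs. 0) \<in> smooth_forms A k"
  by (simp add: smooth_forms_def alt_forms_zero in_chart_def)

lemma smooth_forms_add:
  assumes "\<alpha> \<in> smooth_forms A k" "\<beta> \<in> smooth_forms A k"
  shows "(\<lambda>x vs. \<alpha> x vs + \<beta> x vs) \<in> smooth_forms A k"
  using assms by (simp add: smooth_forms_def alt_forms_add in_chart_def smooth_on_add open_cimg)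

lemma smooth_forms_mult:
  assumes "smooth_fun A a" "\<alpha> \<in> smooth_forms A k"
  shows "(\<lambda>x vs. a x * \<alpha> x vs) \<in> smooth_forms A k"
proof -
  have "smooth_on (cimg c) (\<lambda>y. in_chart A c (\<lambda>x vs. a x * \<alpha> x vs) y ws)"
    if "c \<in> A" "length ws = k" for c ws
    using smooth_on_mult[OF open_cimg[OF that(1)] smooth_funD[OF assms(1) that(1)] in_chart_smooth[OF assms(2) that]]
    by (simp add: in_chart_def)
  then show ?thesis using smooth_forms_alt[OF assms(2)] by (simp add: smooth_forms_def alt_forms_cmult)
qed

lemma in_chart_at: "in_chart A (chart_at A x) \<alpha> (cmap (chart_at A x) x) L = \<alpha> x L"
proof -
  have "map (from_chart A (chart_at A x) x) L = L" by (simp add: from_chart_self map_idI)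
  then show ?thesis using form_at_from_chart[OF chart_at(1) chart_at(2), of \<alpha> x L] by simp
qed

lemma in_chart_at_has_derivative:
  assumes "\<alpha> \<in> smooth_forms A k" "length L = k"
  shows "((\<lambda>z. in_chart A (chart_at A x) \<alpha> z L) has_derivative
    fderiv (\<lambda>z. in_chart A (chart_at A x) \<alpha> z L) (cmap (chart_at A x) x)) (at (cmap (chart_at A x) x))"
  by (rule smooth_on_has_derivative[OF in_chart_smooth[OF assms(1) chart_at(1) assms(2)] cmap_in[OF chart_at(2)]])

lemma ext_deriv_add_cmult:
  assumes \<alpha>: "\<alpha> \<in> smooth_forms A k" and \<beta>: "\<beta> \<in> smooth_forms A k"
  shows "ext_deriv A k (\<lambda>x vs. \<alpha> x vs + r * \<beta> x vs) x vs = ext_deriv A k \<alpha> x vs + r * ext_deriv A k \<beta> x vs"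
proof (cases "length vs = Suc k")
  case l: True
  let ?d = "chart_at A x"
  let ?D = "\<lambda>\<omega> i. fderiv (\<lambda>z. in_chart A ?d \<omega> z (remove_nth i vs)) (cmap ?d x)"
  have "?D (\<lambda>x vs. \<alpha> x vs + r * \<beta> x vs) i v = ?D \<alpha> i v + r * ?D \<beta> i v"
    if i: "i \<le> k" for i v
  proof (rule frechet_derivative_eqI)
    note L = length_remove_nth[OF l i]
    have "((\<lambda>z. in_chart A ?d \<alpha> z (remove_nth i vs) + r * in_chart A ?d \<beta> z (remove_nth i vs)) has_derivative
      (\<lambda>v. ?D \<alpha> i v + r * ?D \<beta> i v)) (at (cmap ?d x))"
      by (intro has_derivative_add has_derivative_mult_right in_chart_at_has_derivative[OF \<alpha> L] in_chart_at_has_derivative[OF \<beta> L])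
    then show "((\<lambda>z. in_chart A ?d (\<lambda>x vs. \<alpha> x vs + r * \<beta> x vs) z (remove_nth i vs)) has_derivative
      (\<lambda>v. ?D \<alpha> i v + r * ?D \<beta> i v)) (at (cmap ?d x))"
      by (simp add: in_chart_def)
  qed
  then have "ext_deriv A k (\<lambda>x vs. \<alpha> x vs + r * \<beta> x vs) x vs = (\<Sum>i\<le>k.
      (-1) ^ i * ?D \<alpha> i (vs ! i)
      + r * ((-1) ^ i * ?D \<beta> i (vs ! i)))"
    unfolding ext_deriv_def using l by (auto intro!: sum.cong simp: distrib_left)
  then show ?thesis using l by (simp add: ext_deriv_def sum.distrib sum_distrib_left)
qed (simp add: ext_deriv_def)

lemma ext_deriv_mult:
  assumes \<beta>: "\<beta> \<in> smooth_forms A k" and l: "length vs = Suc k"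
    and D: "((a \<circ> cinv (chart_at A x)) has_derivative D) (at (cmap (chart_at A x) x))"
  shows "ext_deriv A k (\<lambda>x vs. a x * \<beta> x vs) x vs =
    a x * ext_deriv A k \<beta> x vs + (\<Sum>i\<le>k. (-1) ^ i * (D (vs ! i) * \<beta> x (remove_nth i vs)))"
proof -
  let ?d = "chart_at A x"
  let ?D = "\<lambda>\<omega> i. fderiv (\<lambda>z. in_chart A ?d \<omega> z (remove_nth i vs)) (cmap ?d x)"
  have ax: "a (cinv ?d (cmap ?d x)) = a x" by (simp add: cinv_cmap[OF chart_at(1) chart_at(2)])
  have "?D (\<lambda>x vs. a x * \<beta> x vs) i v = a x * ?D \<beta> i v + D v * \<beta> x (remove_nth i vs)"
    if i: "i \<le> k" for i v
  proof (rule frechet_derivative_eqI)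
    have "((\<lambda>z. (a \<circ> cinv ?d) z * in_chart A ?d \<beta> z (remove_nth i vs)) has_derivative
      (\<lambda>v. (a \<circ> cinv ?d) (cmap ?d x) * ?D \<beta> i v
      + D v * in_chart A ?d \<beta> (cmap ?d x) (remove_nth i vs))) (at (cmap ?d x))"
      by (intro has_derivative_mult D in_chart_at_has_derivative[OF \<beta> length_remove_nth[OF l i]])
    then show "((\<lambda>z. in_chart A ?d (\<lambda>x vs. a x * \<beta> x vs) z (remove_nth i vs)) has_derivative
      (\<lambda>v. a x * ?D \<beta> i v
      + D v * \<beta> x (remove_nth i vs))) (at (cmap ?d x))"
      unfolding in_chart_at o_def ax by (simp add: in_chart_def)
  qed
  then have "ext_deriv A k (\<lambda>x vs. a x * \<beta> x vs) x vs = (\<Sum>i\<le>k.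
      a x * ((-1) ^ i * ?D \<beta> i (vs ! i))
      + (-1) ^ i * (D (vs ! i) * \<beta> x (remove_nth i vs)))"
    unfolding ext_deriv_def using l by (auto intro!: sum.cong simp: distrib_left)
  then show ?thesis using l by (simp add: ext_deriv_def sum.distrib sum_distrib_left)
qed

lemma ext_deriv_local:
  assumes U: "open U" "x \<in> U" and eq: "\<And>z. z \<in> U \<Longrightarrow> \<alpha> z = \<beta> z"
  shows "ext_deriv A k \<alpha> x = ext_deriv A k \<beta> x"
proof -
  let ?d = "chart_at A x"
  let ?W = "cmap ?d ` (cdom ?d \<inter> U)"
  have W: "open ?W" "cmap ?d x \<in> ?W" using open_cmap_image[OF chart_at(1) U(1)] chart_at(2) U(2) by auto
  have "fderiv (\<lambda>z. in_chart A ?d \<alpha> z L) (cmap ?d x) = fderiv (\<lambda>z. in_chart A ?d \<beta> z L) (cmap ?d x)" for L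
  proof (rule frechet_derivative_cong_open[OF W])
    fix z assume "z \<in> ?W"
    then have "cinv ?d z \<in> U" using cmap_image_iff[OF chart_at(1)] by blast
    then show "in_chart A ?d \<alpha> z L = in_chart A ?d \<beta> z L" by (simp add: in_chart_def eq)
  qed
  then show ?thesis by (simp add: ext_deriv_def fun_eq_iff)
qed

lemma differential_has_derivative:
  assumes "smooth_fun A f"
  shows "((f \<circ> cinv (chart_at A x)) has_derivative differential A f x) (at (cmap (chart_at A x) x))"
  unfolding differential_def
  by (rule smooth_on_has_derivative[OF smooth_funD[OF assms chart_at(1)] cmap_in[OF chart_at(2)]])

lemma differential_local:
  assumes U: "open U" "x \<in> U" and eq: "\<And>z. z \<in> U \<Longrightarrow> f z = h z"
  shows "differential A f x = differential A h x"
proof -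
  let ?d = "chart_at A x"
  let ?W = "cmap ?d ` (cdom ?d \<inter> U)"
  have W: "open ?W" "cmap ?d x \<in> ?W" using open_cmap_image[OF chart_at(1) U(1)] chart_at(2) U(2) by auto
  show ?thesis unfolding differential_def
  proof (rule frechet_derivative_cong_open[OF W])
    fix z assume "z \<in> ?W"
    then have "cinv ?d z \<in> U" using cmap_image_iff[OF chart_at(1)] by blast
    then show "(f \<circ> cinv ?d) z = (h \<circ> cinv ?d) z" by (simp add: eq)
  qed
qed

lemma differential_from_chart:
  assumes f: "smooth_fun A f" and c: "c \<in> A" and x: "x \<in> cdom c"
  shows "differential A f x (from_chart A c x w) = fderiv (f \<circ> cinv c) (cmap c x) w"
proof -
  let ?d = "chart_at A x" and ?y = "cmap c x"
  have y: "?y \<in> overlap c ?d" using x chart_at(2) by blast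
  have t: "transition c ?d ?y = cmap ?d x" using c x by (simp add: transition_def cinv_cmap)
  have "(((f \<circ> cinv ?d) \<circ> transition c ?d) has_derivative (differential A f x \<circ> from_chart A c x)) (at ?y)"
    using diff_chain_at[OF transition_has_derivative[OF c chart_at(1) y]] differential_has_derivative[OF f, of x] t
    by (simp add: from_chart_def)
  then have "((f \<circ> cinv c) has_derivative (differential A f x \<circ> from_chart A c x)) (at ?y)"
    by (rule has_derivative_transform_within_open[OF _ open_overlap[OF c chart_at(1)] y])
      (use cinv_transition[OF c chart_at(1)] in auto)
  from frechet_derivative_eqI[OF this, of w] show ?thesis by simp
qed

end

section \<open>The gradient and the operator \<open>dd\<^sup>\<phi>\<close>\<close>

locale calibrated_geometry = oriented_manifold A
  for A :: "('a::{t2_space,second_countable_topology}, 'n::finite) chart set" +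
  fixes g :: "('a, 'n) metric" and p :: nat and \<phi> :: "('a, 'n) form"
  assumes calibrated: "calibrated_manifold A g p \<phi>"
begin

lemma metric_inner_product: "is_inner_product (g x)"
  using calibrated by (auto simp: calibrated_manifold_def riemannian_metric_def is_inner_product_def)

lemma metric_bilinear: "bilinear (g x)"
  using metric_inner_product by (simp add: is_inner_product_def)

lemma metric_linear_left: "linear (\<lambda>v. g x v w)"
  using metric_bilinear by (simp add: bilinear_def)

lemma phi_smooth: "\<phi> \<in> smooth_forms A p"
  using calibrated by (simp add: calibrated_manifold_def)

lemma phi_alt: "\<phi> x \<in> alt_forms p"
  by (rule smooth_forms_alt[OF phi_smooth])

lemma comass: "length es = p \<Longrightarrow> orthonormal (g x) es \<Longrightarrow> \<phi> x es \<le> 1"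
  using calibrated orthonormal_wedge_unit_simple[of "g x" es] phi_alt[of x]
  by (auto simp: calibrated_manifold_def wedge_def dest!: spec[of _ x])

lemma metric_in_chart_inner_product:
  assumes c: "c \<in> A" and y: "y \<in> cimg c"
  shows "is_inner_product (metric_in_chart A c g y)"
proof -
  let ?x = "cinv c y"
  note x = cinv_in[OF y]
  note lin = from_chart_linear[OF c x]
  have "from_chart A c ?x v = 0 \<Longrightarrow> v = 0" for v
    using to_from_chart[OF c x, of v] to_from_chart[OF c x, of 0] linear_0[OF lin] by metis
  moreover have "bilinear (\<lambda>v w. g ?x (from_chart A c ?x v) (from_chart A c ?x w))"
    using metric_bilinear[of ?x] lin unfolding bilinear_def
    by (auto intro: linear_compose[unfolded o_def])
  ultimately show ?thesis
    using metric_inner_product[of ?x]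
    unfolding is_inner_product_def metric_in_chart_def[abs_def] by blast
qed

lemma metric_matrix_smooth:
  "c \<in> A \<Longrightarrow> smooth_on (cimg c) (\<lambda>y. metric_matrix A c g y $ i $ j)"
  using calibrated by (simp add: calibrated_manifold_def riemannian_metric_def metric_matrix_def)

lemma metric_in_chart_expansion:
  assumes c: "c \<in> A" and y: "y \<in> cimg c"
  shows "metric_in_chart A c g y v w = (\<Sum>i\<in>UNIV. v $ i * (\<Sum>j\<in>UNIV. w $ j * metric_matrix A c g y $ i $ j))"
proof -
  have "bilinear (metric_in_chart A c g y)"
    using metric_in_chart_inner_product[OF assms] by (simp add: is_inner_product_def)
  then have l: "linear (\<lambda>v. metric_in_chart A c g y v w)" and r: "linear (metric_in_chart A c g y v)" for v w
    by (auto simp: bilinear_def)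
  have 1: "metric_in_chart A c g y v w = (\<Sum>i\<in>UNIV. v $ i * metric_in_chart A c g y (axis i 1) w)"
    using linear_axis_expansion[OF l, of v w] by simp
  have 2: "metric_in_chart A c g y (axis i 1) w = (\<Sum>j\<in>UNIV. w $ j * metric_in_chart A c g y (axis i 1) (axis j 1))" for i
    using linear_axis_expansion[OF r, of "axis i 1" w] by simp
  show ?thesis unfolding 1 2 by (simp add: metric_matrix_def)
qed

lemma det_metric_matrix:
  assumes c: "c \<in> A" and y: "y \<in> cimg c"
  shows "det (metric_matrix A c g y) \<noteq> 0"
proof -
  have "v = 0" if "metric_matrix A c g y *v v = 0" for v
  proof (rule ccontr)
    assume "v \<noteq> 0"
    then have "metric_in_chart A c g y v v > 0"
      using metric_in_chart_inner_product[OF assms] by (simp add: is_inner_product_def)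
    moreover have "metric_in_chart A c g y v v = (\<Sum>i\<in>UNIV. v $ i * (metric_matrix A c g y *v v) $ i)"
      unfolding metric_in_chart_expansion[OF assms] by (simp add: matrix_vector_mult_def mult.commute)
    ultimately show False using that by simp
  qed
  then have "\<exists>B. B ** metric_matrix A c g y = mat 1"
    using matrix_left_invertible_ker[of "metric_matrix A c g y"] by simp
  then show ?thesis using invertible_left_inverse invertible_det_nz by blast
qed

text \<open>The components of the gradient in a chart, given by Cramer's rule; this form shows that
  they are smooth.\<close>

definition chart_grad :: "('a, 'n) chart \<Rightarrow> ('a \<Rightarrow> real) \<Rightarrow> real^'n \<Rightarrow> real^'n" where
  "chart_grad c f y = vec_lambda (\<lambda>k.
     det (vec_lambda (\<lambda>i. vec_lambda (\<lambda>j. if j = k then pd i (f \<circ> cinv c) y else metric_matrix A c g y $ i $ j)) :: real^'n^'n)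
       / det (metric_matrix A c g y))"

lemma chart_grad_smooth:
  assumes "smooth_fun A f" "c \<in> A"
  shows "smooth_on (cimg c) (\<lambda>y. chart_grad c f y $ k)"
proof -
  have "smooth_on (cimg c) (\<lambda>y. if j = k then pd i (f \<circ> cinv c) y else metric_matrix A c g y $ i $ j)" for i j
    using smooth_on_pd[OF smooth_funD[OF assms]] metric_matrix_smooth[OF assms(2)] by (cases "j = k") simp_all
  then show ?thesis
    unfolding chart_grad_def vec_lambda_beta
    by (intro smooth_on_divide smooth_on_det open_cimg[OF assms(2)] metric_matrix_smooth[OF assms(2)] det_metric_matrix[OF assms(2)])
      simp_all
qed

lemma grad_eqI:
  assumes "\<And>w. g x v w = differential A f x w"
  shows "grad A g f x = v"
  unfolding grad_def
proof (rule the_equality)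
  show "\<forall>w. g x v w = differential A f x w" using assms by simp
  fix u assume "\<forall>w. g x u w = differential A f x w"
  then have "g x (u - v) (u - v) = 0" using assms linear_diff[OF metric_linear_left[of x]] by simp
  then show "u = v" using metric_inner_product[of x] unfolding is_inner_product_def
    by (metis less_irrefl right_minus_eq)
qed

lemma grad_in_chart:
  assumes f: "smooth_fun A f" and c: "c \<in> A" and x: "x \<in> cdom c"
  shows "grad A g f x = from_chart A c x (chart_grad c f (cmap c x))"
    and "g x (grad A g f x) w = differential A f x w"
proof -
  let ?y = "cmap c x" and ?M = "metric_matrix A c g (cmap c x)"
  let ?u = "chart_grad c f ?y"
  have y: "?y \<in> cimg c" and cx: "cinv c ?y = x" using cmap_in[OF x] cinv_cmap[OF c x] by auto
  have "?M *v ?u = vec_lambda (\<lambda>i. pd i (f \<circ> cinv c) ?y)"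
    unfolding cramer[OF det_metric_matrix[OF c y]] by (simp add: chart_grad_def cong: if_cong)
  then have Mu: "(\<Sum>j\<in>UNIV. ?u $ j * ?M $ i $ j) = pd i (f \<circ> cinv c) ?y" for i
    by (simp add: vec_eq_iff matrix_vector_mult_def mult.commute)
  have *: "g x (from_chart A c x ?u) w = differential A f x w" for w
  proof -
    define v where "v = to_chart c x w"
    have w: "w = from_chart A c x v" using from_to_chart[OF c x] by (simp add: v_def)
    have "g x (from_chart A c x ?u) w = metric_in_chart A c g ?y ?u v"
      by (simp add: metric_in_chart_def cx w)
    also have "\<dots> = metric_in_chart A c g ?y v ?u"
      using metric_in_chart_inner_product[OF c y] by (simp add: is_inner_product_def)
    also have "\<dots> = (\<Sum>i\<in>UNIV. v $ i * pd i (f \<circ> cinv c) ?y)"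
      unfolding metric_in_chart_expansion[OF c y] Mu ..
    also have "\<dots> = fderiv (f \<circ> cinv c) ?y v"
      using frechet_derivative_axis_expansion[OF smooth_on_differentiable[OF smooth_funD[OF f c] y], of v] by simp
    also have "\<dots> = differential A f x w"
      unfolding w by (rule differential_from_chart[OF f c x, symmetric])
    finally show ?thesis .
  qed
  then show "grad A g f x = from_chart A c x ?u" by (rule grad_eqI)
  then show "g x (grad A g f x) w = differential A f x w" using * by simp
qed

lemmas metric_grad = grad_in_chart(2)[OF _ chart_at]

lemma d_phi_smooth_forms:
  assumes f: "smooth_fun A f" and p: "p = Suc k"
  shows "d_phi A g \<phi> f \<in> smooth_forms A k"
proof -
  have "d_phi A g \<phi> f x \<in> alt_forms k" for x
    using alt_forms_contract[of "\<phi> x" k] phi_alt[of x] p by (simp add: d_phi_def[abs_def])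
  moreover have "smooth_on (cimg c) (\<lambda>y. in_chart A c (d_phi A g \<phi> f) y ws)"
    if c: "c \<in> A" and l: "length ws = k" for c ws
  proof -
    have sm: "smooth_on (cimg c) (\<lambda>y. \<Sum>i\<in>UNIV. chart_grad c f y $ i * in_chart A c \<phi> y (axis i 1 # ws))"
      by (intro smooth_on_sum smooth_on_mult open_cimg[OF c] chart_grad_smooth[OF f c] in_chart_smooth[OF phi_smooth c])
        (simp add: l p)
    have eq: "(\<Sum>i\<in>UNIV. chart_grad c f y $ i * in_chart A c \<phi> y (axis i 1 # ws)) = in_chart A c (d_phi A g \<phi> f) y ws"
      if y: "y \<in> cimg c" for y
    proof -
      have "(\<Sum>i\<in>UNIV. chart_grad c f y $ i * in_chart A c \<phi> y ([] @ axis i 1 # ws)) = in_chart A c \<phi> y ([] @ chart_grad c f y # ws)"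
        by (rule alt_forms_axis_expansion[OF in_chart_alt_forms[OF c y phi_alt]]) (simp add: l p)
      then show ?thesis
        using grad_in_chart(1)[OF f c cinv_in[OF y]] cmap_cinv[OF y] by (simp add: in_chart_def d_phi_def)
    qed
    show ?thesis by (rule smooth_on_cong[OF open_cimg[OF c] eq, THEN iffD1, OF _ sm])
  qed
  ultimately show ?thesis by (simp add: smooth_forms_def)
qed

text \<open>Forms vanish on lists of the wrong length; hence the contraction of a \<open>0\<close>-form with a vector is
  zero.\<close>

lemma dd_phi_degenerate: "p = 0 \<Longrightarrow> dd_phi A g p \<phi> f = (\<lambda>x vs. 0)"
proof -
  assume p: "p = 0"
  have "d_phi A g \<phi> f = (\<lambda>x vs. 0)"
    using alt_forms_length[OF phi_alt] p by (simp add: d_phi_def fun_eq_iff)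
  then show ?thesis by (simp add: dd_phi_def ext_deriv_def in_chart_def fun_eq_iff)
qed

lemma dd_phi_smooth_forms:
  assumes "smooth_fun A f"
  shows "dd_phi A g p \<phi> f \<in> smooth_forms A p"
proof (cases p)
  case 0
  then show ?thesis using dd_phi_degenerate[of f] smooth_forms_zero by simp
next
  case (Suc k)
  then show ?thesis using ext_deriv_smooth_forms[OF d_phi_smooth_forms[OF assms Suc]] by (simp add: dd_phi_def)
qed

lemma dd_phi_local:
  assumes U: "open U" "x \<in> U" and eq: "\<And>z. z \<in> U \<Longrightarrow> f z = h z"
  shows "dd_phi A g p \<phi> f x = dd_phi A g p \<phi> h x"
  unfolding dd_phi_def
proof (rule ext_deriv_local[OF U])
  fix z assume "z \<in> U"
  then have "differential A f z = differential A h z" by (rule differential_local[OF U(1) _ eq])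
  then show "d_phi A g \<phi> f z = d_phi A g \<phi> h z" by (simp add: d_phi_def grad_def fun_eq_iff)
qed

lemma differential_linear:
  assumes "smooth_fun A f" "smooth_fun A h"
  shows "differential A (\<lambda>x. f x + r * h x) x w = differential A f x w + r * differential A h x w"
proof -
  have "((\<lambda>z. (f \<circ> cinv (chart_at A x)) z + r * (h \<circ> cinv (chart_at A x)) z) has_derivative
      (\<lambda>w. differential A f x w + r * differential A h x w)) (at (cmap (chart_at A x) x))"
    by (intro has_derivative_add has_derivative_mult_right differential_has_derivative assms)
  from frechet_derivative_eqI[OF this, of w] show ?thesis by (simp add: differential_def o_def)
qed

lemma phi_linear_head:
  assumes "p = Suc k"
  shows "\<phi> x ((u + r *\<^sub>R v) # vs) = \<phi> x (u # vs) + r * \<phi> x (v # vs)"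
proof (cases "length vs = k")
  case True
  then have lin: "linear (\<lambda>v. \<phi> x ([] @ v # vs))"
    by (intro alt_forms_linear_append[OF phi_alt]) (simp add: assms)
  show ?thesis using linear_add[OF lin, of u "r *\<^sub>R v"] linear_scale[OF lin, of r v] by simp
qed (use alt_forms_length[OF phi_alt] assms in simp)

lemma phi_scale_head: "p = Suc k \<Longrightarrow> \<phi> x ((r *\<^sub>R v) # vs) = r * \<phi> x (v # vs)"
  using phi_linear_head[of k x 0 r v vs] phi_linear_head[of k x 0 "-1" 0 vs] by simp

lemma dd_phi_linear:
  assumes f: "smooth_fun A f" and h: "smooth_fun A h"
  shows "dd_phi A g p \<phi> (\<lambda>x. f x + r * h x) x vs = dd_phi A g p \<phi> f x vs + r * dd_phi A g p \<phi> h x vs"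
proof (cases p)
  case 0
  then show ?thesis using dd_phi_degenerate by simp
next
  case (Suc k)
  have "grad A g (\<lambda>x. f x + r * h x) z = grad A g f z + r *\<^sub>R grad A g h z" for z
    by (rule grad_eqI) (simp add: linear_add[OF metric_linear_left] linear_scale[OF metric_linear_left]
        metric_grad[OF f] metric_grad[OF h] differential_linear[OF f h])
  then have "d_phi A g \<phi> (\<lambda>x. f x + r * h x) = (\<lambda>z vs. d_phi A g \<phi> f z vs + r * d_phi A g \<phi> h z vs)"
    by (simp add: d_phi_def fun_eq_iff phi_linear_head[OF Suc])
  then show ?thesis
    using ext_deriv_add_cmult[OF d_phi_smooth_forms[OF f Suc] d_phi_smooth_forms[OF h Suc]] Suc
    by (simp add: dd_phi_def)
qed

text \<open>Every \<open>\<phi>\<close>-plane is the wedge product of an orthonormal frame, so positivity can be tested on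
  frames. Unlike the lists of Gram determinant one, the orthonormal frames at a point form a
  bounded set.\<close>

definition phi_frame :: "'a \<Rightarrow> (real^'n) list \<Rightarrow> bool" where
  "phi_frame x es \<longleftrightarrow> length es = p \<and> orthonormal (g x) es \<and> \<phi> x es = 1"

lemma phi_planes_ball_iff:
  assumes "\<omega> \<in> alt_forms p"
  shows "(\<forall>\<xi>\<in>phi_planes g p \<phi> x. P (\<xi> \<omega>)) \<longleftrightarrow> (\<forall>es. phi_frame x es \<longrightarrow> P (\<omega> es))"
proof
  assume L: "\<forall>\<xi>\<in>phi_planes g p \<phi> x. P (\<xi> \<omega>)"
  show "\<forall>es. phi_frame x es \<longrightarrow> P (\<omega> es)"
  proof (intro allI impI)
    fix es assume es: "phi_frame x es"
    then have "wedge es \<in> phi_planes g p \<phi> x"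
      using orthonormal_wedge_unit_simple[of "g x" es] phi_alt[of x]
      by (auto simp: phi_frame_def phi_planes_def wedge_def)
    then have "P (wedge es \<omega>)" using L by blast
    then show "P (\<omega> es)" using assms es by (simp add: wedge_def phi_frame_def)
  qed
next
  assume R: "\<forall>es. phi_frame x es \<longrightarrow> P (\<omega> es)"
  show "\<forall>\<xi>\<in>phi_planes g p \<phi> x. P (\<xi> \<omega>)"
  proof
    fix \<xi> assume "\<xi> \<in> phi_planes g p \<phi> x"
    then have \<xi>: "\<xi> \<in> unit_simple (g x) p" "\<xi> (\<phi> x) = 1" by (auto simp: phi_planes_def)
    obtain es where es: "length es = p" "orthonormal (g x) es" "\<xi> = wedge es"
      by (rule unit_simple_orthonormal[OF metric_inner_product \<xi>(1)])
    then have "phi_frame x es" using \<xi>(2) phi_alt[of x] by (simp add: phi_frame_def wedge_def)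
    then show "P (\<xi> \<omega>)" using R es assms by (simp add: wedge_def)
  qed
qed

lemma dd_phi_alt: "smooth_fun A f \<Longrightarrow> dd_phi A g p \<phi> f x \<in> alt_forms p"
  by (rule smooth_forms_alt[OF dd_phi_smooth_forms])

lemma PSH_iff:
  "f \<in> PSH A g p \<phi> \<longleftrightarrow> smooth_fun A f \<and> (\<forall>x es. phi_frame x es \<longrightarrow> dd_phi A g p \<phi> f x es \<ge> 0)"
  by (cases "smooth_fun A f")
    (simp_all add: PSH_def phi_planes_ball_iff[OF dd_phi_alt, where P = "\<lambda>r. r \<ge> 0"])

lemma strictly_psh_at_iff:
  "smooth_fun A f \<Longrightarrow> strictly_psh_at A g p \<phi> f x \<longleftrightarrow> (\<forall>es. phi_frame x es \<longrightarrow> dd_phi A g p \<phi> f x es > 0)"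
  using phi_planes_ball_iff[OF dd_phi_alt, where P = "\<lambda>r. r > 0"] by (simp add: strictly_psh_at_def)

lemma positive_form_iff:
  "\<alpha> \<in> smooth_forms A p \<Longrightarrow> positive_form g p \<phi> \<alpha> \<longleftrightarrow> (\<forall>x es. phi_frame x es \<longrightarrow> \<alpha> x es \<ge> 0)"
  using phi_planes_ball_iff[OF smooth_forms_alt, where P = "\<lambda>r. r \<ge> 0"] by (simp add: positive_form_def)

text \<open>\<open>dd\<^sup>\<phi> (\<psi> \<circ> f) = \<psi>' dd\<^sup>\<phi> f + \<psi>'' df \<and> d\<^sup>\<phi> f\<close>, and the last form is
  nonnegative on \<open>\<phi>\<close>-planes.\<close>

lemma dd_phi_compose:
  assumes f: "smooth_fun A f" and F: "smooth_fun A (\<lambda>x. \<psi> (f x))"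
    and d1: "\<And>t. (\<psi> has_real_derivative \<psi>1 t) (at t)" and d2: "\<And>t. (\<psi>1 has_real_derivative \<psi>2 t) (at t)"
    and es: "phi_frame x es"
  shows "\<exists>Q\<ge>0. dd_phi A g p \<phi> (\<lambda>x. \<psi> (f x)) x es = \<psi>1 (f x) * dd_phi A g p \<phi> f x es + \<psi>2 (f x) * Q"
proof (cases p)
  case 0
  then show ?thesis using dd_phi_degenerate by (intro exI[of _ 0]) simp
next
  case (Suc k)
  let ?G = "grad A g f x"
  have len: "length es = p" using es by (simp add: phi_frame_def)
  have len': "length es = Suc k" using len Suc by (rule trans)
  have chain: "(((\<lambda>x. \<theta> (f x)) \<circ> cinv (chart_at A z)) has_derivative (\<lambda>w. \<theta>' (f z) * differential A f z w)) (at (cmap (chart_at A z) z))"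
    if "\<And>t. (\<theta> has_real_derivative \<theta>' t) (at t)" for \<theta> \<theta>' z
  proof -
    have "(f \<circ> cinv (chart_at A z)) (cmap (chart_at A z) z) = f z"
      by (simp add: cinv_cmap[OF chart_at(1) chart_at(2)])
    moreover have "(\<theta> has_derivative (\<lambda>s. \<theta>' (f z) * s)) (at (f z))"
      using that[of "f z"] by (simp add: has_field_derivative_def mult_commute_abs)
    ultimately show ?thesis
      using diff_chain_at[OF differential_has_derivative[OF f, of z], of \<theta> "\<lambda>s. \<theta>' (f z) * s"] by (simp add: o_def)
  qed
  have "differential A (\<lambda>x. \<psi> (f x)) z w = \<psi>1 (f z) * differential A f z w" for z w
    unfolding differential_def by (rule frechet_derivative_eqI[OF chain[OF d1, unfolded differential_def]])
  then have "grad A g (\<lambda>x. \<psi> (f x)) z = \<psi>1 (f z) *\<^sub>R grad A g f z" for z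
    by (intro grad_eqI) (simp add: linear_scale[OF metric_linear_left] metric_grad[OF f])
  then have "d_phi A g \<phi> (\<lambda>x. \<psi> (f x)) = (\<lambda>z vs. \<psi>1 (f z) * d_phi A g \<phi> f z vs)"
    using phi_scale_head[OF Suc] by (simp add: d_phi_def fun_eq_iff)
  then have "dd_phi A g p \<phi> (\<lambda>x. \<psi> (f x)) x es = \<psi>1 (f x) * dd_phi A g p \<phi> f x es +
      (\<Sum>i\<le>k. (-1) ^ i * (\<psi>2 (f x) * differential A f x (es ! i) * d_phi A g \<phi> f x (remove_nth i es)))"
    using ext_deriv_mult[OF d_phi_smooth_forms[OF f Suc] len' chain[OF d2], of x] Suc
    by (simp add: dd_phi_def)
  also have "(\<Sum>i\<le>k. (-1) ^ i * (\<psi>2 (f x) * differential A f x (es ! i) * d_phi A g \<phi> f x (remove_nth i es)))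
      = \<psi>2 (f x) * (\<Sum>i<p. g x ?G (es ! i) * \<phi> x (es[i := ?G]))"
    unfolding sum_distrib_left Suc lessThan_Suc_atMost
  proof (rule sum.cong[OF refl])
    fix i assume "i \<in> {..k}"
    then have i: "i < length es" using len' by simp
    have "\<phi> x ([] @ take i es @ ?G # drop (Suc i) es) = (-1) ^ length (take i es) * \<phi> x ([] @ ?G # take i es @ drop (Suc i) es)"
      by (rule alt_forms_move[OF phi_alt]) (use i len in simp)
    then have "\<phi> x (es[i := ?G]) = (-1) ^ i * d_phi A g \<phi> f x (remove_nth i es)"
      using i by (simp add: upd_conv_take_nth_drop d_phi_def)
    then show "(-1) ^ i * (\<psi>2 (f x) * differential A f x (es ! i) * d_phi A g \<phi> f x (remove_nth i es))
        = \<psi>2 (f x) * (g x ?G (es ! i) * \<phi> x (es[i := ?G]))"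
      using metric_grad[OF f] by simp
  qed
  finally have "dd_phi A g p \<phi> (\<lambda>x. \<psi> (f x)) x es = \<psi>1 (f x) * dd_phi A g p \<phi> f x es +
      \<psi>2 (f x) * (\<Sum>i<p. g x ?G (es ! i) * \<phi> x (es[i := ?G]))" .
  moreover have "0 \<le> (\<Sum>i<p. g x ?G (es ! i) * \<phi> x (es[i := ?G]))"
    by (rule contraction_plane_nonneg[OF metric_inner_product phi_alt comass])
      (use es in \<open>auto simp: phi_frame_def\<close>)
  ultimately show ?thesis by (intro exI conjI)
qed

lemma PSH_compose:
  assumes f: "f \<in> PSH A g p \<phi>" and F: "smooth_fun A (\<lambda>x. \<psi> (f x))"
    and d1: "\<And>t. (\<psi> has_real_derivative \<psi>1 t) (at t)" and d2: "\<And>t. (\<psi>1 has_real_derivative \<psi>2 t) (at t)"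
    and pos: "\<And>t. \<psi>1 t \<ge> 0" "\<And>t. \<psi>2 t \<ge> 0"
  shows "(\<lambda>x. \<psi> (f x)) \<in> PSH A g p \<phi>"
    and "strictly_psh_at A g p \<phi> f x \<Longrightarrow> \<psi>1 (f x) > 0 \<Longrightarrow> strictly_psh_at A g p \<phi> (\<lambda>x. \<psi> (f x)) x"
proof -
  have fs: "smooth_fun A f" using f by (simp add: PSH_def)
  have ge: "dd_phi A g p \<phi> (\<lambda>x. \<psi> (f x)) x es \<ge> \<psi>1 (f x) * dd_phi A g p \<phi> f x es" if "phi_frame x es" for x es
    using dd_phi_compose[OF fs F d1 d2 that] pos(2)[of "f x"] by auto
  show "(\<lambda>x. \<psi> (f x)) \<in> PSH A g p \<phi>"
    unfolding PSH_iff
  proof (intro conjI F allI impI)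
    fix x es assume e: "phi_frame x es"
    then have "0 \<le> dd_phi A g p \<phi> f x es" using f by (simp add: PSH_iff)
    then have "0 \<le> \<psi>1 (f x) * dd_phi A g p \<phi> f x es" using pos(1) by simp
    then show "0 \<le> dd_phi A g p \<phi> (\<lambda>x. \<psi> (f x)) x es" using ge[OF e] by linarith
  qed
  assume s: "strictly_psh_at A g p \<phi> f x" and "\<psi>1 (f x) > 0"
  show "strictly_psh_at A g p \<phi> (\<lambda>x. \<psi> (f x)) x"
    unfolding strictly_psh_at_iff[OF F]
  proof (intro allI impI)
    fix es assume e: "phi_frame x es"
    then have "0 < dd_phi A g p \<phi> f x es" using s by (simp add: strictly_psh_at_iff[OF fs])
    then have "0 < \<psi>1 (f x) * dd_phi A g p \<phi> f x es" using \<open>\<psi>1 (f x) > 0\<close> by simp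
    then show "0 < dd_phi A g p \<phi> (\<lambda>x. \<psi> (f x)) x es" using ge[OF e] by linarith
  qed
qed

end

section \<open>Currents and their supports\<close>

context oriented_manifold
begin

lemma test_formsD: "\<alpha> \<in> test_forms A k \<Longrightarrow> \<alpha> \<in> smooth_forms A k"
  by (simp add: test_forms_def)

lemma test_formsI:
  assumes "\<alpha> \<in> smooth_forms A k" "compact C" "closed C" "{x. \<exists>vs. \<alpha> x vs \<noteq> 0} \<subseteq> C"
  shows "\<alpha> \<in> test_forms A k"
proof -
  have s: "form_supp \<alpha> \<subseteq> C" unfolding form_supp_def using assms(3,4) by (rule closure_minimal[rotated])
  then show ?thesis
    using compact_closed_subset[OF assms(2) _ s] assms(1) by (simp add: test_forms_def form_supp_def)
qed

lemma form_supp_subset: "{x. \<exists>vs. \<alpha> x vs \<noteq> 0} \<subseteq> form_supp \<alpha>"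
  unfolding form_supp_def by (rule closure_subset)

lemma closed_form_supp: "closed (form_supp \<alpha>)"
  by (simp add: form_supp_def)

lemma test_forms_mult:
  assumes a: "smooth_fun A a" and \<alpha>: "\<alpha> \<in> test_forms A k"
  shows "(\<lambda>x vs. a x * \<alpha> x vs) \<in> test_forms A k"
proof (rule test_formsI[OF smooth_forms_mult[OF a test_formsD[OF \<alpha>]]])
  show "compact (form_supp \<alpha>)" using \<alpha> by (simp add: test_forms_def)
  show "closed (form_supp \<alpha>)" by (rule closed_form_supp)
  show "{x. \<exists>vs. a x * \<alpha> x vs \<noteq> 0} \<subseteq> form_supp \<alpha>" using form_supp_subset[of \<alpha>] by auto
qed

lemma test_forms_cutoff:
  assumes a: "smooth_fun A a" "compact (closure {x. a x \<noteq> 0})" and \<alpha>: "\<alpha> \<in> smooth_forms A k"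
  shows "(\<lambda>x vs. a x * \<alpha> x vs) \<in> test_forms A k"
proof (rule test_formsI[OF smooth_forms_mult[OF a(1) \<alpha>] a(2) closed_closure])
  show "{x. \<exists>vs. a x * \<alpha> x vs \<noteq> 0} \<subseteq> closure {x. a x \<noteq> 0}" using closure_subset[of "{x. a x \<noteq> 0}"] by auto
qed

lemma test_forms_add:
  assumes "\<alpha> \<in> test_forms A k" "\<beta> \<in> test_forms A k"
  shows "(\<lambda>x vs. \<alpha> x vs + \<beta> x vs) \<in> test_forms A k"
proof (rule test_formsI[OF smooth_forms_add[OF assms[THEN test_formsD]]])
  show "compact (form_supp \<alpha> \<union> form_supp \<beta>)" using assms by (auto simp: test_forms_def)
  show "closed (form_supp \<alpha> \<union> form_supp \<beta>)" using closed_form_supp by blast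
  show "{x. \<exists>vs. \<alpha> x vs + \<beta> x vs \<noteq> 0} \<subseteq> form_supp \<alpha> \<union> form_supp \<beta>"
  proof
    fix x assume "x \<in> {x. \<exists>vs. \<alpha> x vs + \<beta> x vs \<noteq> 0}"
    then obtain vs where "\<alpha> x vs \<noteq> 0 \<or> \<beta> x vs \<noteq> 0" by fastforce
    then show "x \<in> form_supp \<alpha> \<union> form_supp \<beta>" using form_supp_subset[of \<alpha>] form_supp_subset[of \<beta>] by blast
  qed
qed

lemma test_forms_cmult: "\<alpha> \<in> test_forms A k \<Longrightarrow> (\<lambda>x vs. r * \<alpha> x vs) \<in> test_forms A k"
  by (rule test_forms_mult[OF smooth_fun_const])

context
  fixes T :: "('a, 'n) form \<Rightarrow> real" and k :: nat
  assumes T: "current A k T"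
begin

lemma current_add:
  "\<alpha> \<in> test_forms A k \<Longrightarrow> \<beta> \<in> test_forms A k \<Longrightarrow> T (\<lambda>x vs. \<alpha> x vs + \<beta> x vs) = T \<alpha> + T \<beta>"
  using T by (simp add: current_def)

lemma current_cmult: "\<alpha> \<in> test_forms A k \<Longrightarrow> T (\<lambda>x vs. r * \<alpha> x vs) = r * T \<alpha>"
  using T by (simp add: current_def)

text \<open>A form is split as \<open>b \<alpha> + (1 - b) \<alpha>\<close> for one function \<open>b\<close> after the other. Products
  \<open>\<Prod> (1 - b\<^sub>x)\<close> do the work of a partition of unity without any division.\<close>

lemma current_prod_complement:
  assumes "finite F" and b: "\<And>x. x \<in> F \<Longrightarrow> smooth_fun A (b x)"
    and z: "\<And>x \<alpha>. x \<in> F \<Longrightarrow> \<alpha> \<in> test_forms A k \<Longrightarrow> T (\<lambda>z vs. b x z * \<alpha> z vs) = 0"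
    and "\<alpha> \<in> test_forms A k"
  shows "T \<alpha> = T (\<lambda>z vs. (\<Prod>x\<in>F. 1 - b x z) * \<alpha> z vs)"
  using assms(1) b z \<open>\<alpha> \<in> test_forms A k\<close>
proof (induction F arbitrary: \<alpha>)
  case empty
  then show ?case by simp
next
  case (insert x F)
  let ?a = "\<lambda>z vs. b x z * \<alpha> z vs" and ?c = "\<lambda>z vs. (1 - b x z) * \<alpha> z vs"
  have bx: "smooth_fun A (b x)" by (rule insert.prems(1)) simp
  have a: "?a \<in> test_forms A k" by (rule test_forms_mult[OF bx insert.prems(3)])
  have c: "?c \<in> test_forms A k"
    by (rule test_forms_mult[OF smooth_fun_diff[OF smooth_fun_const bx] insert.prems(3)])
  have "\<alpha> = (\<lambda>z vs. ?a z vs + ?c z vs)" by (simp add: fun_eq_iff algebra_simps)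
  then have "T \<alpha> = T ?a + T ?c" using current_add[OF a c] by simp
  also have "T ?a = 0" by (rule insert.prems(2)) (simp_all add: insert.prems(3))
  also have "T ?c = T (\<lambda>z vs. (\<Prod>x\<in>F. 1 - b x z) * ?c z vs)"
  proof (rule insert.IH[OF _ _ c])
    show "smooth_fun A (b x)" if "x \<in> F" for x using insert.prems(1) that by simp
    show "T (\<lambda>z vs. b x z * \<alpha> z vs) = 0" if "x \<in> F" "\<alpha> \<in> test_forms A k" for x \<alpha>
      using insert.prems(2) that by simp
  qed
  finally show ?case using insert.hyps by (simp add: mult_ac)
qed

text \<open>The support is defined by open sets on which the current vanishes; a form with compact support
  is covered by finitely many of them and cut into pieces.\<close>

lemma current_zero_off_supp:
  assumes \<alpha>: "\<alpha> \<in> test_forms A k" and disj: "form_supp \<alpha> \<inter> current_supp A k T = {}"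
  shows "T \<alpha> = 0"
proof -
  have "\<exists>b V. smooth_fun A b \<and> (\<forall>\<beta>\<in>test_forms A k. T (\<lambda>z vs. b z * \<beta> z vs) = 0) \<and>
      open V \<and> x \<in> V \<and> (\<forall>z\<in>V. b z = 1)" if "x \<in> form_supp \<alpha>" for x
  proof -
    have "x \<in> \<Union>{U. open U \<and> (\<forall>\<alpha> \<in> test_forms A k. form_supp \<alpha> \<subseteq> U \<longrightarrow> T \<alpha> = 0)}"
      using disj that unfolding current_supp_def by blast
    then obtain U where U: "open U" "x \<in> U" "\<forall>\<alpha> \<in> test_forms A k. form_supp \<alpha> \<subseteq> U \<longrightarrow> T \<alpha> = 0" by blast
    obtain b V where b: "smooth_fun A b" "closure {z. b z \<noteq> 0} \<subseteq> U" "open V" "x \<in> V" "\<forall>z\<in>V. b z = 1"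
      using bump_exists[OF U(1,2)] by (elim exE conjE)
    have "T (\<lambda>z vs. b z * \<beta> z vs) = 0" if \<beta>: "\<beta> \<in> test_forms A k" for \<beta>
    proof -
      have "form_supp (\<lambda>z vs. b z * \<beta> z vs) \<subseteq> closure {z. b z \<noteq> 0}"
        unfolding form_supp_def by (rule closure_mono) auto
      then show ?thesis using U(3) test_forms_mult[OF b(1) \<beta>] b(2) by blast
    qed
    then show ?thesis using b by (intro exI[of _ b] exI[of _ V]) simp
  qed
  then have "\<forall>x\<in>form_supp \<alpha>. \<exists>q. smooth_fun A (fst q) \<and> (\<forall>\<beta>\<in>test_forms A k. T (\<lambda>z vs. fst q z * \<beta> z vs) = 0) \<and>
      open (snd q) \<and> x \<in> snd q \<and> (\<forall>z\<in>snd q. fst q z = 1)" by simp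
  from bchoice[OF this] obtain q where q: "\<forall>x\<in>form_supp \<alpha>. smooth_fun A (fst (q x)) \<and>
      (\<forall>\<beta>\<in>test_forms A k. T (\<lambda>z vs. fst (q x) z * \<beta> z vs) = 0) \<and>
      open (snd (q x)) \<and> x \<in> snd (q x) \<and> (\<forall>z\<in>snd (q x). fst (q x) z = 1)" by (rule exE)
  have comp: "compact (form_supp \<alpha>)" using \<alpha> by (simp add: test_forms_def)
  obtain F where F: "F \<subseteq> form_supp \<alpha>" "finite F" "form_supp \<alpha> \<subseteq> (\<Union>x\<in>F. snd (q x))"
    by (rule compactE_image[OF comp, of "form_supp \<alpha>" "\<lambda>x. snd (q x)"]) (use q in auto)
  have FS: "x \<in> form_supp \<alpha>" if "x \<in> F" for x using F(1) that by blast
  have "T \<alpha> = T (\<lambda>z vs. (\<Prod>x\<in>F. 1 - fst (q x) z) * \<alpha> z vs)"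
    by (rule current_prod_complement[OF F(2) _ _ \<alpha>]) (use q FS in simp_all)
  also have "(\<lambda>z vs. (\<Prod>x\<in>F. 1 - fst (q x) z) * \<alpha> z vs) = (\<lambda>z vs. 0 * \<alpha> z vs)"
  proof (intro ext)
    fix z vs
    show "(\<Prod>x\<in>F. 1 - fst (q x) z) * \<alpha> z vs = 0 * \<alpha> z vs"
    proof (cases "\<alpha> z vs = 0")
      case False
      then have "z \<in> form_supp \<alpha>" using form_supp_subset[of \<alpha>] by blast
      then obtain x where x: "x \<in> F" "z \<in> snd (q x)" using F(3) by blast
      then have "1 - fst (q x) z = 0" using q FS by simp
      then have "(\<Prod>x\<in>F. 1 - fst (q x) z) = 0" using F(2) x(1) by (intro prod_zero) auto
      then show ?thesis by simp
    qed simp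
  qed
  also have "T (\<lambda>z vs. 0 * \<alpha> z vs) = 0" using current_cmult[OF \<alpha>, of 0] by simp
  finally show ?thesis .
qed

lemma current_eq_near_supp:
  assumes \<alpha>: "\<alpha> \<in> test_forms A k" and \<beta>: "\<beta> \<in> test_forms A k"
    and U: "open U" "current_supp A k T \<subseteq> U" and eq: "\<And>z. z \<in> U \<Longrightarrow> \<alpha> z = \<beta> z"
  shows "T \<alpha> = T \<beta>"
proof -
  let ?d = "\<lambda>x vs. \<alpha> x vs + (-1) * \<beta> x vs"
  have m: "(\<lambda>x vs. (-1) * \<beta> x vs) \<in> test_forms A k" by (rule test_forms_cmult[OF \<beta>])
  have "form_supp ?d \<subseteq> - U"
    unfolding form_supp_def by (rule closure_minimal) (use eq U(1) in auto)
  then have "T ?d = 0" by (intro current_zero_off_supp test_forms_add[OF \<alpha> m]) (use U(2) in blast)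
  moreover have "T ?d = T \<alpha> + (-1) * T \<beta>" using current_add[OF \<alpha> m] current_cmult[OF \<beta>, of "-1"] by simp
  ultimately show ?thesis by simp
qed

end

end

section \<open>Compactness of the space of frames\<close>

text \<open>A \<open>p\<close>-tuple of vectors is coded as a sequence of which the first \<open>p\<close> terms count, since lists
  carry no topology; compactness is Tychonoff's theorem.\<close>

lemma compact_bounded_sequences: "compact {w :: nat \<Rightarrow> real^'n::finite. \<forall>i. norm (w i) \<le> R}"
proof -
  have "compactin (product_topology (\<lambda>i. euclidean) UNIV) (PiE UNIV (\<lambda>i::nat. cball (0 :: real^'n) R))"
    unfolding compactin_PiE by simp
  moreover have "PiE UNIV (\<lambda>i::nat. cball (0 :: real^'n) R) = {w. \<forall>i. norm (w i) \<le> R}"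
    by (auto simp: PiE_def Pi_def)
  ultimately show ?thesis by (simp add: euclidean_product_topology)
qed

lemma continuous_on_snd_nth: "continuous_on X (\<lambda>q. snd q i $ l)" for X :: "('x::topological_space \<times> (nat \<Rightarrow> real^'n::finite)) set"
proof -
  have "continuous_on X (\<lambda>q. snd q i)"
    by (rule continuous_on_compose2[OF continuous_on_product_coordinates[of i] continuous_on_snd[OF continuous_on_id]]) simp
  then show ?thesis by (rule continuous_on_component)
qed

text \<open>Joint continuity in the point and the vectors. As in the product rule, one more slot at a
  time is allowed to vary, by expanding it in the standard basis.\<close>

lemma continuous_on_alt_forms:
  fixes \<beta> :: "'x::topological_space \<Rightarrow> (real^'n::finite) list \<Rightarrow> real"
  assumes alt: "\<And>y. y \<in> Q \<Longrightarrow> \<beta> y \<in> alt_forms k"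
    and cont: "\<And>L. length L = k \<Longrightarrow> continuous_on Q (\<lambda>y. \<beta> y L)"
  shows "m \<le> k \<Longrightarrow> length L = k - m \<Longrightarrow>
    continuous_on (Q \<times> UNIV) (\<lambda>q. \<beta> (fst q) (map (snd q) [0..<m] @ L))"
proof (induction m arbitrary: L)
  case 0
  then have "continuous_on Q (\<lambda>y. \<beta> y L)" by (intro cont) simp
  then show ?case
    using continuous_on_compose2[of Q "\<lambda>y. \<beta> y L" "Q \<times> UNIV" fst] continuous_on_fst[OF continuous_on_id] by auto
next
  case (Suc m)
  have "continuous_on (Q \<times> UNIV) (\<lambda>q. \<Sum>l\<in>UNIV. snd q m $ l * \<beta> (fst q) (map (snd q) [0..<m] @ axis l 1 # L))"
    by (intro continuous_on_sum continuous_on_mult continuous_on_snd_nth Suc.IH) (use Suc.prems in auto)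
  then show ?case
  proof (rule continuous_on_cong[THEN iffD1, OF refl, rotated])
    fix q assume "q \<in> Q \<times> (UNIV :: (nat \<Rightarrow> real^'n) set)"
    then have "\<beta> (fst q) \<in> alt_forms k" using alt by auto
    from alt_forms_axis_expansion[OF this, of "map (snd q) [0..<m]" L "snd q m"]
    show "(\<Sum>l\<in>UNIV. snd q m $ l * \<beta> (fst q) (map (snd q) [0..<m] @ axis l 1 # L))
      = \<beta> (fst q) (map (snd q) [0..<Suc m] @ L)" using Suc.prems by simp
  qed
qed

context calibrated_geometry
begin

lemma continuous_on_metric_in_chart:
  assumes c: "c \<in> A" and Q: "Q \<subseteq> cimg c" and X: "fst ` X \<subseteq> Q"
    and u: "\<And>i. continuous_on X (\<lambda>q. u q $ i)" and v: "\<And>i. continuous_on X (\<lambda>q. v q $ i)"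
  shows "continuous_on X (\<lambda>q. metric_in_chart A c g (fst q) (u q) (v q))"
proof -
  have G: "continuous_on X (\<lambda>q. metric_matrix A c g (fst q) $ i $ j)" for i j
    by (rule continuous_on_compose2[OF continuous_on_subset[OF smooth_on_continuous_on[OF metric_matrix_smooth[OF c]] Q]
        continuous_on_fst[OF continuous_on_id] X])
  have "continuous_on X (\<lambda>q. \<Sum>i\<in>UNIV. u q $ i * (\<Sum>j\<in>UNIV. v q $ j * metric_matrix A c g (fst q) $ i $ j))"
    by (intro continuous_on_sum continuous_on_mult u v G)
  then show ?thesis
    by (rule continuous_on_cong[THEN iffD1, OF refl, rotated])
      (rule metric_in_chart_expansion[OF c, symmetric], use Q X in blast)
qed

text \<open>The metric has a positive minimum on the compact set of Euclidean unit vectors over \<open>Q\<close>, which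
  bounds the Euclidean length of its unit vectors.\<close>

lemma metric_in_chart_lower_bound:
  assumes c: "c \<in> A" and Q: "compact Q" "Q \<subseteq> cimg c"
  shows "\<exists>R\<ge>0. \<forall>y\<in>Q. \<forall>v. metric_in_chart A c g y v v = 1 \<longrightarrow> norm v \<le> R"
proof (cases "Q = {}")
  case False
  let ?S = "Q \<times> sphere (0 :: real^'n) 1"
  let ?q = "\<lambda>(y, v). metric_in_chart A c g y v v"
  have "continuous_on ?S (\<lambda>q. metric_in_chart A c g (fst q) (snd q) (snd q))"
    by (rule continuous_on_metric_in_chart[OF c Q(2)])
      (auto intro!: continuous_on_component continuous_on_snd continuous_on_id)
  then have "continuous_on ?S ?q" by (simp add: case_prod_unfold)
  moreover have "compact ?S" using Q(1) by (intro compact_Times compact_sphere)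
  moreover have "axis undefined 1 \<in> sphere (0 :: real^'n) 1" by simp
  then have "?S \<noteq> {}" using False by blast
  ultimately obtain q0 where q0: "q0 \<in> ?S" "\<And>q. q \<in> ?S \<Longrightarrow> ?q q0 \<le> ?q q"
    using continuous_attains_inf[of ?S ?q] by blast
  define m where "m = ?q q0"
  have m: "m > 0"
  proof -
    obtain y v where yv: "q0 = (y, v)" "y \<in> Q" "norm v = 1" using q0(1) by auto
    then have "v \<noteq> 0" "y \<in> cimg c" using Q(2) by auto
    then show ?thesis using metric_in_chart_inner_product[OF c] yv(1) by (simp add: m_def is_inner_product_def)
  qed
  have "norm v \<le> 1 / sqrt m" if y: "y \<in> Q" and v: "metric_in_chart A c g y v v = 1" for y v
  proof (cases "v = 0")
    case False
    have "bilinear (metric_in_chart A c g y)"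
      using metric_in_chart_inner_product[OF c, of y] y Q(2) by (auto simp: is_inner_product_def)
    then have "metric_in_chart A c g y ((1 / norm v) *\<^sub>R v) ((1 / norm v) *\<^sub>R v) = (1 / norm v) * ((1 / norm v) * 1)"
      using v by (simp only: bilinear_lmul bilinear_rmul real_scaleR_def)
    moreover have "m \<le> metric_in_chart A c g y ((1 / norm v) *\<^sub>R v) ((1 / norm v) *\<^sub>R v)"
      using q0(2)[of "(y, (1 / norm v) *\<^sub>R v)"] y False by (simp add: m_def)
    ultimately have "m \<le> 1 / (norm v)\<^sup>2" by (simp add: power2_eq_square)
    then have "m * (norm v)\<^sup>2 \<le> 1" using False by (simp add: field_simps)
    then have "(norm v)\<^sup>2 \<le> 1 / m" using m by (simp add: field_simps)
    then have "norm v \<le> sqrt (1 / m)" by (rule real_le_rsqrt)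
    then show ?thesis by (simp add: real_sqrt_divide)
  qed (use m in simp)
  then show ?thesis using m by (intro exI[of _ "1 / sqrt m"]) simp
qed auto

text \<open>The \<open>\<phi>\<close>-frames over a compact coordinate ball form a compact set. Strict positivity of \<open>\<delta>\<close>
  over \<open>x0\<close> therefore persists over a smaller ball, and the ratio \<open>|\<alpha>| / \<delta>\<close> is bounded there.
  The neighbourhood \<open>U\<close> does not depend on \<open>\<alpha>\<close>.\<close>

lemma strictly_positive_form_dominates:
  assumes \<delta>: "\<delta> \<in> smooth_forms A p" and pos: "\<And>es. phi_frame x0 es \<Longrightarrow> \<delta> x0 es > 0"
  shows "\<exists>U. open U \<and> x0 \<in> U \<and> (\<forall>\<alpha>\<in>smooth_forms A p. \<exists>C\<ge>0. \<forall>z\<in>U. \<forall>es. phi_frame z es \<longrightarrow>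
    0 \<le> \<delta> z es \<and> \<bar>\<alpha> z es\<bar> \<le> C * \<delta> z es)"
proof -
  define c where "c = chart_at A x0"
  define y0 where "y0 = cmap c x0"
  have c: "c \<in> A" "x0 \<in> cdom c" using chart_at by (auto simp: c_def)
  have y0: "y0 \<in> cimg c" "cinv c y0 = x0" using cmap_in[OF c(2)] cinv_cmap[OF c] by (auto simp: y0_def)
  obtain r where r: "r > 0" "cball y0 r \<subseteq> cimg c" using open_cimg[OF c(1)] y0(1) open_contains_cball by blast
  let ?v = "\<lambda>\<omega> q. in_chart A c \<omega> (fst q) (map (snd q) [0..<p])"
  let ?Q = "cball y0 r"
  obtain R where R: "\<And>y v. y \<in> ?Q \<Longrightarrow> metric_in_chart A c g y v v = 1 \<Longrightarrow> norm v \<le> R" "R \<ge> 0"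
    using metric_in_chart_lower_bound[OF c(1) compact_cball r(2)] by blast
  let ?X = "?Q \<times> {w :: nat \<Rightarrow> real^'n. \<forall>i. norm (w i) \<le> R}"
  have X: "compact ?X" by (intro compact_Times compact_cball compact_bounded_sequences)
  have form_cont: "continuous_on ?X (\<lambda>q. ?v \<alpha> q)"
    if \<alpha>: "\<alpha> \<in> smooth_forms A p" for \<alpha>
  proof -
    have "continuous_on (?Q \<times> UNIV) (\<lambda>q. in_chart A c \<alpha> (fst q) (map (snd q) [0..<p] @ []))"
    proof (rule continuous_on_alt_forms)
      show "in_chart A c \<alpha> y \<in> alt_forms p" if "y \<in> ?Q" for y
        by (rule in_chart_alt_forms[OF c(1) _ smooth_forms_alt[OF \<alpha>]]) (use that r(2) in blast)
      show "continuous_on ?Q (\<lambda>y. in_chart A c \<alpha> y L)" if "length L = p" for L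
        by (rule continuous_on_subset[OF smooth_on_continuous_on[OF in_chart_smooth[OF \<alpha> c(1) that]] r(2)])
    qed simp_all
    then have "continuous_on (?Q \<times> UNIV) (\<lambda>q. ?v \<alpha> q)"
      by (simp only: append_Nil2)
    then show ?thesis by (rule continuous_on_subset) auto
  qed
  have metric_cont: "continuous_on ?X (\<lambda>q. metric_in_chart A c g (fst q) (snd q i) (snd q j))" for i j
    by (rule continuous_on_metric_in_chart[OF c(1) r(2)]) (auto intro: continuous_on_snd_nth)
  \<comment> \<open>One continuous function whose zeros are the \<open>\<phi>\<close>-frames.\<close>
  define h where "h q = (\<Sum>i<p. \<Sum>j<p. \<bar>metric_in_chart A c g (fst q) (snd q i) (snd q j) - (if i = j then 1 else 0)\<bar>)
      + \<bar>?v \<phi> q - 1\<bar>" for q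
  have h: "continuous_on ?X h"
    unfolding h_def
    by (intro continuous_on_add continuous_on_sum continuous_on_rabs continuous_on_diff continuous_on_const
        metric_cont form_cont[OF phi_smooth])
  define K where "K = ?X \<inter> h -` {0}"
  have K: "compact K"
  proof -
    have "closed K" unfolding K_def
      by (rule continuous_closed_preimage[OF h compact_imp_closed[OF X] closed_singleton])
    then show ?thesis by (rule compact_closed_subset[OF X]) (simp add: K_def)
  qed
  have h_frame: "h (y, w) = 0 \<longleftrightarrow> phi_frame (cinv c y) (map (from_chart A c (cinv c y)) (map w [0..<p]))" for y w
  proof -
    have "h (y, w) = 0 \<longleftrightarrow> (\<Sum>i<p. \<Sum>j<p. \<bar>metric_in_chart A c g y (w i) (w j) - (if i = j then 1 else 0)\<bar>) = 0
        \<and> in_chart A c \<phi> y (map w [0..<p]) = 1"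
      unfolding h_def fst_conv snd_conv by (subst add_nonneg_eq_0_iff) (auto intro!: sum_nonneg)
    also have "\<dots> \<longleftrightarrow> (\<forall>i<p. \<forall>j<p. metric_in_chart A c g y (w i) (w j) = (if i = j then 1 else 0))
        \<and> in_chart A c \<phi> y (map w [0..<p]) = 1"
      by (simp add: sum_nonneg_eq_0_iff sum_nonneg Ball_def)
    also have "\<dots> \<longleftrightarrow> phi_frame (cinv c y) (map (from_chart A c (cinv c y)) (map w [0..<p]))"
      by (simp add: phi_frame_def orthonormal_def metric_in_chart_def in_chart_def)
    finally show ?thesis .
  qed
  define d where "d q = ?v \<delta> q" for q
  have d: "continuous_on ?X d" unfolding d_def by (rule form_cont[OF \<delta>])
  have KX: "K \<subseteq> ?X" by (simp add: K_def)
  \<comment> \<open>The points over which some \<open>\<phi>\<close>-frame has value at most \<open>0\<close> form a compact set that misses \<open>x0\<close>.\<close>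
  define B where "B = fst ` (K \<inter> d -` {..0})"
  have "closed (K \<inter> d -` {..0})"
    by (rule continuous_closed_preimage[OF continuous_on_subset[OF d KX] compact_imp_closed[OF K] closed_atMost])
  then have "compact (K \<inter> d -` {..0})" by (rule compact_closed_subset[OF K]) blast
  then have "compact B" unfolding B_def
    by (intro compact_continuous_image continuous_on_fst continuous_on_id)
  then have "closed B" by (rule compact_imp_closed)
  have "y0 \<notin> B"
  proof
    assume "y0 \<in> B"
    then obtain w where w: "(y0, w) \<in> K" "d (y0, w) \<le> 0" unfolding B_def by auto
    then have "h (y0, w) = 0" by (simp add: K_def)
    then have "phi_frame x0 (map (from_chart A c x0) (map w [0..<p]))" using h_frame y0(2) by simp
    then have "\<delta> x0 (map (from_chart A c x0) (map w [0..<p])) > 0" by (rule pos)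
    then show False using w(2) y0(2) by (simp add: d_def in_chart_def)
  qed
  then obtain s0 where s0: "s0 > 0" "ball y0 s0 \<subseteq> - B"
    using \<open>closed B\<close> open_contains_ball[of "- B"] by blast
  define s where "s = min (s0 / 2) r"
  have s: "s > 0" "cball y0 s \<subseteq> ?Q" "cball y0 s \<inter> B = {}"
  proof -
    show "s > 0" using s0(1) r(1) by (simp add: s_def)
    show "cball y0 s \<subseteq> ?Q" by (rule subset_cball) (simp add: s_def)
    have "cball y0 s \<subseteq> ball y0 s0" using s0(1) by (auto simp: s_def)
    then show "cball y0 s \<inter> B = {}" using s0(2) by blast
  qed
  define K2 where "K2 = K \<inter> (cball y0 s \<times> UNIV)"
  have K2: "compact K2"
    unfolding K2_def by (rule compact_Int_closed[OF K]) (intro closed_Times closed_cball closed_UNIV)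
  have dpos: "d q > 0" if "q \<in> K2" for q
  proof (rule ccontr)
    assume "\<not> d q > 0"
    then have "fst q \<in> B" using that by (auto simp: B_def K2_def)
    moreover have "fst q \<in> cball y0 s" using that by (auto simp: K2_def)
    ultimately show False using s(3) by blast
  qed
  have K2X: "K2 \<subseteq> ?X" using KX by (auto simp: K2_def)
  define U where "U = cdom c \<inter> cmap c -` ball y0 s"
  have U: "open U" "x0 \<in> U"
  proof -
    show "open U" unfolding U_def
      by (rule continuous_open_preimage[OF homeomorphism_cont1[OF chart_homeomorphism[OF c(1)]] open_cdom[OF c(1)] open_ball])
    show "x0 \<in> U" using c(2) s(1) by (simp add: U_def y0_def)
  qed
  \<comment> \<open>Every \<open>\<phi>\<close>-frame over \<open>U\<close> comes from a point of the compact set \<open>K2\<close>.\<close>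
  have frame: "\<exists>q\<in>K2. \<forall>\<alpha>. ?v \<alpha> q = \<alpha> z es"
    if z: "z \<in> U" and es: "phi_frame z es" for z es
  proof -
    let ?y = "cmap c z"
    have zc: "z \<in> cdom c" and y: "?y \<in> cball y0 s" using z by (auto simp: U_def)
    have cz: "cinv c ?y = z" by (rule cinv_cmap[OF c(1) zc])
    have yQ: "?y \<in> ?Q" using y s(2) by blast
    define w where "w i = (if i < p then to_chart c z (es ! i) else 0)" for i
    have len: "length es = p" using es by (simp add: phi_frame_def)
    have w_es: "map (from_chart A c z) (map w [0..<p]) = es"
      using len from_to_chart[OF c(1) zc] by (intro nth_equalityI) (simp_all add: w_def)
    have "norm (w i) \<le> R" for i
    proof (cases "i < p")
      case True
      have "metric_in_chart A c g ?y (w i) (w i) = g z (es ! i) (es ! i)"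
        using True from_to_chart[OF c(1) zc] by (simp add: metric_in_chart_def cz w_def)
      also have "\<dots> = 1" using es True len by (simp add: phi_frame_def orthonormal_def)
      finally show ?thesis by (rule R(1)[OF yQ])
    qed (simp add: w_def R(2))
    moreover have "h (?y, w) = 0" using h_frame[of ?y w] es w_es by (simp add: cz)
    ultimately have "(?y, w) \<in> K2" using yQ y by (simp add: K2_def K_def)
    moreover have "in_chart A c \<alpha> ?y (map w [0..<p]) = \<alpha> z es" for \<alpha>
      using w_es by (simp add: in_chart_def cz)
    ultimately show ?thesis by (intro bexI[of _ "(?y, w)"]) simp_all
  qed
  have "\<exists>C\<ge>0. \<forall>z\<in>U. \<forall>es. phi_frame z es \<longrightarrow> 0 \<le> \<delta> z es \<and> \<bar>\<alpha> z es\<bar> \<le> C * \<delta> z es"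
    if \<alpha>: "\<alpha> \<in> smooth_forms A p" for \<alpha>
  proof (cases "K2 = {}")
    case True
    then show ?thesis using frame by (intro exI[of _ 0]) blast
  next
    case False
    let ?f = "\<lambda>q. \<bar>?v \<alpha> q\<bar> / d q"
    have "continuous_on K2 ?f"
      by (intro continuous_on_divide continuous_on_rabs continuous_on_subset[OF form_cont[OF \<alpha>] K2X]
          continuous_on_subset[OF d K2X] ballI) (use dpos in force)
    from continuous_attains_sup[OF K2 False this] obtain q0 where q0: "q0 \<in> K2" "\<forall>q\<in>K2. ?f q \<le> ?f q0" by blast
    show ?thesis
    proof (intro exI[of _ "?f q0"] conjI ballI allI impI)
      show "0 \<le> ?f q0" using dpos[OF q0(1)] by simp
      fix z es assume "z \<in> U" "phi_frame z es"
      then obtain q where q: "q \<in> K2" "\<And>\<alpha>. ?v \<alpha> q = \<alpha> z es"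
        using frame by blast
      have dq: "d q = \<delta> z es" by (simp add: d_def q(2))
      show "0 \<le> \<delta> z es" using dpos[OF q(1)] dq by simp
      have "?f q \<le> ?f q0" using q0(2) q(1) by blast
      then show "\<bar>\<alpha> z es\<bar> \<le> ?f q0 * \<delta> z es"
        using dpos[OF q(1)] q(2)[of \<alpha>] dq by (simp add: pos_divide_le_eq)
    qed
  qed
  then show ?thesis using U by blast
qed

section \<open>Separating plurisubharmonic functions\<close>

text \<open>A function \<open>f\<close> that separates \<open>x\<close> from \<open>K\<close>, plus a small multiple of a function \<open>u\<close> that is
  strictly plurisubharmonic at \<open>x\<close>, still separates. Choose \<open>c\<close> between a bound for the
  sum on \<open>K\<close> and its value at \<open>x\<close>. Composing with the convex increasing function that vanishes exactly up to
  \<open>c\<close> gives a nonnegative function which is zero near the hull and strict at \<open>x\<close>.\<close>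

lemma psh_separating_hull:
  assumes "x \<notin> hull_phi A g p \<phi> K" "x \<notin> core A g p \<phi>" "compact K"
  shows "\<exists>F\<in>PSH A g p \<phi>. (\<forall>z. F z \<ge> 0) \<and> strictly_psh_at A g p \<phi> F x \<and>
    (\<exists>W. open W \<and> hull_phi A g p \<phi> K \<subseteq> W \<and> (\<forall>z\<in>W. F z = 0))"
proof -
  obtain f where f: "f \<in> PSH A g p \<phi>" and "\<not> ereal (f x) \<le> (SUP y\<in>K. ereal (f y))"
    using assms(1) by (auto simp: hull_phi_def)
  then have "(SUP y\<in>K. ereal (f y)) < ereal (f x)" by simp
  then obtain r0 where r0: "(SUP y\<in>K. ereal (f y)) < r0" "r0 < ereal (f x)" using dense by blast
  then have "\<bar>r0\<bar> \<noteq> \<infinity>" by auto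
  then obtain r where "r0 = ereal r" by auto
  with r0 have r: "r < f x" "\<And>y. y \<in> K \<Longrightarrow> f y \<le> r"
    by (auto simp: less_imp_le dest!: SUP_lessD)
  obtain u where u: "u \<in> PSH A g p \<phi>" "strictly_psh_at A g p \<phi> u x" using assms(2) by (auto simp: core_def)
  have fs: "smooth_fun A f" and us: "smooth_fun A u" using f u by (auto simp: PSH_def)
  have "compact (u ` insert x K)"
    using assms(3) continuous_on_subset[OF smooth_fun_continuous_on[OF us]] by (intro compact_continuous_image) auto
  then obtain B where "\<forall>t\<in>u ` insert x K. norm t \<le> B" using compact_imp_bounded bounded_iff by metis
  then have B: "\<bar>u x\<bar> \<le> B" "\<And>y. y \<in> K \<Longrightarrow> \<bar>u y\<bar> \<le> B" by auto
  \<comment> \<open>Small enough that \<open>e u\<close> changes \<open>f\<close> on \<open>K\<close> and at \<open>x\<close> by less than a quarter of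
    the gap \<open>f x - r\<close>.\<close>
  define e where "e = (f x - r) / (4 * B + 4)"
  have B0: "B \<ge> 0" using B(1) by linarith
  have e: "e > 0" using r(1) B0 by (simp add: e_def)
  have eB: "4 * (e * B) < f x - r"
  proof -
    have "e * (4 * B + 4) = f x - r" using B0 by (simp add: e_def)
    then show ?thesis using e by (simp add: algebra_simps)
  qed
  define F0 where "F0 z = f z + e * u z" for z
  have F0s: "smooth_fun A F0"
    unfolding F0_def using smooth_fun_add[OF fs smooth_fun_mult[OF smooth_fun_const us]] .
  have dd: "dd_phi A g p \<phi> F0 z es = dd_phi A g p \<phi> f z es + e * dd_phi A g p \<phi> u z es" for z es
    unfolding F0_def[abs_def] by (rule dd_phi_linear[OF fs us])
  have F0: "F0 \<in> PSH A g p \<phi>"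
    using f u(1) e F0s by (simp add: PSH_iff dd)
  have F0x: "strictly_psh_at A g p \<phi> F0 x"
    unfolding strictly_psh_at_iff[OF F0s] dd
    using f u(2) e by (auto simp: PSH_iff strictly_psh_at_iff[OF us] add_nonneg_pos)
  define c0 where "c0 = r + e * B"
  have F0K: "F0 y \<le> c0" if "y \<in> K" for y
  proof -
    have "e * u y \<le> e * B" using B(2)[OF that] e by (intro mult_left_mono) auto
    then show ?thesis using r(2)[OF that] by (simp add: F0_def c0_def)
  qed
  have "e * (- B) \<le> e * u x" using B(1) e by (intro mult_left_mono) auto
  moreover have "0 \<le> e * B" using e B0 by simp
  ultimately have "c0 < F0 x" using eB by (simp add: F0_def c0_def)
  define c where "c = (c0 + F0 x) / 2"
  have c: "c0 < c" "c < F0 x" using \<open>c0 < F0 x\<close> by (auto simp: c_def)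
  define \<psi> where "\<psi> t = (t - c) * flat 1 (t - c)" for t
  define \<psi>1 where "\<psi>1 t = flat [:1, 1:] (t - c)" for t
  define \<psi>2 where "\<psi>2 t = flat [:0, 0, 0, 1:] (t - c)" for t
  have sub: "((\<lambda>t. t - c) has_real_derivative 1) (at t)" for t
    by (auto intro!: derivative_eq_intros)
  have d1: "(\<psi> has_real_derivative \<psi>1 t) (at t)" for t
    unfolding \<psi>_def[abs_def] \<psi>1_def using DERIV_chain2[OF times_flat_has_derivative sub, of t] by simp
  have d2: "(\<psi>1 has_real_derivative \<psi>2 t) (at t)" for t
    unfolding \<psi>1_def[abs_def] \<psi>2_def
    using DERIV_chain2[OF flat_has_derivative[of "[:1, 1:]"] sub, of t] by (simp add: pderiv_pCons)
  have pos: "\<psi> t \<ge> 0" "\<psi>1 t \<ge> 0" "\<psi>2 t \<ge> 0" for t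
    by (auto simp: \<psi>_def \<psi>1_def \<psi>2_def flat_def)
  have "\<psi>1 (F0 x) > 0" using c(2) by (simp add: \<psi>1_def flat_def add_pos_pos)
  have Fs: "smooth_fun A (\<lambda>z. \<psi> (F0 z))"
    unfolding \<psi>_def by (intro smooth_fun_mult smooth_fun_flat smooth_fun_diff F0s smooth_fun_const)
  have W: "open {z. F0 z < c}"
    using open_Collect_less[OF smooth_fun_continuous_on[OF F0s] continuous_on_const] .
  have "hull_phi A g p \<phi> K \<subseteq> {z. F0 z < c}"
  proof
    fix z assume "z \<in> hull_phi A g p \<phi> K"
    then have "ereal (F0 z) \<le> (SUP y\<in>K. ereal (F0 y))" using F0 by (simp add: hull_phi_def)
    also have "\<dots> \<le> ereal c0" by (rule SUP_least) (simp add: F0K)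
    finally show "z \<in> {z. F0 z < c}" using c(1) by simp
  qed
  moreover have "\<forall>z\<in>{z. F0 z < c}. \<psi> (F0 z) = 0" by (simp add: \<psi>_def flat_def)
  ultimately have "\<exists>W. open W \<and> hull_phi A g p \<phi> K \<subseteq> W \<and> (\<forall>z\<in>W. \<psi> (F0 z) = 0)" using W by blast
  moreover have "strictly_psh_at A g p \<phi> (\<lambda>z. \<psi> (F0 z)) x"
    by (rule PSH_compose(2)[OF F0 Fs d1 d2 pos(2,3) F0x \<open>\<psi>1 (F0 x) > 0\<close>])
  moreover have "(\<lambda>z. \<psi> (F0 z)) \<in> PSH A g p \<phi>"
    by (rule PSH_compose(1)[OF F0 Fs d1 d2 pos(2,3)])
  ultimately show ?thesis using pos(1) by (intro bexI[of _ "\<lambda>z. \<psi> (F0 z)"]) simp_all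
qed

end

section \<open>The support theorem\<close>

theorem lemma3p2:
  fixes A :: "('a::{t2_space,second_countable_topology}, 'n::finite) chart set"
    and g :: "('a, 'n) metric"
    and \<phi> :: "('a, 'n) form"
    and p :: nat
    and K :: "'a set"
    and T :: "('a, 'n) form \<Rightarrow> real"
  assumes "calibrated_manifold A g p \<phi>"
    and "parallel_form A g p \<phi>"
    and "connected (UNIV :: 'a set)"
    and "\<not> compact (UNIV :: 'a set)"
    and "compact K"
    and "current A p T"
    and "compact (current_supp A p T)"
    and "positive_current A g p \<phi> T"
    and "nonpos_on A (del_phi_del A g p \<phi> T) (- hull_phi A g p \<phi> K)"
  shows "current_supp A p T \<subseteq> hull_phi A g p \<phi> K \<union> core A g p \<phi>"
proof (rule subsetI, rule ccontr)
  interpret calibrated_geometry A g p \<phi>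
    using assms(1) by unfold_locales (simp_all add: calibrated_manifold_def)
  let ?S = "current_supp A p T"
  note T = assms(6)
  fix x assume xS: "x \<in> ?S" and "x \<notin> hull_phi A g p \<phi> K \<union> core A g p \<phi>"
  then have "x \<notin> hull_phi A g p \<phi> K" "x \<notin> core A g p \<phi>" by auto
  from psh_separating_hull[OF this assms(5)] obtain F where F: "F \<in> PSH A g p \<phi>" "\<forall>z. F z \<ge> 0"
      "strictly_psh_at A g p \<phi> F x"
    and "\<exists>W. open W \<and> hull_phi A g p \<phi> K \<subseteq> W \<and> (\<forall>z\<in>W. F z = 0)" by (elim bexE conjE)
  then obtain W where W: "open W" "hull_phi A g p \<phi> K \<subseteq> W" "\<forall>z\<in>W. F z = 0" by (elim exE conjE)
  have Fs: "smooth_fun A F" using F(1) by (simp add: PSH_def)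
  obtain c V where c: "smooth_fun A c" "\<forall>z. 0 \<le> c z \<and> c z \<le> 1" "compact (closure {z. c z \<noteq> 0})"
    and V: "open V" "?S \<subseteq> V" "\<forall>z\<in>V. c z = 1"
    using smooth_cutoff_exists[OF assms(7) open_UNIV subset_UNIV] by (elim exE conjE)
  let ?\<delta> = "dd_phi A g p \<phi> F"
  let ?c\<delta> = "\<lambda>z vs. c z * ?\<delta> z vs"
  have \<delta>: "?\<delta> \<in> smooth_forms A p" by (rule dd_phi_smooth_forms[OF Fs])
  have c\<delta>: "?c\<delta> \<in> test_forms A p" by (rule test_forms_cutoff[OF c(1,3) \<delta>])
  \<comment> \<open>\<open>F\<close> need not have compact support, but \<open>c F\<close> has, and \<open>dd\<^sup>\<phi>\<close> of the two functions
    agree near the support of \<open>T\<close>.\<close>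
  have "T ?c\<delta> \<le> 0"
  proof -
    let ?h = "\<lambda>z. c z * F z"
    have hs: "smooth_fun A ?h" by (rule smooth_fun_mult[OF c(1) Fs])
    have cl: "closure {z. ?h z \<noteq> 0} \<subseteq> closure {z. c z \<noteq> 0}" by (rule closure_mono) auto
    have "compact (closure {z. ?h z \<noteq> 0})" by (rule compact_closed_subset[OF c(3) closed_closure cl])
    moreover have "closure {z. ?h z \<noteq> 0} \<subseteq> - W"
      by (rule closure_minimal) (use W(1,3) in auto)
    ultimately have "del_phi_del A g p \<phi> T ?h \<le> 0"
      using assms(9) hs F(2) c(2) W(2) unfolding nonpos_on_def by (auto 0 3)
    moreover have "del_phi_del A g p \<phi> T ?h = T ?c\<delta>"
    proof -
      \<comment> \<open>The cutoff function chosen in the definition of \<open>extend_current\<close>; it need not be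
        nonnegative, so it is exchanged for \<open>c\<close>.\<close>
      define \<eta> where "\<eta> = (SOME \<eta>. cutoff A ?S \<eta>)"
      have "cutoff A ?S c" using c V by (auto simp: cutoff_def)
      then have "cutoff A ?S \<eta>" unfolding \<eta>_def by (rule someI[of "cutoff A ?S"])
      then obtain U where \<eta>: "smooth_fun A \<eta>" "compact (closure {x. \<eta> x \<noteq> 0})"
        and U: "open U" "?S \<subseteq> U" "\<forall>z\<in>U. \<eta> z = 1" unfolding cutoff_def by (elim exE conjE)
      have "T (\<lambda>z vs. \<eta> z * dd_phi A g p \<phi> ?h z vs) = T ?c\<delta>"
      proof (rule current_eq_near_supp[OF T test_forms_cutoff[OF \<eta> dd_phi_smooth_forms[OF hs]] c\<delta>])
        show "open (U \<inter> V)" using U(1) V(1) by blast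
        show "?S \<subseteq> U \<inter> V" using U(2) V(2) by blast
        fix z assume z: "z \<in> U \<inter> V"
        have "dd_phi A g p \<phi> ?h z = ?\<delta> z" by (rule dd_phi_local[OF V(1)]) (use z V(3) in auto)
        then show "(\<lambda>vs. \<eta> z * dd_phi A g p \<phi> ?h z vs) = (\<lambda>vs. c z * ?\<delta> z vs)" using z U(3) V(3) by simp
      qed
      then show ?thesis by (simp add: del_phi_del_def extend_current_def \<eta>_def)
    qed
    ultimately show ?thesis by simp
  qed
  have \<delta>pos: "0 \<le> ?\<delta> z es" if "phi_frame z es" for z es using F(1) that by (simp add: PSH_iff)
  have "\<exists>U. open U \<and> x \<in> U \<and> (\<forall>\<alpha>\<in>smooth_forms A p. \<exists>C\<ge>0. \<forall>z\<in>U. \<forall>es. phi_frame z es \<longrightarrow>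
      0 \<le> ?\<delta> z es \<and> \<bar>\<alpha> z es\<bar> \<le> C * ?\<delta> z es)"
    by (rule strictly_positive_form_dominates[OF \<delta>]) (use F(3) strictly_psh_at_iff[OF Fs] in blast)
  then obtain U where U: "open U" "x \<in> U" and dom: "\<forall>\<alpha>\<in>smooth_forms A p. \<exists>C\<ge>0. \<forall>z\<in>U. \<forall>es. phi_frame z es \<longrightarrow>
      0 \<le> ?\<delta> z es \<and> \<bar>\<alpha> z es\<bar> \<le> C * ?\<delta> z es" by (elim exE conjE)
  have "T \<alpha> = 0" if \<alpha>: "\<alpha> \<in> test_forms A p" and supp: "form_supp \<alpha> \<subseteq> U \<inter> V" for \<alpha>
  proof -
    obtain C where C: "C \<ge> 0" "\<forall>z\<in>U. \<forall>es. phi_frame z es \<longrightarrow> 0 \<le> ?\<delta> z es \<and> \<bar>\<alpha> z es\<bar> \<le> C * ?\<delta> z es"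
      using bspec[OF dom test_formsD[OF \<alpha>]] by (elim exE conjE)
    \<comment> \<open>Both \<open>C c \<delta> + \<alpha>\<close> and \<open>C c \<delta> - \<alpha>\<close> are positive forms.\<close>
    have "0 \<le> C * T ?c\<delta> + s * T \<alpha>" if s: "\<bar>s\<bar> = 1" for s
    proof -
      let ?\<beta> = "\<lambda>z vs. C * ?c\<delta> z vs + s * \<alpha> z vs"
      have 1: "(\<lambda>z vs. C * ?c\<delta> z vs) \<in> test_forms A p" by (rule test_forms_cmult[OF c\<delta>])
      have 2: "(\<lambda>z vs. s * \<alpha> z vs) \<in> test_forms A p" by (rule test_forms_cmult[OF \<alpha>])
      have \<beta>: "?\<beta> \<in> test_forms A p" by (rule test_forms_add[OF 1 2])
      have "0 \<le> ?\<beta> z es" if es: "phi_frame z es" for z es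
      proof (cases "z \<in> U \<inter> V")
        case True
        then have "\<bar>s * \<alpha> z es\<bar> \<le> C * ?\<delta> z es" using C(2) es s by (simp add: abs_mult)
        then show ?thesis using True V(3) by simp
      next
        case False
        then have "\<alpha> z es = 0" using supp form_supp_subset[of \<alpha>] by blast
        then show ?thesis using C(1) c(2) \<delta>pos[OF es] by simp
      qed
      then have "positive_form g p \<phi> ?\<beta>" by (simp add: positive_form_iff[OF test_formsD[OF \<beta>]])
      then have "0 \<le> T ?\<beta>" using assms(8) \<beta> by (simp add: positive_current_def)
      also have "T ?\<beta> = C * T ?c\<delta> + s * T \<alpha>"
        using current_add[OF T 1 2] current_cmult[OF T c\<delta>] current_cmult[OF T \<alpha>] by simp
      finally show ?thesis .
    qed
    from this[of 1] this[of "-1"] have "\<bar>T \<alpha>\<bar> \<le> C * T ?c\<delta>" by simp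
    also have "\<dots> \<le> 0" using C(1) \<open>T ?c\<delta> \<le> 0\<close> by (rule mult_nonneg_nonpos)
    finally show ?thesis by simp
  qed
  moreover have "x \<in> U \<inter> V" "open (U \<inter> V)" using U V xS by auto
  ultimately have "x \<notin> ?S" unfolding current_supp_def by blast
  then show False using xS by blast
qed

end
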